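(* Let $\Gamma\subset\mathrm{PSL}_2(\mathbb R)$ be a torsion-free cocompact Fuchsian group of genus $g\ge2$, and $V$ any vertex operator algebra of CFT-type. Then for every even $k=2n\ge0$, $$\dim M_k(V,\Gamma)=\sum_{j=0}^{n-1}\dim M_{k-2j}(\Gamma)\,\dim V_j+\dim QP_n(V).$$
   Context: A VOA $V=\bigoplus_nV_n$ has Virasoro modes $L(n)$, with $L(0)=n$ on $V_n$; CFT-type means $V_n=0$ for $n<0$ and $V_0=\mathbb C\mathbf 1$. $F_NV=\bigoplus_{n\le N}V_n$. $QP_n(V):=\ker(L(1):V_n\to V_{n-1})$. Elements of $\Gamma$ are lifted to $\mathrm{SL}_2(\mathbb R)$ (full preimage); the genus of $\Gamma$ is that of $\Gamma\backslash\mathbb H$. For $\gamma=\begin{pmatrix}a&b\\c&d\end{pmatrix}$: $j(\gamma,\tau)=c\tau+d$, $f|_k\gamma(\tau)=j(\gamma,\tau)^{-k}f(\gamma\tau)$, $K(\gamma,\tau)=e^{-c\,j(\gamma,\tau)L(1)}j(\gamma,\tau)^{-2L(0)}$, $f\Vert_k\gamma(\tau)=j(\gamma,\tau)^{-k}K(\gamma,\tau)^{-1}f(\gamma\tau)$. For such $\Gamma$ (no cusps, no elliptic points): $M_k(\Gamma)$ is the space of holomorphic $f:\mathbb H\to\mathbb C$ with $f|_k\gamma=f$ for all $\gamma\in\Gamma$, and $M_k(V,\Gamma)$ is the space of holomorphic $f:\mathbb H\to F_NV$ (some $N$) with $f\Vert_k\gamma=f$ for all $\gamma\in\Gamma$.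 *)

theory Defs
  imports
    "HOL-Complex_Analysis.Complex_Analysis"
    "HOL-Homology.Homology"
    "HOL-Library.Function_Algebras"
    "HOL-Library.Groups_Big_Fun"
begin

section \<open>Subspaces of complex vector spaces\<close>

text \<open>The library function \<^const>\<open>vector_space.dim\<close> returns 0 on infinite-dimensional
  subspaces, so finite-dimensionality has to be expressed separately.\<close>

definition finite_dim_subspace :: "(complex \<Rightarrow> 'v::ab_group_add \<Rightarrow> 'v) \<Rightarrow> 'v set \<Rightarrow> bool" where
  "finite_dim_subspace scl S \<longleftrightarrow>
     module.subspace scl S \<and> (\<exists>B. finite B \<and> module.span scl B = S)"

definition fun_scale :: "('c \<Rightarrow> 'v \<Rightarrow> 'v) \<Rightarrow> 'c \<Rightarrow> ('a \<Rightarrow> 'v) \<Rightarrow> 'a \<Rightarrow> 'v" where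
  "fun_scale scl c f = (\<lambda>x. scl c (f x))"

lemma vector_space_fun_scale:
  assumes "vector_space (scl :: 'c::field \<Rightarrow> 'v::ab_group_add \<Rightarrow> 'v)"
  shows "vector_space (fun_scale scl :: 'c \<Rightarrow> ('a \<Rightarrow> 'v) \<Rightarrow> 'a \<Rightarrow> 'v)"
proof -
  interpret vector_space scl by (fact assms)
  show ?thesis
    by unfold_locales
      (simp_all add: fun_scale_def fun_eq_iff scale_right_distrib scale_left_distrib)
qed

lemma vector_space_complex: "vector_space ((*) :: complex \<Rightarrow> complex \<Rightarrow> complex)"
  by unfold_locales (simp_all add: algebra_simps)

text \<open>Holomorphy of a map which takes values in a finite-dimensional subspace of an abstract
  complex vector space: every linear coordinate is holomorphic.\<close>

definition vholomorphic_on ::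
    "(complex \<Rightarrow> 'v::ab_group_add \<Rightarrow> 'v) \<Rightarrow> (complex \<Rightarrow> 'v) \<Rightarrow> complex set \<Rightarrow> bool" where
  "vholomorphic_on scl f S \<longleftrightarrow>
     (\<forall>\<phi>. Vector_Spaces.linear scl (*) \<phi> \<longrightarrow> (\<lambda>z. \<phi> (f z)) holomorphic_on S)"


section \<open>Quotient spaces\<close>

definition quotient_topology :: "'a topology \<Rightarrow> ('a \<Rightarrow> 'b) \<Rightarrow> 'b topology" where
  "quotient_topology X q =
     topology (\<lambda>U. U \<subseteq> q ` topspace X \<and> openin X {x \<in> topspace X. q x \<in> U})"

lemma openin_quotient_topology:
  "openin (quotient_topology X q) U \<longleftrightarrow>
     U \<subseteq> q ` topspace X \<and> openin X {x \<in> topspace X. q x \<in> U}"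
proof -
  have "istopology (\<lambda>U. U \<subseteq> q ` topspace X \<and> openin X {x \<in> topspace X. q x \<in> U})"
    unfolding istopology_def
  proof (intro conjI allI impI)
    fix S T
    assume S: "S \<subseteq> q ` topspace X \<and> openin X {x \<in> topspace X. q x \<in> S}"
      and T: "T \<subseteq> q ` topspace X \<and> openin X {x \<in> topspace X. q x \<in> T}"
    then show "S \<inter> T \<subseteq> q ` topspace X" by blast
    have "{x \<in> topspace X. q x \<in> S \<inter> T} =
        {x \<in> topspace X. q x \<in> S} \<inter> {x \<in> topspace X. q x \<in> T}" by blast
    then show "openin X {x \<in> topspace X. q x \<in> S \<inter> T}" using S T by auto
  next
    fix \<K>
    assume K: "\<forall>K\<in>\<K>. K \<subseteq> q ` topspace X \<and> openin X {x \<in> topspace X. q x \<in> K}"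
    then show "\<Union>\<K> \<subseteq> q ` topspace X" by blast
    have "{x \<in> topspace X. q x \<in> \<Union>\<K>} = (\<Union>K\<in>\<K>. {x \<in> topspace X. q x \<in> K})" by blast
    then show "openin X {x \<in> topspace X. q x \<in> \<Union>\<K>}" using K by auto
  qed
  then show ?thesis
    by (simp add: quotient_topology_def topology_inverse')
qed

lemma topspace_quotient_topology: "topspace (quotient_topology X q) = q ` topspace X"
proof -
  have "{x \<in> topspace X. q x \<in> q ` topspace X} = topspace X" by blast
  then have "openin (quotient_topology X q) (q ` topspace X)"
    by (simp add: openin_quotient_topology)
  then show ?thesis
    by (metis openin_quotient_topology openin_subset openin_topspace subset_antisym)
qed

lemma quotient_map_quotient_topology: "quotient_map X (quotient_topology X q) q"
  by (simp add: quotient_map_def openin_quotient_topology topspace_quotient_topology)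


section \<open>Fuchsian groups\<close>

definition upper_half_plane :: "complex set" where
  "upper_half_plane = {\<tau>. 0 < Im \<tau>}"

definition SL2R :: "(real^2^2) monoid" where
  "SL2R = \<lparr>carrier = {A. det A = 1}, monoid.mult = (**), one = mat 1\<rparr>"

definition pm_one :: "(real^2^2) set" where
  "pm_one = {mat 1, - mat 1}"

definition PSL2R :: "(real^2^2) set monoid" where
  "PSL2R = SL2R Mod pm_one"

definition PSL2R_topology :: "(real^2^2) set topology" where
  "PSL2R_topology =
     quotient_topology (top_of_set (carrier SL2R)) (\<lambda>A. pm_one #>\<^bsub>SL2R\<^esub> A)"

text \<open>Elements of \<^const>\<open>PSL2R\<close> are the cosets \<open>{A, -A}\<close>, so the full preimage in
  \<^const>\<open>SL2R\<close> of a subset of \<^const>\<open>PSL2R\<close> is its union.\<close>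

definition SL2R_lift :: "(real^2^2) set set \<Rightarrow> (real^2^2) set" where
  "SL2R_lift \<Gamma> = \<Union>\<Gamma>"

definition aut_factor :: "real^2^2 \<Rightarrow> complex \<Rightarrow> complex" where
  "aut_factor \<gamma> \<tau> = of_real (\<gamma>$2$1) * \<tau> + of_real (\<gamma>$2$2)"

definition moebius_action :: "real^2^2 \<Rightarrow> complex \<Rightarrow> complex" where
  "moebius_action \<gamma> \<tau> =
     moebius (of_real (\<gamma>$1$1)) (of_real (\<gamma>$1$2)) (of_real (\<gamma>$2$1)) (of_real (\<gamma>$2$2)) \<tau>"

definition fuchsian :: "(real^2^2) set set \<Rightarrow> bool" where
  "fuchsian \<Gamma> \<longleftrightarrow>
     subgroup \<Gamma> PSL2R \<and> subtopology PSL2R_topology \<Gamma> = discrete_topology \<Gamma>"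

definition torsion_free :: "(real^2^2) set set \<Rightarrow> bool" where
  "torsion_free \<Gamma> \<longleftrightarrow>
     (\<forall>\<gamma>\<in>\<Gamma>. \<forall>m::nat. 0 < m \<longrightarrow> \<gamma> [^]\<^bsub>PSL2R\<^esub> m = \<one>\<^bsub>PSL2R\<^esub> \<longrightarrow> \<gamma> = \<one>\<^bsub>PSL2R\<^esub>)"

definition orbit_of :: "(real^2^2) set set \<Rightarrow> complex \<Rightarrow> complex set" where
  "orbit_of \<Gamma> \<tau> = (\<lambda>\<gamma>. moebius_action \<gamma> \<tau>) ` SL2R_lift \<Gamma>"

definition orbit_surface :: "(real^2^2) set set \<Rightarrow> complex set topology" where
  "orbit_surface \<Gamma> = quotient_topology (top_of_set upper_half_plane) (orbit_of \<Gamma>)"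

definition cocompact :: "(real^2^2) set set \<Rightarrow> bool" where
  "cocompact \<Gamma> \<longleftrightarrow> compact_space (orbit_surface \<Gamma>)"

text \<open>Genus of a closed connected orientable surface: the first integral homology is free
  abelian of rank \<open>2g\<close>.\<close>

definition has_genus :: "'a topology \<Rightarrow> nat \<Rightarrow> bool" where
  "has_genus X g \<longleftrightarrow> homology_group 1 X \<cong> free_Abelian_group {..<2 * g}"


section \<open>Vertex operator algebras\<close>

text \<open>The component \<open>voa_mode A u n\<close> is the operator \<open>u\<^sub>(\<^sub>n\<^sub>)\<close> in
  \<open>Y(u,z) = \<Sum>\<^sub>n u\<^sub>(\<^sub>n\<^sub>) z\<^sup>-\<^sup>n\<^sup>-\<^sup>1\<close>. The underlying space of \<open>A\<close> is the whole type \<open>'v\<close>.\<close>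

record 'v voa =
  voa_scale :: "complex \<Rightarrow> 'v \<Rightarrow> 'v"
  voa_grade :: "int \<Rightarrow> 'v set"
  voa_mode :: "'v \<Rightarrow> int \<Rightarrow> 'v \<Rightarrow> 'v"
  voa_vacuum :: 'v
  voa_conformal :: 'v
  voa_charge :: complex

text \<open>\<open>Y(\<omega>,z) = \<Sum>\<^sub>n L(n) z\<^sup>-\<^sup>n\<^sup>-\<^sup>2\<close>\<close>

definition Vir :: "'v voa \<Rightarrow> int \<Rightarrow> 'v \<Rightarrow> 'v" where
  "Vir A n = voa_mode A (voa_conformal A) (n + 1)"

definition graded_decomp :: "('v::ab_group_add) voa \<Rightarrow> 'v \<Rightarrow> (int \<Rightarrow> 'v) \<Rightarrow> bool" where
  "graded_decomp A v u \<longleftrightarrow>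
     (\<forall>n. u n \<in> voa_grade A n) \<and> finite {n. u n \<noteq> 0} \<and> v = Sum_any u"

text \<open>\<^const>\<open>Sum_any\<close> sums over the support of its argument, which is finite in all instances
  below. The axiom \<open>borcherds\<close> is the Jacobi identity for formal series, written out coefficient
  by coefficient.\<close>

locale vertex_operator_algebra =
  fixes A :: "('v::ab_group_add) voa"
  assumes vector_space_scale: "vector_space (voa_scale A)"
    and grade_finite_dim: "finite_dim_subspace (voa_scale A) (voa_grade A n)"
    and grade_bounded_below: "\<exists>N. \<forall>n<N. voa_grade A n = {0}"
    and grade_direct_sum: "\<exists>!u. graded_decomp A v u"
    and mode_linear_left:
      "Vector_Spaces.linear (voa_scale A) (voa_scale A) (\<lambda>u. voa_mode A u n v)"
    and mode_linear_right:
      "Vector_Spaces.linear (voa_scale A) (voa_scale A) (voa_mode A u n)"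
    and truncation: "\<exists>N. \<forall>n\<ge>N. voa_mode A u n v = 0"
    and vacuum_mode: "voa_mode A (voa_vacuum A) n v = (if n = - 1 then v else 0)"
    and creation: "voa_mode A u (- 1) (voa_vacuum A) = u"
    and creation_nonneg: "n \<ge> 0 \<Longrightarrow> voa_mode A u n (voa_vacuum A) = 0"
    and borcherds:
      "Sum_any (\<lambda>i::nat. voa_scale A (of_int m gchoose i)
          (voa_mode A (voa_mode A u (l + int i) v) (m + n - int i) w)) =
       Sum_any (\<lambda>i::nat. voa_scale A ((- 1) ^ i * (of_int l gchoose i))
          (voa_mode A u (l + m - int i) (voa_mode A v (n + int i) w)
           - voa_scale A ((- 1) powi l)
               (voa_mode A v (l + n - int i) (voa_mode A u (m + int i) w))))"
    and virasoro:
      "Vir A m (Vir A n v) - Vir A n (Vir A m v) =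
         voa_scale A (of_int (m - n)) (Vir A (m + n) v)
         + voa_scale A (if m + n = 0 then of_int (m^3 - m) / 12 * voa_charge A else 0) v"
    and L_minus_one_derivative:
      "voa_mode A (Vir A (- 1) u) n v = voa_scale A (- of_int n) (voa_mode A u (n - 1) v)"
    and L_zero_grade: "v \<in> voa_grade A n \<Longrightarrow> Vir A 0 v = voa_scale A (of_int n) v"
    and vacuum_grade: "voa_vacuum A \<in> voa_grade A 0"
    and conformal_grade: "voa_conformal A \<in> voa_grade A 2"

locale cft_type_voa = vertex_operator_algebra A for A :: "('v::ab_group_add) voa" +
  assumes grade_negative: "n < 0 \<Longrightarrow> voa_grade A n = {0}"
    and grade_zero: "voa_grade A 0 = module.span (voa_scale A) {voa_vacuum A}"

definition voa_filtration :: "('v::ab_group_add) voa \<Rightarrow> int \<Rightarrow> 'v set" where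
  "voa_filtration A N = module.span (voa_scale A) (\<Union>n\<in>{..N}. voa_grade A n)"

definition quasi_primary :: "('v::ab_group_add) voa \<Rightarrow> int \<Rightarrow> 'v set" where
  "quasi_primary A n = {v \<in> voa_grade A n. Vir A 1 v = 0}"

definition grade_component :: "('v::ab_group_add) voa \<Rightarrow> 'v \<Rightarrow> int \<Rightarrow> 'v" where
  "grade_component A v = (THE u. graded_decomp A v u)"

text \<open>\<open>x\<^sup>-\<^sup>2\<^sup>L\<^sup>(\<^sup>0\<^sup>)\<close>\<close>

definition pow_neg_2L0 :: "('v::ab_group_add) voa \<Rightarrow> complex \<Rightarrow> 'v \<Rightarrow> 'v" where
  "pow_neg_2L0 A x v = Sum_any (\<lambda>n. voa_scale A (x powi (- 2 * n)) (grade_component A v n))"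

text \<open>\<open>e\<^sup>x\<^sup>L\<^sup>(\<^sup>1\<^sup>)\<close>; the sum is finite since \<open>L(1)\<close> lowers the grading, which is bounded below.\<close>

definition exp_L1 :: "('v::ab_group_add) voa \<Rightarrow> complex \<Rightarrow> 'v \<Rightarrow> 'v" where
  "exp_L1 A x v = Sum_any (\<lambda>m::nat. voa_scale A (x ^ m / fact m) ((Vir A 1 ^^ m) v))"

definition K_factor :: "('v::ab_group_add) voa \<Rightarrow> real^2^2 \<Rightarrow> complex \<Rightarrow> 'v \<Rightarrow> 'v" where
  "K_factor A \<gamma> \<tau> v =
     exp_L1 A (- of_real (\<gamma>$2$1) * aut_factor \<gamma> \<tau>) (pow_neg_2L0 A (aut_factor \<gamma> \<tau>) v)"


section \<open>Modular forms\<close>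

definition slash :: "int \<Rightarrow> real^2^2 \<Rightarrow> (complex \<Rightarrow> complex) \<Rightarrow> complex \<Rightarrow> complex" where
  "slash k \<gamma> f \<tau> = aut_factor \<gamma> \<tau> powi (- k) * f (moebius_action \<gamma> \<tau>)"

definition voa_slash ::
    "('v::ab_group_add) voa \<Rightarrow> int \<Rightarrow> real^2^2 \<Rightarrow> (complex \<Rightarrow> 'v) \<Rightarrow> complex \<Rightarrow> 'v" where
  "voa_slash A k \<gamma> f \<tau> =
     voa_scale A (aut_factor \<gamma> \<tau> powi (- k))
       (inv_into UNIV (K_factor A \<gamma> \<tau>) (f (moebius_action \<gamma> \<tau>)))"

text \<open>A function on the upper half-plane is represented by its extension by 0 to the whole
  plane. There are no conditions at cusps: these spaces are meant for groups without cusps.\<close>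

definition modular_forms :: "int \<Rightarrow> (real^2^2) set set \<Rightarrow> (complex \<Rightarrow> complex) set" where
  "modular_forms k \<Gamma> =
     {f. f holomorphic_on upper_half_plane \<and> (\<forall>\<tau>. \<tau> \<notin> upper_half_plane \<longrightarrow> f \<tau> = 0) \<and>
         (\<forall>\<gamma>\<in>SL2R_lift \<Gamma>. \<forall>\<tau>\<in>upper_half_plane. slash k \<gamma> f \<tau> = f \<tau>)}"

definition voa_modular_forms ::
    "('v::ab_group_add) voa \<Rightarrow> int \<Rightarrow> (real^2^2) set set \<Rightarrow> (complex \<Rightarrow> 'v) set" where
  "voa_modular_forms A k \<Gamma> =
     {f. (\<exists>N. \<forall>\<tau>\<in>upper_half_plane. f \<tau> \<in> voa_filtration A N) \<and>
         vholomorphic_on (voa_scale A) f upper_half_plane \<and>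
         (\<forall>\<tau>. \<tau> \<notin> upper_half_plane \<longrightarrow> f \<tau> = 0) \<and>
         (\<forall>\<gamma>\<in>SL2R_lift \<Gamma>. \<forall>\<tau>\<in>upper_half_plane. voa_slash A k \<gamma> f \<tau> = f \<tau>)}"

end

theory Submission
  imports Defs
begin

text \<open>Write \<open>f = \<Sum>\<^sub>m f\<^sub>m\<close> with \<open>f\<^sub>m\<close> valued in \<open>V\<^sub>m\<close>. The inverse of \<open>K(\<gamma>,\<tau>)\<close> mixes the
components only downwards, through powers of \<open>L(1)\<close>. Hence the component of highest degree \<open>p\<close> of a
form of weight \<open>k\<close> is an ordinary automorphic form of weight \<open>k - 2p\<close> with coefficients in \<open>V\<^sub>p\<close>, and
forms are determined successively by their top components. Filtering
\<open>M\<^sub>k(V,\<Gamma>)\<close> by the degree \<open>p\<close> of the top component, rank-nullity reduces the dimension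
formula to computing which elements of \<open>M\<^bsub>k-2p\<^esub>(\<Gamma>) \<otimes> V\<^sub>p\<close> occur as top components. With
\<open>k = 2n\<close> there are three cases.

For \<open>p > n\<close> the weight \<open>k - 2p\<close> is negative and nothing occurs: \<open>|F| (Im \<tau>)\<^bsup>w/2\<^esup>\<close>
is invariant, attains its maximum because the quotient is compact, and for negative weight \<open>w\<close> the
maximum modulus principle forces \<open>F = 0\<close> (\<open>automorphic_negative_weight_zero\<close>).

For \<open>p < n\<close> the weight \<open>w = k - 2p\<close> is positive and everything occurs: for \<open>F \<in> M\<^sub>w(\<Gamma>)\<close> and
\<open>v \<in> V\<^sub>p\<close> the finite sum \<open>\<Sum>\<^sub>m (-1)\<^sup>m F\<^bsup>(m)\<^esup> / (m! (w)\<^sub>m) \<otimes> L(1)\<^sup>m v\<close> is a form with top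
component \<open>F \<otimes> v\<close>. This is the transformation law of Kuznetsov and Cohen for the derivatives of
\<open>F\<close>, in which the denominators \<open>(w)\<^sub>m\<close> require \<open>w > 0\<close>
(\<open>normalized_derivative_moebius\<close>, \<open>kuznetsov_lift_in_filtered_forms\<close>).

For \<open>p = n\<close> the weight is zero, so the top component is a constant vector \<open>v \<in> V\<^sub>n\<close>. If \<open>L(1) v\<close> did
not vanish, a linear functional applied to the next component would yield a holomorphic \<open>h\<close> with
\<open>h(\<gamma>\<tau>) = j\<^sup>2 h(\<tau>) - c j\<close>, that is, a holomorphic connection on the canonical bundle of the
quotient. None exists (\<open>no_affine_weight_two_form\<close>), so exactly the quasi-primary \<open>v\<close> occur. The reason
is the Gauss-Bonnet theorem, which enters here in the following form. If \<open>P' = -2h\<close>, then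
\<open>\<phi> = ln Im \<tau> + Re P\<close> changes only by an additive constant under each
\<open>\<gamma>\<close>, so \<open>\<phi>(z) - \<phi>(w)\<close> is an invariant antisymmetric function of two points. Integrated
over pairs of points at bounded distance, modulo \<open>\<Gamma>\<close>, it must give zero by antisymmetry
(\<open>antisymmetric_kernel_integral_zero\<close>). But \<open>\<phi>\<close> is
strictly superharmonic with constant hyperbolic Laplacian: its average over a hyperbolic disc is smaller
than its value at the centre, by an amount that is the same for all discs of a given radius
(\<open>integral_near_superharmonic\<close>).

Finite-dimensionality of the scalar spaces is a Schwarz lemma argument: a form that vanishes to high
order at the centres of finitely many discs covering the quotient is much smaller than its own maximum
(\<open>automorphic_determined_by_jets\<close>).\<close>

section \<open>Linear algebra of finite-dimensional subspaces\<close>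

text \<open>Bases are often given as families. For an injective family the absence of nontrivial relations is independence of
the image, and injectivity itself follows because two equal members would be related.\<close>

lemma (in vector_space) independent_family:
  assumes "finite I" and "\<And>a. (\<Sum>i\<in>I. scale (a i) (e i)) = 0 \<Longrightarrow> \<forall>i\<in>I. a i = 0"
  shows "inj_on e I" "independent (e ` I)"
proof -
  show inj: "inj_on e I"
  proof (rule inj_onI, rule ccontr)
    fix i j assume ij: "i \<in> I" "j \<in> I" "e i = e j" "i \<noteq> j"
    define a where "a k = (if k = i then 1 else if k = j then - 1 else (0::'a))" for k
    have "(\<Sum>k\<in>I. scale (a k) (e k)) = (\<Sum>k\<in>{i, j}. scale (a k) (e k))"
      by (rule sum.mono_neutral_right) (use assms(1) ij in \<open>auto simp: a_def\<close>)
    also have "\<dots> = 0" using ij by (simp add: a_def)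
    finally have "a i = 0" using assms(2) ij(1) by blast
    then show False by (simp add: a_def)
  qed
  show "independent (e ` I)"
  proof
    assume "dependent (e ` I)"
    then obtain u where u: "\<exists>v\<in>e ` I. u v \<noteq> 0" "(\<Sum>v\<in>e ` I. scale (u v) v) = 0"
      using dependent_finite[of "e ` I"] assms(1) by auto
    from u(2) have "(\<Sum>i\<in>I. scale (u (e i)) (e i)) = 0" by (simp add: sum.reindex[OF inj])
    then have "\<forall>i\<in>I. u (e i) = 0" using assms(2)[of "\<lambda>i. u (e i)"] by blast
    then show False using u(1) by blast
  qed
qed

lemma (in vector_space) independent_coefficients_zero:
  assumes "finite B" "independent B" "(\<Sum>b\<in>B. scale (a b) b) = 0" "b \<in> B"
  shows "a b = 0"
  using assms dependent_finite by blast

lemma (in vector_space) separating_functional: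
  assumes "v \<noteq> 0"
  shows "\<exists>\<phi>. Vector_Spaces.linear scale (*) \<phi> \<and> \<phi> v = 1"
proof -
  interpret F: vector_space "(*) :: 'a \<Rightarrow> 'a \<Rightarrow> 'a" by unfold_locales (auto simp: algebra_simps)
  interpret P: vector_space_pair scale "(*) :: 'a \<Rightarrow> 'a \<Rightarrow> 'a" ..
  have "independent {v}" using assms by simp
  from P.linear_independent_extend[OF this, of "\<lambda>_. 1"] show ?thesis by auto
qed

lemma (in vector_space) dual_basis:
  assumes "independent B"
  shows "\<exists>\<phi>. Vector_Spaces.linear scale (*) \<phi> \<and> (\<forall>x\<in>B. \<phi> x = (if x = b then 1 else 0))"
proof -
  interpret F: vector_space "(*) :: 'a \<Rightarrow> 'a \<Rightarrow> 'a" by unfold_locales (auto simp: algebra_simps)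
  interpret P: vector_space_pair scale "(*) :: 'a \<Rightarrow> 'a \<Rightarrow> 'a" ..
  from P.linear_independent_extend[OF assms, of "\<lambda>x. if x = b then 1 else 0"] show ?thesis .
qed

lemma finite_dim_subspace_basis:
  assumes "vector_space scl" "finite_dim_subspace scl S"
  obtains B where "finite B" "\<not> module.dependent scl B" "module.span scl B = S" "B \<subseteq> S"
    "card B = vector_space.dim scl S"
proof -
  interpret vector_space scl by fact
  obtain B0 where B0: "finite B0" "span B0 = S" and S: "subspace S"
    using assms(2) by (auto simp: finite_dim_subspace_def)
  obtain B where B: "B \<subseteq> S" "independent B" "S \<subseteq> span B" "card B = dim S"
    using basis_exists[of S] by blast
  have "finite B" using independent_span_bound[OF B0(1) B(2)] B(1) B0(2) by blast
  moreover have "span B = S" using B S by (metis span_minimal subset_antisym)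
  ultimately show thesis using that B by blast
qed

lemma finite_dim_subspaceI:
  assumes "vector_space scl" "finite B" "\<not> module.dependent scl B" "module.span scl B = S"
  shows "finite_dim_subspace scl S" "vector_space.dim scl S = card B"
proof -
  interpret vector_space scl by fact
  show "finite_dim_subspace scl S" using assms(2,4) subspace_span by (auto simp: finite_dim_subspace_def)
  have "span B = span S" using assms(4) span_span by metis
  then show "dim S = card B" using dim_eq_card assms(3) by blast
qed

text \<open>The dimension of an infinite-dimensional space is \<open>0\<close> by convention, so the finiteness of kernel and
image has to be carried along. The basis is the union of a basis of the kernel with preimages of a basis of the
image.\<close>

lemma rank_nullity_subspace:
  assumes lin: "Vector_Spaces.linear s1 s2 T"
    and S: "module.subspace s1 S"
    and ker: "finite_dim_subspace s1 {x \<in> S. T x = 0}"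
    and img: "finite_dim_subspace s2 (T ` S)"
  shows "finite_dim_subspace s1 S"
    "vector_space.dim s1 S = vector_space.dim s1 {x \<in> S. T x = 0} + vector_space.dim s2 (T ` S)"
proof -
  interpret T: Vector_Spaces.linear s1 s2 T by (rule lin)
  note vs1 = T.vs1.vector_space_axioms and vs2 = T.vs2.vector_space_axioms
  obtain B0 where B0: "finite B0" "\<not> T.vs1.dependent B0" "T.vs1.span B0 = {x \<in> S. T x = 0}" "B0 \<subseteq> {x \<in> S. T x = 0}"
    "card B0 = T.vs1.dim {x \<in> S. T x = 0}"
    by (rule finite_dim_subspace_basis[OF vs1 ker])
  obtain C where C: "finite C" "\<not> T.vs2.dependent C" "T.vs2.span C = T ` S" "C \<subseteq> T ` S"
    "card C = T.vs2.dim (T ` S)"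
    by (rule finite_dim_subspace_basis[OF vs2 img])
  have "\<forall>c\<in>C. \<exists>x. x \<in> S \<and> T x = c"
  proof
    fix c assume "c \<in> C"
    then have "c \<in> T ` S" using C(4) by (rule subsetD[rotated])
    then show "\<exists>x. x \<in> S \<and> T x = c" by (elim imageE) (rule exI, rule conjI, assumption, rule sym)
  qed
  from bchoice[OF this] obtain g where g0: "\<forall>c\<in>C. g c \<in> S \<and> T (g c) = c" by (elim exE)
  have g: "g c \<in> S \<and> T (g c) = c" if "c \<in> C" for c using g0 that by (rule bspec)
  define e where "e = case_sum (\<lambda>b. b) g"
  define I where "I = B0 <+> C"
  have finI: "finite I" using B0 C by (simp add: I_def)
  have sumI: "(\<Sum>i\<in>I. f i) = (\<Sum>b\<in>B0. f (Inl b)) + (\<Sum>c\<in>C. f (Inr c))" for f :: "_ \<Rightarrow> 'x::comm_monoid_add"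
    unfolding I_def using B0(1) C(1) by (simp add: sum.Plus)
  have ind: "\<forall>i\<in>I. a i = 0" if eq: "(\<Sum>i\<in>I. s1 (a i) (e i)) = 0" for a
  proof -
    have s: "(\<Sum>b\<in>B0. s1 (a (Inl b)) b) + (\<Sum>c\<in>C. s1 (a (Inr c)) (g c)) = 0"
      using eq by (simp add: sumI e_def)
    have "0 = T ((\<Sum>b\<in>B0. s1 (a (Inl b)) b) + (\<Sum>c\<in>C. s1 (a (Inr c)) (g c)))"
      unfolding s by (simp add: T.zero)
    also have "\<dots> = (\<Sum>b\<in>B0. s2 (a (Inl b)) (T b)) + (\<Sum>c\<in>C. s2 (a (Inr c)) (T (g c)))"
      by (simp add: T.add T.sum T.scale)
    also have "(\<Sum>b\<in>B0. s2 (a (Inl b)) (T b)) = 0"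
      using B0(4) by (intro sum.neutral) auto
    also have "(\<Sum>c\<in>C. s2 (a (Inr c)) (T (g c))) = (\<Sum>c\<in>C. s2 (a (Inr c)) c)"
      using g by (intro sum.cong) auto
    finally have "(\<Sum>c\<in>C. s2 (a (Inr c)) c) = 0" by simp
    then have aC: "a (Inr c) = 0" if "c \<in> C" for c
      using T.vs2.independent_coefficients_zero[OF C(1,2), of "\<lambda>c. a (Inr c)"] that by blast
    then have "(\<Sum>b\<in>B0. s1 (a (Inl b)) b) = 0" using s by simp
    then have "a (Inl b) = 0" if "b \<in> B0" for b
      using T.vs1.independent_coefficients_zero[OF B0(1,2), of "\<lambda>b. a (Inl b)"] that by blast
    with aC show ?thesis by (auto simp: I_def)
  qed
  note fam = T.vs1.independent_family[OF finI ind]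
  have eS: "e ` I \<subseteq> S" using B0(4) g by (auto simp: e_def I_def)
  have "T.vs1.span (e ` I) = S"
  proof
    show "T.vs1.span (e ` I) \<subseteq> S" using eS S by (rule T.vs1.span_minimal)
    show "S \<subseteq> T.vs1.span (e ` I)"
    proof
      fix x assume x: "x \<in> S"
      then have "T x \<in> T.vs2.span C" using C(3) by blast
      then obtain a where a: "T x = (\<Sum>c\<in>C. s2 (a c) c)"
        using T.vs2.span_finite[OF C(1)] by auto
      define y where "y = (\<Sum>c\<in>C. s1 (a c) (g c))"
      have "y \<in> S" unfolding y_def using g by (intro T.vs1.subspace_sum[OF S] T.vs1.subspace_scale[OF S]) auto
      have "T y = (\<Sum>c\<in>C. s2 (a c) c)" unfolding y_def T.sum T.scale using g by (intro sum.cong) auto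
      then have "T (x - y) = 0" by (simp add: T.diff a)
      moreover have "x - y \<in> S" using x \<open>y \<in> S\<close> by (rule T.vs1.subspace_diff[OF S])
      ultimately have "x - y \<in> T.vs1.span B0" using B0(3) by blast
      moreover have "B0 \<subseteq> e ` I" by (force simp: e_def I_def)
      ultimately have 1: "x - y \<in> T.vs1.span (e ` I)" using T.vs1.span_mono by blast
      have "g c \<in> e ` I" if "c \<in> C" for c
        using that by (intro image_eqI[of _ _ "Inr c"]) (auto simp: e_def I_def)
      then have "y \<in> T.vs1.span (e ` I)"
        unfolding y_def by (intro T.vs1.span_sum T.vs1.span_scale T.vs1.span_base)
      from T.vs1.span_add[OF 1 this] show "x \<in> T.vs1.span (e ` I)" by simp
    qed
  qed
  note basis = finite_dim_subspaceI[OF vs1 finite_imageI[OF finI] fam(2) this]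
  show "finite_dim_subspace s1 S" by (rule basis(1))
  show "T.vs1.dim S = T.vs1.dim {x \<in> S. T x = 0} + T.vs2.dim (T ` S)"
  proof -
    have "card (e ` I) = card I" by (rule card_image[OF fam(1)])
    also have "\<dots> = card B0 + card C" unfolding I_def using B0(1) C(1) by (rule card_Plus)
    finally show ?thesis using basis(2) B0(5) C(5) by simp
  qed
qed

text \<open>Each functional cuts the dimension by at most one. The functionals are only required to be linear on \<open>S\<close>:
in the application they are derivatives at a point, which are additive on holomorphic functions only.\<close>

lemma finite_dim_subspace_by_functionals:
  assumes vs: "vector_space scl" and "finite L"
    and "module.subspace scl S"
    and "\<And>l x y. l \<in> L \<Longrightarrow> x \<in> S \<Longrightarrow> y \<in> S \<Longrightarrow> l (x + y) = l x + l y"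
    and "\<And>l c x. l \<in> L \<Longrightarrow> x \<in> S \<Longrightarrow> l (scl c x) = c * l x"
    and "\<And>x. x \<in> S \<Longrightarrow> (\<And>l. l \<in> L \<Longrightarrow> l x = 0) \<Longrightarrow> x = 0"
  shows "finite_dim_subspace scl S"
  using assms(2-)
proof (induction L arbitrary: S rule: finite_induct)
  case empty
  interpret vector_space scl by fact
  have "S = {0}" using empty.prems(1,4) subspace_0 by auto
  then have "span {} = S" by simp
  then show ?case using empty.prems(1) unfolding finite_dim_subspace_def by blast
next
  case (insert l L)
  interpret vector_space scl by fact
  note S = insert.prems(1)
  have add: "l (x + y) = l x + l y" if "x \<in> S" "y \<in> S" for x y using insert.prems(2) that by blast
  have scale: "l (scl c x) = c * l x" if "x \<in> S" for c x using insert.prems(3) that by blast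
  let ?S = "{x \<in> S. l x = 0}"
  have l0: "l 0 = 0" using scale[OF subspace_0[OF S], of 0] by simp
  have "subspace ?S"
    unfolding subspace_def using S l0 add scale by (auto simp: subspace_0 subspace_add subspace_scale)
  then have "finite_dim_subspace scl ?S"
  proof (rule insert.IH)
    fix x assume "x \<in> ?S" "\<And>l. l \<in> L \<Longrightarrow> l x = 0"
    then show "x = 0" using insert.prems(4)[of x] by auto
  qed (use insert.prems(2,3) in auto)
  then obtain B where B: "finite B" "span B = ?S" by (auto simp: finite_dim_subspace_def)
  show ?case
  proof (cases "\<forall>x\<in>S. l x = 0")
    case True
    then have "?S = S" by blast
    then show ?thesis using B S by (auto simp: finite_dim_subspace_def)
  next
    case False
    then obtain x0 where x0: "x0 \<in> S" "l x0 \<noteq> 0" by blast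
    have "span (insert x0 B) = S"
    proof
      have "B \<subseteq> S" using B(2) span_superset by blast
      then show "span (insert x0 B) \<subseteq> S" using x0 S by (intro span_minimal) auto
      show "S \<subseteq> span (insert x0 B)"
      proof
        fix x assume x: "x \<in> S"
        define c where "c = - (l x / l x0)"
        have "x + scl c x0 \<in> S" using x x0 S by (intro subspace_add subspace_scale)
        moreover have "l (x + scl c x0) = l x + c * l x0"
          using add[OF x subspace_scale[OF S x0(1)]] scale[OF x0(1)] by simp
        then have "l (x + scl c x0) = 0" using x0(2) by (simp add: c_def)
        ultimately have "x + scl c x0 \<in> span B" using B(2) by blast
        then have "x + scl c x0 \<in> span (insert x0 B)" using span_mono[of B "insert x0 B"] by blast
        moreover have "scl c x0 \<in> span (insert x0 B)" by (intro span_scale span_base) simp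
        ultimately have "(x + scl c x0) - scl c x0 \<in> span (insert x0 B)" by (rule span_diff)
        then show "x \<in> span (insert x0 B)" by simp
      qed
    qed
    then show ?thesis using B(1) S unfolding finite_dim_subspace_def by (metis finite_insert)
  qed
qed

text \<open>\<open>M \<otimes> W\<close>, realised as the space of \<open>W\<close>-valued functions spanned by the functions \<open>\<tau> \<mapsto> F(\<tau>) w\<close>.\<close>

definition tensor_forms :: "(complex \<Rightarrow> 'v::ab_group_add \<Rightarrow> 'v) \<Rightarrow> (complex \<Rightarrow> complex) set \<Rightarrow> 'v set \<Rightarrow> (complex \<Rightarrow> 'v) set" where
  "tensor_forms scl M W = module.span (fun_scale scl) {\<lambda>\<tau>. scl (F \<tau>) w | F w. F \<in> M \<and> w \<in> W}"

lemma sum_fun_apply: "(\<Sum>i\<in>I. f i) x = (\<Sum>i\<in>I. f i x)"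
  by (induction I rule: infinite_finite_induct) auto

text \<open>The products of two bases are independent: in a relation, evaluation at a point and comparison of the coefficients in \<open>W\<close>
leave a relation between scalar functions.\<close>

lemma tensor_forms_basis:
  assumes vs: "vector_space scl" and M: "finite_dim_subspace (fun_scale (*)) M" and W: "finite_dim_subspace scl W"
  shows "finite_dim_subspace (fun_scale scl) (tensor_forms scl M W)"
    "vector_space.dim (fun_scale scl) (tensor_forms scl M W)
      = vector_space.dim (fun_scale (*)) M * vector_space.dim scl W"
proof -
  note vsf = vector_space_fun_scale[OF vs] and vsc = vector_space_fun_scale[OF vector_space_complex]
  interpret vector_space scl by fact
  interpret FV: vector_space "fun_scale scl :: complex \<Rightarrow> (complex \<Rightarrow> 'a) \<Rightarrow> _" by (rule vsf)
  interpret FC: vector_space "fun_scale (*) :: complex \<Rightarrow> (complex \<Rightarrow> complex) \<Rightarrow> _" by (rule vsc)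
  obtain B where B: "finite B" "\<not> FC.dependent B" "FC.span B = M" "B \<subseteq> M" "card B = FC.dim M"
    by (rule finite_dim_subspace_basis[OF vsc M])
  obtain C where C: "finite C" "independent C" "span C = W" "C \<subseteq> W" "card C = dim W"
    by (rule finite_dim_subspace_basis[OF vs W])
  define e where "e p = (\<lambda>\<tau>. scl (fst p \<tau>) (snd p))" for p :: "(complex \<Rightarrow> complex) \<times> 'a"
  let ?I = "B \<times> C"
  have fin: "finite ?I" using B C by simp
  have ind: "\<forall>p\<in>?I. a p = 0" if eq: "(\<Sum>p\<in>?I. fun_scale scl (a p) (e p)) = 0" for a
  proof -
    have z: "(\<Sum>F\<in>B. a (F, w) * F \<tau>) = 0" if "w \<in> C" for w \<tau>
    proof (rule independent_coefficients_zero[OF C(1,2) _ that])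
      have "(\<Sum>w\<in>C. scl (\<Sum>F\<in>B. a (F, w) * F \<tau>) w) = (\<Sum>w\<in>C. \<Sum>F\<in>B. scl (a (F, w)) (scl (F \<tau>) w))"
        by (simp add: scale_sum_left)
      also have "\<dots> = (\<Sum>F\<in>B. \<Sum>w\<in>C. scl (a (F, w)) (scl (F \<tau>) w))" by (rule sum.swap)
      also have "\<dots> = (\<Sum>p\<in>?I. fun_scale scl (a p) (e p)) \<tau>"
        by (simp add: sum_fun_apply fun_scale_def e_def sum.cartesian_product case_prod_unfold)
      also have "\<dots> = 0" by (simp add: eq)
      finally show "(\<Sum>w\<in>C. scl (\<Sum>F\<in>B. a (F, w) * F \<tau>) w) = 0" .
    qed
    have "a (F, w) = 0" if "F \<in> B" "w \<in> C" for F w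
    proof (rule FC.independent_coefficients_zero[OF B(1,2) _ that(1), of "\<lambda>F. a (F, w)"])
      show "(\<Sum>F\<in>B. fun_scale (*) (a (F, w)) F) = 0"
        by (rule ext) (simp add: sum_fun_apply fun_scale_def z[OF that(2)])
    qed
    then show ?thesis by auto
  qed
  note fam = FV.independent_family[OF fin ind]
  have "FV.span (e ` ?I) = tensor_forms scl M W"
  proof
    show "FV.span (e ` ?I) \<subseteq> tensor_forms scl M W"
      unfolding tensor_forms_def using B(4) C(4) by (intro FV.span_mono) (auto simp: e_def, blast)
    show "tensor_forms scl M W \<subseteq> FV.span (e ` ?I)"
      unfolding tensor_forms_def
    proof (rule FV.span_minimal[OF _ FV.subspace_span], safe)
      fix F w assume "F \<in> M" "w \<in> W"
      then have "F \<in> FC.span B" "w \<in> span C" using B(3) C(3) by simp_all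
      then obtain a b where F: "F = (\<Sum>G\<in>B. fun_scale (*) (a G) G)" and w: "w = (\<Sum>v\<in>C. scl (b v) v)"
        unfolding FC.span_finite[OF B(1)] span_finite[OF C(1)] by (elim imageE)
      have "(\<lambda>\<tau>. scl (F \<tau>) w) = (\<Sum>p\<in>?I. fun_scale scl (a (fst p) * b (snd p)) (e p))"
      proof
        fix \<tau>
        have "scl (F \<tau>) w = (\<Sum>G\<in>B. \<Sum>v\<in>C. scl (a G * b v) (scl (G \<tau>) v))"
          unfolding F w sum_fun_apply fun_scale_def scale_sum_left scale_sum_right
          by (simp add: mult_ac sum.swap[of _ B C])
        then show "scl (F \<tau>) w = (\<Sum>p\<in>?I. fun_scale scl (a (fst p) * b (snd p)) (e p)) \<tau>"
          by (simp add: sum_fun_apply fun_scale_def e_def sum.cartesian_product case_prod_unfold)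
      qed
      also have "\<dots> \<in> FV.span (e ` ?I)" by (intro FV.span_sum FV.span_scale FV.span_base imageI)
      finally show "(\<lambda>\<tau>. scl (F \<tau>) w) \<in> FV.span (e ` ?I)" .
    qed
  qed
  note basis = finite_dim_subspaceI[OF vsf finite_imageI[OF fin] fam(2) this]
  show "finite_dim_subspace (fun_scale scl) (tensor_forms scl M W)" by (rule basis(1))
  show "FV.dim (tensor_forms scl M W) = FC.dim M * dim W"
    using basis(2) B(5) C(5) by (simp add: card_image[OF fam(1)] card_cartesian_product)
qed

lemma finite_dim_subspace_mono:
  assumes "vector_space scl" "finite_dim_subspace scl S" "module.subspace scl S'" "S' \<subseteq> S"
  shows "finite_dim_subspace scl S'"
proof -
  interpret vector_space scl by fact
  obtain B0 where B0: "finite B0" "span B0 = S"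
    using assms(2) by (auto simp: finite_dim_subspace_def)
  obtain B where B: "B \<subseteq> S'" "independent B" "S' \<subseteq> span B" "card B = dim S'"
    using basis_exists[of S'] by blast
  have "finite B" using independent_span_bound[OF B0(1) B(2)] B(1) B0(2) assms(4) by blast
  moreover have "span B = S'" using span_minimal[OF B(1) assms(3)] B(3) by (rule subset_antisym)
  ultimately show ?thesis using assms(3) by (auto simp: finite_dim_subspace_def)
qed

text \<open>Expanding in a basis of \<open>W\<close>, the coordinates of \<open>u\<close> are obtained by applying functionals, so \<open>u\<close> is a sum of
products as soon as all its scalar coordinates lie in \<open>M\<close>.\<close>

lemma in_tensor_forms:
  assumes vs: "vector_space scl" and W: "finite_dim_subspace scl W" and u: "\<And>\<tau>. u \<tau> \<in> W"
    and M: "\<And>\<phi>. Vector_Spaces.linear scl (*) \<phi> \<Longrightarrow> (\<lambda>\<tau>. \<phi> (u \<tau>)) \<in> M"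
  shows "u \<in> tensor_forms scl M W"
proof -
  interpret vector_space scl by fact
  interpret FV: vector_space "fun_scale scl :: complex \<Rightarrow> (complex \<Rightarrow> 'a) \<Rightarrow> _"
    by (rule vector_space_fun_scale[OF vs])
  obtain C where C: "finite C" "independent C" "span C = W" "C \<subseteq> W" "card C = dim W"
    by (rule finite_dim_subspace_basis[OF vs W])
  have "\<forall>v. \<exists>\<phi>. Vector_Spaces.linear scl (*) \<phi> \<and> (\<forall>x\<in>C. \<phi> x = (if x = v then 1 else 0))"
    using dual_basis[OF C(2)] by blast
  from choice[OF this] obtain \<phi> where
    \<phi>: "\<forall>v. Vector_Spaces.linear scl (*) (\<phi> v) \<and> (\<forall>x\<in>C. \<phi> v x = (if x = v then 1 else 0))" by (elim exE)
  have lin: "Vector_Spaces.linear scl (*) (\<phi> v)" for v using \<phi> by simp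
  have exp: "x = (\<Sum>v\<in>C. scl (\<phi> v x) v)" if "x \<in> W" for x
  proof -
    have "x \<in> span C" using that C(3) by simp
    then obtain a where a: "x = (\<Sum>w\<in>C. scl (a w) w)"
      unfolding span_finite[OF C(1)] by (elim imageE)
    have "\<phi> v x = a v" if v: "v \<in> C" for v
    proof -
      interpret L: Vector_Spaces.linear scl "(*)" "\<phi> v" by (rule lin)
      have "\<phi> v x = (\<Sum>w\<in>C. a w * \<phi> v w)" unfolding a by (simp add: L.sum L.scale)
      also have "\<dots> = (\<Sum>w\<in>C. if w = v then a w else 0)"
        using \<phi> by (intro sum.cong) auto
      also have "\<dots> = a v" using C(1) v by simp
      finally show ?thesis .
    qed
    then show ?thesis by (subst a) (rule sum.cong, auto)
  qed
  have "u = (\<Sum>v\<in>C. (\<lambda>\<tau>. scl (\<phi> v (u \<tau>)) v))"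
    by (rule ext) (simp add: sum_fun_apply exp[OF u, symmetric])
  also have "\<dots> \<in> tensor_forms scl M W"
    unfolding tensor_forms_def
  proof (intro FV.span_sum FV.span_base)
    fix v assume "v \<in> C"
    then have "v \<in> W" using C(4) by (rule subsetD[rotated])
    then show "(\<lambda>\<tau>. scl (\<phi> v (u \<tau>)) v) \<in> {\<lambda>\<tau>. scl (F \<tau>) w |F w. F \<in> M \<and> w \<in> W}"
      using M[OF lin, of v] by (intro CollectI exI[of _ "\<lambda>\<tau>. \<phi> v (u \<tau>)"] exI[of _ v] conjI refl)
  qed
  finally show ?thesis .
qed

section \<open>Moebius transformations of the upper half-plane\<close>

text \<open>Two infix dollar operators are in scope (formal power series and vectors), and every occurrence doubles the
number of parse trees; entries are therefore written in prefix form.\<close>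

abbreviation (input) entry :: "real^2^2 \<Rightarrow> 2 \<Rightarrow> 2 \<Rightarrow> real" where
  "entry A i j \<equiv> vec_nth (vec_nth A i) j"

abbreviation "uhp \<equiv> upper_half_plane"

lemma uhp_iff: "\<tau> \<in> uhp \<longleftrightarrow> 0 < Im \<tau>"
  by (simp add: upper_half_plane_def)

lemma open_uhp: "open uhp"
  unfolding upper_half_plane_def by (rule open_halfspace_Im_gt)

lemma convex_uhp: "convex uhp"
  unfolding upper_half_plane_def by (rule convex_halfspace_Im_gt)

lemma aut_factor_nonzero:
  assumes "det \<gamma> = 1" "\<tau> \<in> uhp"
  shows "aut_factor \<gamma> \<tau> \<noteq> 0"
proof
  assume *: "aut_factor \<gamma> \<tau> = 0"
  then have "Im (aut_factor \<gamma> \<tau>) = 0" by simp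
  then have "entry \<gamma> 2 1 = 0" using assms(2) by (simp add: aut_factor_def uhp_iff)
  with * have "entry \<gamma> 2 2 = 0" by (simp add: aut_factor_def)
  with \<open>entry \<gamma> 2 1 = 0\<close> assms(1) show False by (simp add: det_2)
qed

lemma moebius_action_eq:
  "moebius_action \<gamma> \<tau> = (of_real (entry \<gamma> 1 1) * \<tau> + of_real (entry \<gamma> 1 2)) / aut_factor \<gamma> \<tau>"
  by (simp add: moebius_action_def moebius_def aut_factor_def)

lemma Im_moebius_action:
  assumes "det \<gamma> = 1" "\<tau> \<in> uhp"
  shows "Im (moebius_action \<gamma> \<tau>) = Im \<tau> / (cmod (aut_factor \<gamma> \<tau>))\<^sup>2"
proof -
  have "Im (moebius_action \<gamma> \<tau>) = (entry \<gamma> 1 1 * entry \<gamma> 2 2 - entry \<gamma> 1 2 * entry \<gamma> 2 1) * Im \<tau> / (cmod (aut_factor \<gamma> \<tau>))\<^sup>2"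
    by (simp add: moebius_action_eq Im_divide cmod_power2 aut_factor_def algebra_simps)
  then show ?thesis using assms(1) by (simp add: det_2)
qed

lemma moebius_action_in_uhp:
  assumes "det \<gamma> = 1" "\<tau> \<in> uhp"
  shows "moebius_action \<gamma> \<tau> \<in> uhp"
  using assms aut_factor_nonzero[OF assms] by (simp add: uhp_iff Im_moebius_action)

lemma moebius_action_has_derivative:
  assumes "det \<gamma> = 1" "\<tau> \<in> uhp"
  shows "(moebius_action \<gamma> has_field_derivative 1 / (aut_factor \<gamma> \<tau>)\<^sup>2) (at \<tau> within S)"
proof -
  let ?a = "complex_of_real (entry \<gamma> 1 1)" and ?b = "complex_of_real (entry \<gamma> 1 2)"
  let ?c = "complex_of_real (entry \<gamma> 2 1)" and ?d = "complex_of_real (entry \<gamma> 2 2)"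
  have nz: "?c * \<tau> + ?d \<noteq> 0" using aut_factor_nonzero[OF assms] by (simp add: aut_factor_def)
  have "?a * ?d - ?b * ?c = of_real (det \<gamma>)" by (simp add: det_2)
  then have det: "?a * ?d - ?b * ?c = 1" using assms(1) by simp
  have "((\<lambda>\<tau>. (?a * \<tau> + ?b) / (?c * \<tau> + ?d)) has_field_derivative
      (?a * (?c * \<tau> + ?d) - (?a * \<tau> + ?b) * ?c) / (?c * \<tau> + ?d)\<^sup>2) (at \<tau> within S)"
    using nz by (auto intro!: derivative_eq_intros simp: power2_eq_square)
  moreover have "?a * (?c * \<tau> + ?d) - (?a * \<tau> + ?b) * ?c = 1"
    using det by (simp add: algebra_simps)
  ultimately show ?thesis
    by (simp add: moebius_action_eq[abs_def] aut_factor_def)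
qed

lemma moebius_action_holomorphic:
  assumes "det \<gamma> = 1" shows "moebius_action \<gamma> holomorphic_on uhp"
  unfolding holomorphic_on_def field_differentiable_def
  using moebius_action_has_derivative[OF assms] by blast

lemma aut_factor_has_derivative:
  "(aut_factor \<gamma> has_field_derivative of_real (entry \<gamma> 2 1)) (at \<tau> within S)"
  unfolding aut_factor_def[abs_def] by (auto intro!: derivative_eq_intros)

lemma aut_factor_mult:
  assumes "det B = 1" "\<tau> \<in> uhp"
  shows "aut_factor (A ** B) \<tau> = aut_factor A (moebius_action B \<tau>) * aut_factor B \<tau>"
  using aut_factor_nonzero[OF assms]
  by (simp add: moebius_action_eq aut_factor_def[of A] aut_factor_def[of "A**B"] matrix_matrix_mult_def sum_2 field_simps)
     (simp add: aut_factor_def algebra_simps)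

lemma moebius_action_mult:
  assumes "det A = 1" "det B = 1" "\<tau> \<in> uhp"
  shows "moebius_action (A ** B) \<tau> = moebius_action A (moebius_action B \<tau>)"
proof -
  let ?z = "moebius_action B \<tau>"
  have nB: "aut_factor B \<tau> \<noteq> 0" using assms aut_factor_nonzero by blast
  have nA: "aut_factor A ?z \<noteq> 0" using assms aut_factor_nonzero moebius_action_in_uhp by blast
  have z: "?z * aut_factor B \<tau> = of_real (entry B 1 1) * \<tau> + of_real (entry B 1 2)"
    using nB by (simp add: moebius_action_eq)
  have "(of_real (entry A 1 1) * ?z + of_real (entry A 1 2)) * aut_factor B \<tau>
     = of_real (entry A 1 1) * (?z * aut_factor B \<tau>) + of_real (entry A 1 2) * aut_factor B \<tau>"
    by (simp add: algebra_simps)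
  also have "\<dots> = of_real (entry (A ** B) 1 1) * \<tau> + of_real (entry (A ** B) 1 2)"
    unfolding z by (simp add: aut_factor_def matrix_matrix_mult_def sum_2 algebra_simps)
  finally have eq: "of_real (entry (A ** B) 1 1) * \<tau> + of_real (entry (A ** B) 1 2) =
    (of_real (entry A 1 1) * ?z + of_real (entry A 1 2)) * aut_factor B \<tau>" ..
  show ?thesis
    unfolding moebius_action_eq[of "A ** B"] moebius_action_eq[of A] aut_factor_mult[OF assms(2,3)]
    using nA nB by (simp add: eq)
qed

lemma moebius_action_one [simp]: "moebius_action (mat 1) \<tau> = \<tau>"
  by (simp add: moebius_action_eq aut_factor_def mat_def)

text \<open>The adjugate is the inverse on \<open>SL\<^sub>2\<close> and is visibly continuous in the entries.\<close>

definition adj2 :: "real^2^2 \<Rightarrow> real^2^2" where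
  "adj2 \<gamma> = vector [vector [entry \<gamma> 2 2, - entry \<gamma> 1 2], vector [- entry \<gamma> 2 1, entry \<gamma> 1 1]]"

lemma matrix2_eq_iff: "(A :: real^2^2) = B \<longleftrightarrow> entry A 1 1 = entry B 1 1 \<and> entry A 1 2 = entry B 1 2 \<and> entry A 2 1 = entry B 2 1 \<and> entry A 2 2 = entry B 2 2"
  by (auto simp: vec_eq_iff forall_2)

lemma matrix2_mult_entry: "entry (A ** B) i j = entry A i 1 * entry B 1 j + entry A i 2 * entry B 2 j"
  by (simp add: matrix_matrix_mult_def sum_2)

lemma det_adj2 [simp]: "det (adj2 \<gamma>) = det \<gamma>"
  by (simp add: adj2_def det_2)

lemma adj2_mult:
  assumes "det \<gamma> = 1" shows "adj2 \<gamma> ** \<gamma> = mat 1" "\<gamma> ** adj2 \<gamma> = mat 1"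
  using assms by (simp_all add: matrix2_eq_iff matrix2_mult_entry adj2_def det_2 mat_def algebra_simps)

lemma adj2_adj2 [simp]: "adj2 (adj2 \<gamma>) = \<gamma>"
  by (simp add: matrix2_eq_iff adj2_def)

lemma moebius_action_adj2:
  assumes "det \<gamma> = 1" "\<tau> \<in> uhp"
  shows "moebius_action (adj2 \<gamma>) (moebius_action \<gamma> \<tau>) = \<tau>"
    "moebius_action \<gamma> (moebius_action (adj2 \<gamma>) \<tau>) = \<tau>"
  using assms moebius_action_mult[of "adj2 \<gamma>" \<gamma> \<tau>] moebius_action_mult[of \<gamma> "adj2 \<gamma>" \<tau>]
  by (simp_all add: adj2_mult)

lemma moebius_action_bij:
  assumes "det \<gamma> = 1" shows "bij_betw (moebius_action \<gamma>) uhp uhp"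
  by (rule bij_betw_byWitness[where f' = "moebius_action (adj2 \<gamma>)"])
     (use assms in \<open>auto simp: moebius_action_adj2 moebius_action_in_uhp\<close>)

section \<open>Discrete cocompact subgroups\<close>

locale SL2R_group =
  fixes G :: "(real^2^2) set"
  assumes det_one: "\<gamma> \<in> G \<Longrightarrow> det \<gamma> = 1"
    and one_in: "mat 1 \<in> G"
    and mult_in: "\<gamma> \<in> G \<Longrightarrow> \<delta> \<in> G \<Longrightarrow> \<gamma> ** \<delta> \<in> G"
    and adj2_in: "\<gamma> \<in> G \<Longrightarrow> adj2 \<gamma> \<in> G"

text \<open>Cocompactness is used through finite covers of the quotient by images of discs whose radii may depend on
the centre. Discreteness is used only near the identity, up to sign since \<open>G\<close> stands for the full
preimage of a subgroup of \<open>PSL\<^sub>2(\<real>)\<close>.\<close>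

locale cocompact_fuchsian_group = SL2R_group +
  assumes finite_cover: "(\<And>z. z \<in> uhp \<Longrightarrow> r z > 0) \<Longrightarrow>
      \<exists>Z. finite Z \<and> Z \<subseteq> uhp \<and> (\<forall>\<tau>\<in>uhp. \<exists>\<gamma>\<in>G. \<exists>z\<in>Z. moebius_action \<gamma> \<tau> \<in> ball z (r z))"
    and discrete: "\<exists>W. open W \<and> mat 1 \<in> W \<and> W \<inter> G \<subseteq> {mat 1, - mat 1}"

lemma SL2R_simps:
  "carrier SL2R = {A. det A = 1}" "x \<otimes>\<^bsub>SL2R\<^esub> y = x ** y" "\<one>\<^bsub>SL2R\<^esub> = mat 1"
  by (simp_all add: SL2R_def)

lemma det_minus2: "det (- A :: real^2^2) = det A"
  by (simp add: det_2)

lemma minus_mat_mult: "(- mat 1 :: real^2^2) ** A = - A" "A ** (- mat 1 :: real^2^2) = - A"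
  by (simp_all add: matrix2_eq_iff matrix2_mult_entry mat_def)

lemma group_SL2R: "group SL2R"
proof (rule groupI)
  fix x assume "x \<in> carrier SL2R"
  then show "\<exists>y\<in>carrier SL2R. y \<otimes>\<^bsub>SL2R\<^esub> x = \<one>\<^bsub>SL2R\<^esub>"
    by (intro bexI[of _ "adj2 x"]) (auto simp: SL2R_simps adj2_mult)
qed (auto simp: SL2R_simps det_mul matrix_mul_assoc)

lemma pm_one_coset: "pm_one #>\<^bsub>SL2R\<^esub> A = {A, - A}"
  by (auto simp: r_coset_def pm_one_def SL2R_simps minus_mat_mult)

lemma carrier_PSL2R: "carrier PSL2R = {{A, - A} | A. det A = 1}"
  by (auto simp: PSL2R_def FactGroup_def RCOSETS_def pm_one_coset SL2R_simps)

lemma PSL2R_mult: "X \<otimes>\<^bsub>PSL2R\<^esub> Y = {x ** y | x y. x \<in> X \<and> y \<in> Y}"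
  by (auto simp: PSL2R_def FactGroup_def set_mult_def SL2R_simps)

lemma PSL2R_one: "\<one>\<^bsub>PSL2R\<^esub> = pm_one"
  by (simp add: PSL2R_def FactGroup_def)

lemma pm_one_normal: "pm_one \<lhd> SL2R"
proof -
  interpret group SL2R by (rule group_SL2R)
  have sg: "subgroup pm_one SL2R"
  proof (rule subgroupI)
    show "pm_one \<subseteq> carrier SL2R" by (auto simp: pm_one_def SL2R_simps det_minus2)
    show "pm_one \<noteq> {}" by (simp add: pm_one_def)
    fix a b assume a: "a \<in> pm_one" and b: "b \<in> pm_one"
    show "a \<otimes>\<^bsub>SL2R\<^esub> b \<in> pm_one" using a b by (auto simp: pm_one_def SL2R_simps minus_mat_mult)
    have "inv\<^bsub>SL2R\<^esub> a = a"
      by (rule inv_equality) (use a in \<open>auto simp: pm_one_def SL2R_simps minus_mat_mult det_minus2\<close>)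
    then show "inv\<^bsub>SL2R\<^esub> a \<in> pm_one" using a by simp
  qed
  show ?thesis
  proof (rule normalI[OF sg], rule ballI)
    fix x assume "x \<in> carrier SL2R"
    show "pm_one #>\<^bsub>SL2R\<^esub> x = x <#\<^bsub>SL2R\<^esub> pm_one"
      unfolding pm_one_coset by (auto simp: l_coset_def pm_one_def SL2R_simps minus_mat_mult)
  qed
qed

lemma group_PSL2R: "group PSL2R"
  unfolding PSL2R_def using normal.factorgroup_is_group[OF pm_one_normal] .

lemma subgroup_PSL2R_elem:
  assumes "subgroup \<Gamma> PSL2R" "A \<in> SL2R_lift \<Gamma>"
  shows "det A = 1" "{A, - A} \<in> \<Gamma>"
proof -
  obtain X where X: "X \<in> \<Gamma>" "A \<in> X" using assms(2) by (auto simp: SL2R_lift_def)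
  with assms(1) have "X \<in> carrier PSL2R" by (meson subgroup.mem_carrier)
  then obtain B where "X = {B, - B}" "det B = 1" by (auto simp: carrier_PSL2R)
  with X show "det A = 1" "{A, - A} \<in> \<Gamma>" by (auto simp: det_minus2 insert_commute)
qed

lemma SL2R_lift_iff:
  assumes "subgroup \<Gamma> PSL2R" shows "A \<in> SL2R_lift \<Gamma> \<longleftrightarrow> {A, - A} \<in> \<Gamma>"
  using subgroup_PSL2R_elem[OF assms] by (auto simp: SL2R_lift_def)

lemma SL2R_group_lift:
  assumes "subgroup \<Gamma> PSL2R" shows "SL2R_group (SL2R_lift \<Gamma>)"
proof
  interpret subgroup \<Gamma> PSL2R by fact
  note el = subgroup_PSL2R_elem[OF assms]
  show "det A = 1" if "A \<in> SL2R_lift \<Gamma>" for A using el that by blast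
  show "mat 1 \<in> SL2R_lift \<Gamma>"
    using one_closed by (auto simp: SL2R_lift_def PSL2R_one pm_one_def)
  show "A ** B \<in> SL2R_lift \<Gamma>" if "A \<in> SL2R_lift \<Gamma>" "B \<in> SL2R_lift \<Gamma>" for A B
  proof -
    have "{A, - A} \<otimes>\<^bsub>PSL2R\<^esub> {B, - B} \<in> \<Gamma>" using el that by blast
    then show ?thesis unfolding SL2R_lift_def PSL2R_mult by blast
  qed
  show "adj2 A \<in> SL2R_lift \<Gamma>" if A: "A \<in> SL2R_lift \<Gamma>" for A
  proof -
    have eq: "{adj2 A, - adj2 A} \<otimes>\<^bsub>PSL2R\<^esub> {A, - A} = \<one>\<^bsub>PSL2R\<^esub>"
    proof -
      have "- adj2 A ** A = - (adj2 A ** A)" "adj2 A ** - A = - (adj2 A ** A)" "- adj2 A ** - A = adj2 A ** A"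
        by (simp_all add: matrix2_eq_iff matrix2_mult_entry)
      moreover have "{x ** y | x y. x \<in> {adj2 A, - adj2 A} \<and> y \<in> {A, - A}}
          = {adj2 A ** A, adj2 A ** - A, - adj2 A ** A, - adj2 A ** - A}" by blast
      ultimately show ?thesis
        using adj2_mult(1)[OF el(1)[OF A]] by (auto simp: PSL2R_mult PSL2R_one pm_one_def)
    qed
    have "inv\<^bsub>PSL2R\<^esub> {A, - A} = {adj2 A, - adj2 A}"
      using eq el[OF A] by (intro group.inv_equality[OF group_PSL2R]) (auto simp: carrier_PSL2R)
    with el(2)[OF A] show ?thesis by (metis SL2R_lift_iff assms m_inv_closed)
  qed
qed

text \<open>The quotient map to \<open>PSL\<^sub>2(\<real>)\<close> pulls an open set isolating the trivial coset back to an open set of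
matrices which meets the preimage of \<open>\<Gamma>\<close> only in \<open>\<plusminus> 1\<close>.\<close>

lemma fuchsian_discrete:
  assumes "fuchsian \<Gamma>"
  shows "\<exists>W. open W \<and> mat 1 \<in> W \<and> W \<inter> SL2R_lift \<Gamma> \<subseteq> {mat 1, - mat 1}"
proof -
  have sg: "subgroup \<Gamma> PSL2R" and disc: "subtopology PSL2R_topology \<Gamma> = discrete_topology \<Gamma>"
    using assms by (auto simp: fuchsian_def)
  have "pm_one \<in> \<Gamma>" using subgroup.one_closed[OF sg] by (simp add: PSL2R_one)
  then have "openin (subtopology PSL2R_topology \<Gamma>) {pm_one}" by (simp add: disc)
  then obtain U where U: "openin PSL2R_topology U" "{pm_one} = U \<inter> \<Gamma>"
    by (auto simp: openin_subtopology)
  then have "openin (top_of_set (carrier SL2R)) {A \<in> carrier SL2R. pm_one #>\<^bsub>SL2R\<^esub> A \<in> U}"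
    by (simp add: PSL2R_topology_def openin_quotient_topology)
  then obtain W where W: "open W" "{A \<in> carrier SL2R. pm_one #>\<^bsub>SL2R\<^esub> A \<in> U} = carrier SL2R \<inter> W"
    by (auto simp: openin_open)
  show ?thesis
  proof (intro exI conjI subsetI)
    show "open W" by fact
    have "pm_one #>\<^bsub>SL2R\<^esub> mat 1 = pm_one" unfolding pm_one_coset by (simp add: pm_one_def)
    then have "mat 1 \<in> {A \<in> carrier SL2R. pm_one #>\<^bsub>SL2R\<^esub> A \<in> U}"
      using U(2) by (auto simp: SL2R_simps)
    then show "mat 1 \<in> W" using W(2) by blast
    fix A assume A: "A \<in> W \<inter> SL2R_lift \<Gamma>"
    with subgroup_PSL2R_elem[OF sg] have "{A, - A} \<in> \<Gamma>" "det A = 1" by auto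
    with A W(2) have "{A, - A} \<in> U" by (auto simp: SL2R_simps pm_one_coset)
    with \<open>{A, - A} \<in> \<Gamma>\<close> have "{A, - A} \<in> U \<inter> \<Gamma>" by simp
    then have "{A, - A} = pm_one" unfolding U(2)[symmetric] by (rule singletonD)
    moreover have "A \<in> {A, - A}" by simp
    ultimately have "A \<in> pm_one" by (simp only:)
    then show "A \<in> {mat 1, - mat 1}" by (simp only: pm_one_def)
  qed
qed

text \<open>The image of a disc in the orbit space is open because its full preimage is the union of the
translates of the disc.\<close>

lemma cocompact_finite_cover:
  assumes "SL2R_group (SL2R_lift \<Gamma>)" "cocompact \<Gamma>" "\<And>z. z \<in> uhp \<Longrightarrow> r z > 0"
  shows "\<exists>Z. finite Z \<and> Z \<subseteq> uhp \<and>
    (\<forall>\<tau>\<in>uhp. \<exists>\<gamma>\<in>SL2R_lift \<Gamma>. \<exists>z\<in>Z. moebius_action \<gamma> \<tau> \<in> ball z (r z))"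
proof -
  interpret SL2R_group "SL2R_lift \<Gamma>" by fact
  let ?B = "\<lambda>z. ball z (r z) \<inter> uhp"
  let ?O = "\<lambda>z. orbit_of \<Gamma> ` ?B z"
  have orbit_sub: "\<exists>\<gamma>\<in>SL2R_lift \<Gamma>. moebius_action \<gamma> \<tau> \<in> S"
    if \<tau>: "\<tau> \<in> uhp" "orbit_of \<Gamma> \<tau> \<in> orbit_of \<Gamma> ` S" for \<tau> S
  proof -
    obtain s where s: "s \<in> S" "orbit_of \<Gamma> \<tau> = orbit_of \<Gamma> s" using \<tau>(2) by blast
    have "s \<in> orbit_of \<Gamma> s" unfolding orbit_of_def using one_in by (force intro!: image_eqI[of _ _ "mat 1"])
    with s have "s \<in> orbit_of \<Gamma> \<tau>" by simp
    with s(1) show ?thesis by (auto simp: orbit_of_def)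
  qed
  have orbit_eq: "orbit_of \<Gamma> (moebius_action \<gamma> \<tau>) = orbit_of \<Gamma> \<tau>"
    if "\<tau> \<in> uhp" "\<gamma> \<in> SL2R_lift \<Gamma>" for \<tau> \<gamma>
  proof -
    note \<gamma> = \<open>\<gamma> \<in> SL2R_lift \<Gamma>\<close> and \<tau> = \<open>\<tau> \<in> uhp\<close>
    have 1: "moebius_action \<delta> (moebius_action \<gamma> \<tau>) \<in> orbit_of \<Gamma> \<tau>" if \<delta>: "\<delta> \<in> SL2R_lift \<Gamma>" for \<delta>
      unfolding orbit_of_def moebius_action_mult[OF det_one[OF \<delta>] det_one[OF \<gamma>] \<tau>, symmetric]
      using mult_in[OF \<delta> \<gamma>] by (rule imageI)
    have 2: "moebius_action \<delta> \<tau> \<in> orbit_of \<Gamma> (moebius_action \<gamma> \<tau>)" if \<delta>: "\<delta> \<in> SL2R_lift \<Gamma>" for \<delta>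
    proof -
      have "moebius_action (\<delta> ** adj2 \<gamma>) (moebius_action \<gamma> \<tau>) = moebius_action \<delta> \<tau>"
        using \<delta> \<tau> \<gamma> det_one
        by (simp add: moebius_action_mult moebius_action_in_uhp moebius_action_adj2)
      then show ?thesis
        unfolding orbit_of_def using mult_in[OF \<delta> adj2_in[OF \<gamma>]] by (metis (no_types, lifting) imageI)
    qed
    show ?thesis
    proof (intro equalityI subsetI)
      fix x assume "x \<in> orbit_of \<Gamma> (moebius_action \<gamma> \<tau>)"
      then obtain \<delta> where "\<delta> \<in> SL2R_lift \<Gamma>" "x = moebius_action \<delta> (moebius_action \<gamma> \<tau>)"
        unfolding orbit_of_def by blast
      then show "x \<in> orbit_of \<Gamma> \<tau>" using 1 by blast
    next
      fix x assume "x \<in> orbit_of \<Gamma> \<tau>"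
      then obtain \<delta> where "\<delta> \<in> SL2R_lift \<Gamma>" "x = moebius_action \<delta> \<tau>"
        unfolding orbit_of_def by blast
      then show "x \<in> orbit_of \<Gamma> (moebius_action \<gamma> \<tau>)" using 2 by blast
    qed
  qed
  have op: "openin (orbit_surface \<Gamma>) (?O z)" for z
  proof -
    have "{\<tau> \<in> uhp. orbit_of \<Gamma> \<tau> \<in> ?O z} = (\<Union>\<gamma>\<in>SL2R_lift \<Gamma>. moebius_action \<gamma> -` ?B z \<inter> uhp)"
    proof (intro equalityI subsetI)
      fix \<tau> assume "\<tau> \<in> {\<tau> \<in> uhp. orbit_of \<Gamma> \<tau> \<in> ?O z}"
      then show "\<tau> \<in> (\<Union>\<gamma>\<in>SL2R_lift \<Gamma>. moebius_action \<gamma> -` ?B z \<inter> uhp)"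
        using orbit_sub[of \<tau> "?B z"] by auto
    next
      fix \<tau> assume "\<tau> \<in> (\<Union>\<gamma>\<in>SL2R_lift \<Gamma>. moebius_action \<gamma> -` ?B z \<inter> uhp)"
      then obtain \<gamma> where "\<gamma> \<in> SL2R_lift \<Gamma>" "\<tau> \<in> uhp" "moebius_action \<gamma> \<tau> \<in> ?B z" by blast
      then have "orbit_of \<Gamma> \<tau> \<in> ?O z"
        by (subst orbit_eq[symmetric, of \<tau> \<gamma>]) (auto intro: imageI)
      with \<open>\<tau> \<in> uhp\<close> show "\<tau> \<in> {\<tau> \<in> uhp. orbit_of \<Gamma> \<tau> \<in> ?O z}" by simp
    qed
    moreover have "open (moebius_action \<gamma> -` ?B z \<inter> uhp)" if "\<gamma> \<in> SL2R_lift \<Gamma>" for \<gamma>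
    proof -
      have "continuous_on uhp (moebius_action \<gamma>)"
        using moebius_action_holomorphic det_one that holomorphic_on_imp_continuous_on by blast
      then show ?thesis
        using continuous_on_open_vimage[OF open_uhp] open_Int[OF open_ball open_uhp] by blast
    qed
    ultimately have "open {\<tau> \<in> uhp. orbit_of \<Gamma> \<tau> \<in> ?O z}"
      using open_UN[of "SL2R_lift \<Gamma>" "\<lambda>\<gamma>. moebius_action \<gamma> -` ?B z \<inter> uhp"] by (simp only:) blast
    then have "openin (top_of_set uhp) {\<tau> \<in> uhp. orbit_of \<Gamma> \<tau> \<in> ?O z}"
      by (rule open_subset[rotated]) blast
    moreover have "?O z \<subseteq> orbit_of \<Gamma> ` uhp" by (rule image_mono) blast
    ultimately show ?thesis
      unfolding orbit_surface_def openin_quotient_topology topspace_euclidean_subtopology by (rule conjI[rotated])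
  qed
  have cov: "topspace (orbit_surface \<Gamma>) \<subseteq> \<Union>(?O ` uhp)"
  proof
    fix x assume "x \<in> topspace (orbit_surface \<Gamma>)"
    then obtain \<tau> where "\<tau> \<in> uhp" "x = orbit_of \<Gamma> \<tau>"
      unfolding orbit_surface_def topspace_quotient_topology by auto
    moreover from this have "x \<in> ?O \<tau>" using assms(3) by simp
    ultimately show "x \<in> \<Union>(?O ` uhp)" by blast
  qed
  have "openin (orbit_surface \<Gamma>) U" if "U \<in> ?O ` uhp" for U using op that by auto
  then obtain \<F> where \<F>: "finite \<F>" "\<F> \<subseteq> ?O ` uhp" "topspace (orbit_surface \<Gamma>) \<subseteq> \<Union>\<F>"
    using \<open>cocompact \<Gamma>\<close>[unfolded cocompact_def compact_space_alt, rule_format, OF conjI[OF ballI cov]]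
    by blast
  obtain Z where Z: "Z \<subseteq> uhp" "finite Z" "\<F> = ?O ` Z"
    using finite_subset_image[OF \<F>(1,2)] by blast
  from \<F>(3) have Z3: "topspace (orbit_surface \<Gamma>) \<subseteq> \<Union>(?O ` Z)" unfolding Z(3) .
  show ?thesis
  proof (intro exI conjI ballI)
    fix \<tau> assume "\<tau> \<in> uhp"
    then have "orbit_of \<Gamma> \<tau> \<in> topspace (orbit_surface \<Gamma>)"
      unfolding orbit_surface_def topspace_quotient_topology by simp
    then have "orbit_of \<Gamma> \<tau> \<in> \<Union>(?O ` Z)" using Z3 by (rule subsetD[rotated])
    then obtain z where "z \<in> Z" "orbit_of \<Gamma> \<tau> \<in> ?O z" by blast
    then show "\<exists>\<gamma>\<in>SL2R_lift \<Gamma>. \<exists>z\<in>Z. moebius_action \<gamma> \<tau> \<in> ball z (r z)"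
      using orbit_sub[OF \<open>\<tau> \<in> uhp\<close>, of "?B z"] by auto
  qed (use Z in auto)
qed

lemma cocompact_fuchsian_group_lift:
  assumes "fuchsian \<Gamma>" "cocompact \<Gamma>"
  shows "cocompact_fuchsian_group (SL2R_lift \<Gamma>)"
proof -
  interpret SL2R_group "SL2R_lift \<Gamma>"
    using assms(1) SL2R_group_lift by (simp add: fuchsian_def)
  show ?thesis
  proof
    fix r :: "complex \<Rightarrow> real" assume "\<And>z. z \<in> uhp \<Longrightarrow> r z > 0"
    then show "\<exists>Z. finite Z \<and> Z \<subseteq> uhp \<and>
        (\<forall>\<tau>\<in>uhp. \<exists>\<gamma>\<in>SL2R_lift \<Gamma>. \<exists>z\<in>Z. moebius_action \<gamma> \<tau> \<in> ball z (r z))"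
      by (rule cocompact_finite_cover[OF SL2R_group_axioms assms(2)])
  qed (rule fuchsian_discrete[OF assms(1)])
qed

lemma matrix2_tendsto:
  assumes "\<And>i j. ((\<lambda>n. entry (X n) i j) \<longlongrightarrow> entry L i j) F"
  shows "(X \<longlongrightarrow> L) F"
  by (intro vec_tendstoI assms)

context cocompact_fuchsian_group
begin

text \<open>Proper discontinuity. If \<open>z\<close> and \<open>\<gamma> z\<close> both lie in \<open>K\<close>, then \<open>|cz + d|\<^sup>2 = Im z / Im \<gamma> z\<close>
is bounded, which bounds all four entries of \<open>\<gamma>\<close>. Infinitely many such \<open>\<gamma>\<close> would accumulate, and
quotients of nearby ones would contradict discreteness at the identity.\<close>

lemma finite_returns:
  assumes "compact K" "K \<subseteq> uhp"
  shows "finite {\<gamma> \<in> G. \<exists>z\<in>K. moebius_action \<gamma> z \<in> K}" (is "finite ?S")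
proof (rule ccontr)
  assume inf: "infinite ?S"
  then have "K \<noteq> {}" by (auto dest: infinite_imp_nonempty)
  have "continuous_on K Im" by (intro continuous_intros)
  then obtain z0 where z0: "z0 \<in> K" "\<And>z. z \<in> K \<Longrightarrow> Im z0 \<le> Im z"
    using continuous_attains_inf[OF assms(1) \<open>K \<noteq> {}\<close>] by blast
  define m where "m = Im z0"
  have m: "m > 0" "\<And>z. z \<in> K \<Longrightarrow> m \<le> Im z" using z0 assms(2) by (auto simp: m_def uhp_iff)
  obtain R where R: "R > 0" "\<And>z. z \<in> K \<Longrightarrow> cmod z \<le> R"
    using compact_imp_bounded[OF assms(1)] by (auto simp: bounded_pos)
  define B where "B = sqrt (R / m)"
  define C where "C = B + B / m * R + R * B + R * B / m * R + B / m + R * B / m"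
  have "B > 0" using m R by (simp add: B_def)
  have lin: "\<bar>p\<bar> \<le> D / m \<and> \<bar>q\<bar> \<le> D + D / m * R"
    if "z \<in> K" "cmod (of_real p * z + of_real q) \<le> D" for p q D z
  proof -
    have "\<bar>p\<bar> * m \<le> \<bar>p\<bar> * Im z" using m that by (intro mult_left_mono) auto
    also have "\<dots> = \<bar>Im (of_real p * z + of_real q)\<bar>"
      using m(1) m(2)[OF that(1)] by (simp add: abs_mult)
    also have "\<dots> \<le> D" using abs_Im_le_cmod that(2) order_trans by blast
    finally have p: "\<bar>p\<bar> \<le> D / m" using m by (simp add: field_simps)
    have "\<bar>q\<bar> = cmod ((of_real p * z + of_real q) - of_real p * z)" by simp
    also have "\<dots> \<le> cmod (of_real p * z + of_real q) + cmod (of_real p * z)"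
      by (rule norm_triangle_ineq4)
    also have "\<dots> \<le> D + D / m * R"
      unfolding norm_mult norm_of_real using p R(2)[OF that(1)] that(2)
      by (intro add_mono mult_mono) (auto intro: order_trans[OF abs_ge_zero])
    finally show ?thesis using p by blast
  qed
  have entries: "\<bar>entry \<gamma> i j\<bar> \<le> C" if \<gamma>: "\<gamma> \<in> ?S" for \<gamma> i j
  proof -
    obtain z where z: "\<gamma> \<in> G" "z \<in> K" "moebius_action \<gamma> z \<in> K" using \<gamma> by blast
    have zu: "z \<in> uhp" using z assms by blast
    have nz: "aut_factor \<gamma> z \<noteq> 0" using aut_factor_nonzero det_one z(1) zu by blast
    have "m \<le> Im z / (cmod (aut_factor \<gamma> z))\<^sup>2"
      using m(2)[OF z(3)] Im_moebius_action[OF det_one[OF z(1)] zu] by simp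
    then have "(cmod (aut_factor \<gamma> z))\<^sup>2 \<le> Im z / m" using m nz by (simp add: field_simps)
    also have "\<dots> \<le> R / m"
      using m R(2)[OF z(2)] abs_Im_le_cmod[of z] by (intro divide_right_mono) auto
    finally have j: "cmod (aut_factor \<gamma> z) \<le> B" by (simp add: B_def real_le_rsqrt)
    then have cd: "\<bar>entry \<gamma> 2 1\<bar> \<le> B / m" "\<bar>entry \<gamma> 2 2\<bar> \<le> B + B / m * R"
      using lin[OF z(2)] by (auto simp: aut_factor_def)
    have "of_real (entry \<gamma> 1 1) * z + of_real (entry \<gamma> 1 2) = moebius_action \<gamma> z * aut_factor \<gamma> z"
      using nz by (simp add: moebius_action_eq)
    then have "cmod (of_real (entry \<gamma> 1 1) * z + of_real (entry \<gamma> 1 2)) \<le> R * B"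
      using j R(2)[OF z(3)] R(1) by (simp add: norm_mult mult_mono)
    from lin[OF z(2) this] have ab: "\<bar>entry \<gamma> 1 1\<bar> \<le> R * B / m" "\<bar>entry \<gamma> 1 2\<bar> \<le> R * B + R * B / m * R"
      by auto
    have "0 \<le> B / m" "0 \<le> B / m * R" "0 \<le> R * B" "0 \<le> R * B / m * R" "0 \<le> R * B / m" "0 \<le> B"
      using m R \<open>B > 0\<close> by simp_all
    then have "\<bar>entry \<gamma> 1 1\<bar> \<le> C" "\<bar>entry \<gamma> 1 2\<bar> \<le> C" "\<bar>entry \<gamma> 2 1\<bar> \<le> C" "\<bar>entry \<gamma> 2 2\<bar> \<le> C"
      using ab cd unfolding C_def by linarith+
    then show ?thesis using exhaust_2[of i] exhaust_2[of j] by auto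
  qed
  have bdd: "bounded ?S"
  proof (rule boundedI)
    fix \<gamma> :: "real^2^2" assume \<gamma>: "\<gamma> \<in> ?S"
    have "norm (vec_nth \<gamma> i) \<le> C + C" for i
      using norm_le_l1_cart[of "vec_nth \<gamma> i"] entries[OF \<gamma>, of i 1] entries[OF \<gamma>, of i 2]
      by (simp add: sum_2)
    from this[of 1] this[of 2] show "norm \<gamma> \<le> C + C + (C + C)"
      using L2_set_le_sum[of UNIV "\<lambda>i. norm (vec_nth \<gamma> i)"] by (simp add: norm_vec_def sum_2)
  qed
  obtain f :: "nat \<Rightarrow> real^2^2" where f: "inj f" "range f \<subseteq> ?S"
    using infinite_countable_subset[OF inf] by blast
  then have "bounded (range f)" using bdd bounded_subset by blast
  then obtain l r where r: "strict_mono r" "(f \<circ> r) \<longlonglongrightarrow> l"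
    using bounded_imp_convergent_subsequence by blast
  define x where "x = f \<circ> r"
  have xG: "x n \<in> G" for n using f(2) by (auto simp: x_def)
  have injx: "x a = x b \<longleftrightarrow> a = b" for a b
    using f(1) strict_mono_eq[OF r(1)] by (auto simp: x_def inj_def)
  have lim: "(\<lambda>n. entry (x (n + p)) i j) \<longlonglongrightarrow> entry l i j" for p i j
    using LIMSEQ_ignore_initial_segment[OF r(2), of p] unfolding x_def
    by (intro tendsto_vec_nth)
  have "(\<lambda>n. det (x (n + 0))) \<longlonglongrightarrow> det l"
    unfolding det_2 by (intro tendsto_intros lim)
  moreover have "det (x (n + 0)) = 1" for n using xG det_one by blast
  ultimately have "det l = 1" by (simp add: LIMSEQ_const_iff)
  have conv: "(\<lambda>n. adj2 (x (n + 0)) ** x (n + p)) \<longlonglongrightarrow> mat 1" for p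
  proof -
    have adj: "(\<lambda>n. entry (adj2 (x (n + 0))) i j) \<longlonglongrightarrow> entry (adj2 l) i j" for i j
      using exhaust_2[of i] exhaust_2[of j] lim[of 0] tendsto_minus[OF lim[of 0]]
      by (auto simp: adj2_def)
    have "(\<lambda>n. adj2 (x (n + 0)) ** x (n + p)) \<longlonglongrightarrow> adj2 l ** l"
      by (rule matrix2_tendsto) (unfold matrix2_mult_entry, intro tendsto_add tendsto_mult adj lim)
    then show ?thesis using adj2_mult[OF \<open>det l = 1\<close>] by simp
  qed
  obtain W where W: "open W" "mat 1 \<in> W" "W \<inter> G \<subseteq> {mat 1, - mat 1}" using discrete by blast
  have "\<forall>\<^sub>F n in sequentially. adj2 (x (n + 0)) ** x (n + 1) \<in> W \<and> adj2 (x (n + 0)) ** x (n + 2) \<in> W"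
    by (intro eventually_conj topological_tendstoD[OF conv W(1,2)])
  then obtain n where n: "adj2 (x n) ** x (n + 1) \<in> W" "adj2 (x n) ** x (n + 2) \<in> W"
    by (auto simp: eventually_sequentially)
  \<comment> \<open>One quotient close to the identity could be \<open>-1\<close>; hence two successive quotients are compared.\<close>
  have "x (n + p) = - x n" if "p > 0" "adj2 (x n) ** x (n + p) \<in> W" for p
  proof -
    have "adj2 (x n) ** x (n + p) \<in> {mat 1, - mat 1}"
      using that(2) W(3) mult_in[OF adj2_in[OF xG] xG] by blast
    moreover have "x (n + p) = x n ** (adj2 (x n) ** x (n + p))"
      by (simp add: matrix_mul_assoc adj2_mult det_one xG)
    ultimately have "x (n + p) = x n \<or> x (n + p) = - x n"
      by (auto simp: minus_mat_mult)
    then show ?thesis using injx[of "n + p" n] that(1) by auto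
  qed
  from this[of 1] this[of 2] n have "x (n + 1) = x (n + 2)" by simp
  then show False using injx by simp
qed

lemma compact_fundamental_set:
  "\<exists>K. compact K \<and> K \<subseteq> uhp \<and> (\<forall>\<tau>\<in>uhp. \<exists>\<gamma>\<in>G. moebius_action \<gamma> \<tau> \<in> K)"
proof -
  obtain Z where Z: "finite Z" "Z \<subseteq> uhp"
    "\<And>\<tau>. \<tau> \<in> uhp \<Longrightarrow> \<exists>\<gamma>\<in>G. \<exists>z\<in>Z. moebius_action \<gamma> \<tau> \<in> ball z (Im z / 2)"
    using finite_cover[of "\<lambda>z. Im z / 2"] by (auto simp: uhp_iff)
  have "cball z (Im z / 2) \<subseteq> uhp" if "z \<in> uhp" for z
  proof
    fix w assume "w \<in> cball z (Im z / 2)"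
    then have "\<bar>Im (z - w)\<bar> \<le> Im z / 2" using abs_Im_le_cmod[of "z - w"] by (simp add: dist_norm)
    then have "Im (z - w) \<le> Im z / 2" using abs_le_D1 by blast
    then show "w \<in> uhp" using that by (simp add: uhp_iff)
  qed
  moreover have "\<exists>\<gamma>\<in>G. moebius_action \<gamma> \<tau> \<in> (\<Union>z\<in>Z. cball z (Im z / 2))" if "\<tau> \<in> uhp" for \<tau>
    using Z(3)[OF that] ball_subset_cball by blast
  ultimately show ?thesis
    using Z(1,2) by (intro exI[of _ "\<Union>z\<in>Z. cball z (Im z / 2)"]) (auto intro!: compact_UN)
qed

end

section \<open>Scalar automorphic forms on a compact quotient\<close>

context SL2R_group
begin

text \<open>Holomorphic functions with the transformation law of weight \<open>k\<close> on the half-plane; their values elsewhere are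
not restricted.\<close>

definition automorphic :: "int \<Rightarrow> (complex \<Rightarrow> complex) \<Rightarrow> bool" where
  "automorphic k f \<longleftrightarrow> f holomorphic_on uhp \<and>
     (\<forall>\<gamma>\<in>G. \<forall>\<tau>\<in>uhp. f (moebius_action \<gamma> \<tau>) = aut_factor \<gamma> \<tau> powi k * f \<tau>)"

lemma automorphicD:
  assumes "automorphic k f"
  shows "f holomorphic_on uhp"
    "\<gamma> \<in> G \<Longrightarrow> \<tau> \<in> uhp \<Longrightarrow> f (moebius_action \<gamma> \<tau>) = aut_factor \<gamma> \<tau> powi k * f \<tau>"
  using assms by (auto simp: automorphic_def)

text \<open>The Petersson norm: \<open>|f(\<tau>)| (Im \<tau>)\<^sup>m\<close> is invariant in weight \<open>2m\<close> since \<open>Im \<gamma>\<tau> = Im \<tau> / |j|\<^sup>2\<close>.\<close>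

lemma petersson_invariant:
  assumes "automorphic (2 * m) f" "\<gamma> \<in> G" "\<tau> \<in> uhp"
  shows "cmod (f (moebius_action \<gamma> \<tau>)) * Im (moebius_action \<gamma> \<tau>) powi m = cmod (f \<tau>) * Im \<tau> powi m"
proof -
  have nz: "cmod (aut_factor \<gamma> \<tau>) \<noteq> 0" using aut_factor_nonzero assms det_one by auto
  have "cmod (aut_factor \<gamma> \<tau> powi (2 * m)) = (cmod (aut_factor \<gamma> \<tau>))\<^sup>2 powi m"
    by (simp add: norm_power_int norm_power power_int_mult)
  then show ?thesis
    using nz by (simp add: automorphicD[OF assms(1)] assms(2,3) Im_moebius_action det_one norm_mult
      power_int_divide_distrib)
qed

end

context cocompact_fuchsian_group
begin

text \<open>The invariant function is determined by its values on a compact fundamental set.\<close>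

lemma petersson_attains_max:
  assumes "automorphic (2 * m) f"
  obtains \<tau>\<^sub>0 where "\<tau>\<^sub>0 \<in> uhp"
    "\<And>\<tau>. \<tau> \<in> uhp \<Longrightarrow> cmod (f \<tau>) * Im \<tau> powi m \<le> cmod (f \<tau>\<^sub>0) * Im \<tau>\<^sub>0 powi m"
proof -
  obtain K where K: "compact K" "K \<subseteq> uhp" "\<And>\<tau>. \<tau> \<in> uhp \<Longrightarrow> \<exists>\<gamma>\<in>G. moebius_action \<gamma> \<tau> \<in> K"
    using compact_fundamental_set by blast
  have "\<i> \<in> uhp" by (simp add: uhp_iff)
  then have "K \<noteq> {}" using K(3) by blast
  have "continuous_on K f"
    using automorphicD(1)[OF assms] K(2) holomorphic_on_imp_continuous_on continuous_on_subset by blast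
  then have "continuous_on K (\<lambda>\<tau>. cmod (f \<tau>) * Im \<tau> powi m)"
    using K(2) by (intro continuous_intros) (auto simp: uhp_iff)
  then obtain \<tau>\<^sub>0 where t0: "\<tau>\<^sub>0 \<in> K" "\<And>\<tau>. \<tau> \<in> K \<Longrightarrow> cmod (f \<tau>) * Im \<tau> powi m \<le> cmod (f \<tau>\<^sub>0) * Im \<tau>\<^sub>0 powi m"
    using continuous_attains_sup[OF K(1) \<open>K \<noteq> {}\<close>] by blast
  show thesis
  proof
    show "\<tau>\<^sub>0 \<in> uhp" using t0 K by blast
    fix \<tau> assume \<tau>: "\<tau> \<in> uhp"
    then obtain \<gamma> where "\<gamma> \<in> G" "moebius_action \<gamma> \<tau> \<in> K" using K(3) by blast
    then show "cmod (f \<tau>) * Im \<tau> powi m \<le> cmod (f \<tau>\<^sub>0) * Im \<tau>\<^sub>0 powi m"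
      using t0(2) petersson_invariant[OF assms _ \<tau>] by metis
  qed
qed

lemma automorphic_weight_zero_constant:
  assumes "automorphic 0 f" shows "f constant_on uhp"
proof -
  obtain \<tau>\<^sub>0 where "\<tau>\<^sub>0 \<in> uhp" "\<And>\<tau>. \<tau> \<in> uhp \<Longrightarrow> cmod (f \<tau>) \<le> cmod (f \<tau>\<^sub>0)"
    using petersson_attains_max[of 0 f] assms by auto
  then show ?thesis
    using maximum_modulus_principle[OF automorphicD(1)[OF assms] open_uhp convex_connected[OF convex_uhp] open_uhp]
    by blast
qed

text \<open>At a maximum \<open>t\<close> of \<open>|f| y\<^bsup>-m\<^esup>\<close>, with \<open>y\<^sub>0 = Im t\<close>, replace the factor \<open>y\<^bsup>-m\<^esup>\<close> by the modulus of the
holomorphic function \<open>exp(i m (\<tau> - t)/y\<^sub>0)\<close>, suitably normalised: it is bounded by \<open>y\<^bsup>-m\<^esup>\<close> because \<open>ln\<close> is concave, and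
agrees with it at \<open>t\<close>. The maximum modulus principle makes the product with \<open>f\<close> constant, but the bound
is strict away from the line \<open>Im \<tau> = y\<^sub>0\<close>.\<close>

lemma automorphic_negative_weight_zero:
  assumes "automorphic (- 2 * int m) f" "m > 0" "\<tau> \<in> uhp"
  shows "f \<tau> = 0"
proof -
  have aut: "automorphic (2 * (- int m)) f" using assms(1) by simp
  obtain t where t: "t \<in> uhp"
    and le: "\<And>\<tau>. \<tau> \<in> uhp \<Longrightarrow> cmod (f \<tau>) * Im \<tau> powi (- int m) \<le> cmod (f t) * Im t powi (- int m)"
    using petersson_attains_max[OF aut] by blast
  define y where "y = Im t"
  have y: "y > 0" using t by (simp add: y_def uhp_iff)
  define F where "F = (\<lambda>\<tau>. f \<tau> * exp (of_nat m * \<i> * (\<tau> - t) / of_real y))"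
  have normF: "cmod (F \<tau>) = cmod (f \<tau>) * exp (- (of_nat m * (Im \<tau> - y) / y))" for \<tau>
    by (simp add: F_def norm_mult Re_divide y_def power2_eq_square y[unfolded y_def] divide_simps)
  \<comment> \<open>This is \<open>ln(s/y) \<le> s/y - 1\<close>.\<close>
  have key: "exp (- (of_nat m * (s - y) / y)) \<le> y ^ m / s ^ m" if "s > 0" for s :: real
  proof -
    have "s / y \<le> exp (s / y - 1)" using exp_ge_add_one_self[of "s / y - 1"] by simp
    then have "(s / y) ^ m \<le> exp (s / y - 1) ^ m" using that y by (intro power_mono) auto
    also have "\<dots> = exp (of_nat m * (s - y) / y)"
      using y by (simp add: exp_of_nat_mult[symmetric] field_simps)
    finally have "inverse (exp (of_nat m * (s - y) / y)) \<le> inverse ((s / y) ^ m)"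
      using that y by (intro le_imp_inverse_le) auto
    then show ?thesis using that y by (simp add: exp_minus power_divide)
  qed
  have le': "cmod (f \<tau>) * (y ^ m / Im \<tau> ^ m) \<le> cmod (f t)" if "\<tau> \<in> uhp" for \<tau>
    using le[OF that] y that
    by (simp add: power_int_minus y_def[symmetric] uhp_iff divide_simps mult.commute)
  have "cmod (F \<tau>) \<le> cmod (F t)" if "\<tau> \<in> uhp" for \<tau>
  proof -
    have "cmod (F \<tau>) \<le> cmod (f \<tau>) * (y ^ m / Im \<tau> ^ m)"
      unfolding normF using key[of "Im \<tau>"] that by (intro mult_left_mono) (auto simp: uhp_iff)
    also have "\<dots> \<le> cmod (F t)" using le'[OF that] by (simp add: normF y_def)
    finally show ?thesis .
  qed
  moreover have "F holomorphic_on uhp"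
    unfolding F_def using automorphicD(1)[OF aut] by (intro holomorphic_intros) (use y in auto)
  ultimately have "F constant_on uhp"
    using maximum_modulus_principle[OF _ open_uhp convex_connected[OF convex_uhp] open_uhp subset_refl t] by blast
  \<comment> \<open>Any point at another height would do; at height \<open>2y\<close> the comparison reads \<open>2\<^sup>m < e\<^sup>m\<close>.\<close>
  moreover define u where "u = t + \<i> * of_real y"
  moreover have u: "u \<in> uhp" using t y by (simp add: u_def uhp_iff)
  ultimately have "F u = F t" using t by (auto simp: constant_on_def)
  have "Im u = 2 * y" by (simp add: u_def y_def)
  have "cmod (f t) = cmod (F u)" using \<open>F u = F t\<close> by (simp add: normF y_def)
  also have "\<dots> = cmod (f u) * exp (- of_nat m)"
    using y by (simp add: normF \<open>Im u = 2 * y\<close>)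
  also have "\<dots> \<le> cmod (f t) * 2 ^ m * exp (- of_nat m)"
    using le'[OF u] y by (intro mult_right_mono) (auto simp: \<open>Im u = 2 * y\<close> power_mult_distrib field_simps)
  finally have *: "cmod (f t) \<le> cmod (f t) * (2 ^ m * exp (- of_nat m))" by (simp add: mult.assoc)
  have "(2::real) < exp 1" using exp_lower_Taylor_quadratic[of "1::real"] by simp
  then have "(2::real) ^ m < exp 1 ^ m" using assms(2) by (intro power_strict_mono) auto
  then have "2 ^ m * exp (- of_nat m) < (1::real)"
    by (simp add: exp_of_nat_mult[symmetric] exp_minus field_simps)
  with * have "cmod (f t) = 0" by (smt (verit) mult_less_cancel_left2 norm_ge_zero)
  then have "cmod (f \<tau>) * (y ^ m / Im \<tau> ^ m) \<le> 0" using le'[OF assms(3)] by simp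
  moreover have "y ^ m / Im \<tau> ^ m > 0" using assms(3) y by (simp add: uhp_iff)
  ultimately show ?thesis by (metis mult_pos_pos not_less zero_less_norm_iff)
qed

end

text \<open>A Schwarz lemma with a wasteful constant: the Cauchy estimates bound the \<open>i\<close>-th Taylor term on the half-size
disc by \<open>S / 2\<^sup>i\<close>, and the terms with \<open>i < N\<close> vanish.\<close>

lemma norm_le_of_vanishing_derivatives:
  assumes "f holomorphic_on ball z R" "continuous_on (cball z R) f" "R > 0"
    and "\<And>x. x \<in> cball z R \<Longrightarrow> cmod (f x) \<le> S"
    and "\<And>i. i < N \<Longrightarrow> (deriv ^^ i) f z = 0"
    and "dist z w \<le> R / 2"
  shows "cmod (f w) \<le> S * 2 / 2 ^ N"
proof -
  define a where "a n = (deriv ^^ n) f z / fact n * (w - z) ^ n" for n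
  have S: "S \<ge> 0" using assms(4)[of z] assms(3) by (meson centre_in_cball less_imp_le norm_ge_zero order_trans)
  have "w \<in> ball z R" using assms(3,6) by simp
  then have sums: "a sums f w" unfolding a_def by (rule holomorphic_power_series[OF assms(1)])
  have bound: "cmod (a n) \<le> S * (1 / 2) ^ n" for n
  proof -
    have "cmod ((deriv ^^ n) f z) \<le> fact n * S / R ^ n"
      by (rule Cauchy_inequality[OF assms(1-3)]) (auto intro!: assms(4) simp: dist_norm)
    then have "cmod (a n) \<le> (S / R ^ n) * (R / 2) ^ n"
      unfolding a_def norm_mult norm_divide norm_power
      using assms(3,6) S by (intro mult_mono power_mono) (auto simp: dist_norm norm_minus_commute field_simps)
    then show ?thesis using assms(3) by (simp add: power_divide)
  qed
  have z: "a n = 0" if "n < N" for n using assms(5)[OF that] by (simp add: a_def)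
  have "(\<lambda>n. a (n + N)) sums (f w - (\<Sum>i<N. a i))" using sums by (rule sums_split_initial_segment)
  then have sums': "(\<lambda>n. a (n + N)) sums f w" using z by simp
  have g: "(\<lambda>n. S * (1 / 2) ^ (n + N)) sums (S * 2 / 2 ^ N)"
    using sums_mult[OF geometric_sums[of "1/2::real"], of "S / 2 ^ N"]
    by (simp add: power_add power_divide mult_ac)
  have "cmod (suminf (\<lambda>n. a (n + N))) \<le> suminf (\<lambda>n. S * (1 / 2) ^ (n + N))"
    by (rule norm_suminf_le) (use bound g sums_summable in auto)
  then show ?thesis using sums_unique[OF sums'] sums_unique[OF g] by simp
qed

context cocompact_fuchsian_group
begin

text \<open>Choose discs of radius a quarter of the height of the centre which cover the quotient. On the disc twice as large the
height varies by a bounded ratio, so vanishing to order \<open>N\<close> at the centres bounds the maximal Petersson norm by \<open>3\<^sup>m * 2 / 2\<^sup>N\<close> times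
itself. The same \<open>N\<close> serves for all discs.\<close>

lemma automorphic_determined_by_jets:
  obtains Z N where "finite Z" "Z \<subseteq> uhp"
    "\<And>f \<tau>. automorphic (2 * int m) f \<Longrightarrow> (\<And>z i. z \<in> Z \<Longrightarrow> i < N \<Longrightarrow> (deriv ^^ i) f z = 0) \<Longrightarrow> \<tau> \<in> uhp \<Longrightarrow> f \<tau> = 0"
proof -
  obtain Z where Z: "finite Z" "Z \<subseteq> uhp"
    "\<And>\<tau>. \<tau> \<in> uhp \<Longrightarrow> \<exists>\<gamma>\<in>G. \<exists>z\<in>Z. moebius_action \<gamma> \<tau> \<in> ball z (Im z / 4)"
    using finite_cover[of "\<lambda>z. Im z / 4"] by (auto simp: uhp_iff)
  obtain N where N: "(3::real) ^ m * 2 < 2 ^ N" using real_arch_pow[of 2 "3 ^ m * 2"] by auto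
  show thesis
  proof (rule that[OF Z(1,2), of N])
    fix f \<tau> assume f: "automorphic (2 * int m) f"
      and van: "\<And>z i. z \<in> Z \<Longrightarrow> i < N \<Longrightarrow> (deriv ^^ i) f z = 0" and \<tau>: "\<tau> \<in> uhp"
    obtain t' where t': "t' \<in> uhp" "\<And>\<tau>. \<tau> \<in> uhp \<Longrightarrow> cmod (f \<tau>) * Im \<tau> powi int m \<le> cmod (f t') * Im t' powi int m"
      using petersson_attains_max[OF f] by blast
    obtain \<gamma> z where gz: "\<gamma> \<in> G" "z \<in> Z" "moebius_action \<gamma> t' \<in> ball z (Im z / 4)" using Z(3)[OF t'(1)] by blast
    define t where "t = moebius_action \<gamma> t'"
    define M where "M = cmod (f t) * Im t ^ m"
    have t: "t \<in> uhp" using moebius_action_in_uhp det_one gz(1) t'(1) by (simp add: t_def)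
    have max: "cmod (f \<tau>) * Im \<tau> ^ m \<le> M" if "\<tau> \<in> uhp" for \<tau>
      using t'(2)[OF that] petersson_invariant[OF f gz(1) t'(1)] by (simp add: M_def t_def power_int_def)
    have z: "Im z > 0" using gz(2) Z(2) by (auto simp: uhp_iff)
    have M: "M \<ge> 0" using t by (simp add: M_def uhp_iff)
    have im: "Im z / 2 \<le> Im x" if "x \<in> cball z (Im z / 2)" for x
      using that abs_Im_le_cmod[of "z - x"] by (simp add: dist_norm)
    have sub: "cball z (Im z / 2) \<subseteq> uhp" using im z by (force simp: uhp_iff)
    have "cmod (f t) \<le> (M / (Im z / 2) ^ m) * 2 / 2 ^ N"
    proof (rule norm_le_of_vanishing_derivatives[where f = f and w = t and z = z and R = "Im z / 2"])
      show "f holomorphic_on ball z (Im z / 2)"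
        using automorphicD(1)[OF f] by (rule holomorphic_on_subset) (use sub ball_subset_cball in \<open>rule order_trans[rotated]\<close>)
      show "continuous_on (cball z (Im z / 2)) f"
        using holomorphic_on_imp_continuous_on[OF automorphicD(1)[OF f]] sub by (rule continuous_on_subset)
      fix x assume x: "x \<in> cball z (Im z / 2)"
      have "cmod (f x) * (Im z / 2) ^ m \<le> cmod (f x) * Im x ^ m"
        using im[OF x] z by (intro mult_left_mono power_mono) auto
      also have "\<dots> \<le> M" using max sub x by blast
      finally show "cmod (f x) \<le> M / (Im z / 2) ^ m" using z by (simp add: field_simps)
    qed (use z van gz in \<open>auto simp: t_def\<close>)
    moreover have "Im t \<le> 3 * (Im z / 2)"
      using gz(3) abs_Im_le_cmod[of "z - t"] z by (simp add: dist_norm t_def)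
    ultimately have "M \<le> ((M / (Im z / 2) ^ m) * 2 / 2 ^ N) * (3 * (Im z / 2)) ^ m"
      unfolding M_def using t z by (intro mult_mono power_mono) (auto simp: uhp_iff)
    also have "\<dots> = M * (3 ^ m * 2 / 2 ^ N)"
      using z unfolding power_mult_distrib by (simp add: divide_simps)
    finally have "M \<le> M * (3 ^ m * 2 / 2 ^ N)" .
    moreover have "3 ^ m * 2 / 2 ^ N < (1::real)" using N by simp
    ultimately have "M = 0" using M by (smt (verit) mult_less_cancel_left2)
    then have "cmod (f \<tau>) * Im \<tau> ^ m \<le> 0" using max[OF \<tau>] by simp
    moreover have "Im \<tau> ^ m > 0" using \<tau> by (simp add: uhp_iff)
    ultimately show "f \<tau> = 0" by (simp add: mult_le_0_iff)
  qed
qed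

end

context SL2R_group
begin

text \<open>Extension by zero outside the half-plane makes forms correspond to honest functions on the plane, so that distinct
elements are distinct forms.\<close>

definition scalar_forms :: "int \<Rightarrow> (complex \<Rightarrow> complex) set" where
  "scalar_forms k = {f. automorphic k f \<and> (\<forall>\<tau>. \<tau> \<notin> uhp \<longrightarrow> f \<tau> = 0)}"

lemma subspace_scalar_forms: "module.subspace (fun_scale (*)) (scalar_forms k)"
proof -
  interpret FC: vector_space "fun_scale (*) :: complex \<Rightarrow> (complex \<Rightarrow> complex) \<Rightarrow> _"
    by (rule vector_space_fun_scale[OF vector_space_complex])
  show ?thesis
    unfolding FC.subspace_def scalar_forms_def automorphic_def fun_scale_def plus_fun_def zero_fun_def
    by (auto intro!: holomorphic_intros simp: algebra_simps)
qed

end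

lemma (in cocompact_fuchsian_group) finite_dim_scalar_forms:
  "finite_dim_subspace (fun_scale (*)) (scalar_forms (2 * int m))"
proof -
  obtain Z N where Z: "finite Z" "Z \<subseteq> uhp" and
    van: "\<And>f \<tau>. automorphic (2 * int m) f \<Longrightarrow> (\<And>z i. z \<in> Z \<Longrightarrow> i < N \<Longrightarrow> (deriv ^^ i) f z = 0) \<Longrightarrow> \<tau> \<in> uhp \<Longrightarrow> f \<tau> = 0"
    by (rule automorphic_determined_by_jets[of m]) blast
  let ?L = "(\<lambda>(z, i) f. (deriv ^^ i) f z) ` (Z \<times> {..<N})"
  have hol: "f holomorphic_on uhp" if "f \<in> scalar_forms k" for f k
    using that automorphicD(1) by (auto simp: scalar_forms_def)
  show ?thesis
  proof (rule finite_dim_subspace_by_functionals[OF vector_space_fun_scale[OF vector_space_complex] _ subspace_scalar_forms])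
    show "finite ?L" using Z by simp
    fix l f g and c :: complex assume l: "l \<in> ?L" and f: "f \<in> scalar_forms (2 * int m)"
    then obtain z i where z: "z \<in> uhp" "l = (\<lambda>f. (deriv ^^ i) f z)" using Z(2) by auto
    show "l (fun_scale (*) c f) = c * l f"
      using higher_deriv_cmult[OF hol[OF f] z(1) open_uhp, of i c] by (simp add: z(2) fun_scale_def)
    assume g: "g \<in> scalar_forms (2 * int m)"
    show "l (f + g) = l f + l g"
      using higher_deriv_add[OF hol[OF f] hol[OF g] open_uhp z(1), of i] by (simp add: z(2) plus_fun_def)
  next
    fix f assume f: "f \<in> scalar_forms (2 * int m)" and l: "\<And>l. l \<in> ?L \<Longrightarrow> l f = 0"
    show "f = 0"
    proof
      fix \<tau>
      have "f \<tau> = 0" if "\<tau> \<in> uhp"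
      proof (rule van[OF _ _ that])
        show "automorphic (2 * int m) f" using f by (simp add: scalar_forms_def)
        show "(deriv ^^ i) f z = 0" if "z \<in> Z" "i < N" for z i
          using l[of "\<lambda>f. (deriv ^^ i) f z"] that by force
      qed
      then show "f \<tau> = 0 \<tau>" using f by (auto simp: scalar_forms_def)
    qed
  qed
qed

lemma (in cocompact_fuchsian_group) scalar_forms_weight_zero:
  "scalar_forms 0 = module.span (fun_scale (*)) {indicator uhp}"
  "vector_space.dim (fun_scale (*)) (scalar_forms 0) = 1"
proof -
  interpret FC: vector_space "fun_scale (*) :: complex \<Rightarrow> (complex \<Rightarrow> complex) \<Rightarrow> _"
    by (rule vector_space_fun_scale[OF vector_space_complex])
  show eq: "scalar_forms 0 = FC.span {indicator uhp}"
  proof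
    show "scalar_forms 0 \<subseteq> FC.span {indicator uhp}"
    proof
      fix f assume f: "f \<in> scalar_forms 0"
      then have "f constant_on uhp" by (intro automorphic_weight_zero_constant) (simp add: scalar_forms_def)
      then obtain c where "\<And>\<tau>. \<tau> \<in> uhp \<Longrightarrow> f \<tau> = c" by (auto simp: constant_on_def)
      then have "f = fun_scale (*) c (indicator uhp)"
        using f by (auto simp: fun_scale_def fun_eq_iff indicator_def scalar_forms_def)
      then show "f \<in> FC.span {indicator uhp}" by (simp add: FC.span_scale FC.span_base)
    qed
    have "(indicator uhp :: complex \<Rightarrow> complex) \<in> scalar_forms 0"
      unfolding scalar_forms_def automorphic_def
    proof (intro CollectI conjI ballI allI impI)
      show "(indicator uhp :: complex \<Rightarrow> complex) holomorphic_on uhp"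
        by (rule holomorphic_transform[of "\<lambda>_. 1"]) auto
    qed (auto simp: moebius_action_in_uhp det_one)
    then show "FC.span {indicator uhp} \<subseteq> scalar_forms 0"
      by (intro FC.span_minimal subspace_scalar_forms) simp
  qed
  have "(indicator uhp :: complex \<Rightarrow> complex) \<i> \<noteq> 0 \<i>" by (simp add: uhp_iff)
  then have "(indicator uhp :: complex \<Rightarrow> complex) \<noteq> 0" by metis
  then have "FC.independent {indicator uhp}" by simp
  from finite_dim_subspaceI(2)[OF FC.vector_space_axioms _ this eq[symmetric]]
  show "FC.dim (scalar_forms 0) = 1" by simp
qed

section \<open>Conformal change of variables and hyperbolic area\<close>

text \<open>The isometry along which change of variables is transported from \<open>\<real>\<^sup>2\<close> to the complex plane.\<close>

definition complex_of_vec :: "real^2 \<Rightarrow> complex" where "complex_of_vec v = Complex (vec_nth v 1) (vec_nth v 2)"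
definition vec_of_complex :: "complex \<Rightarrow> real^2" where "vec_of_complex z = vector [Re z, Im z]"

lemma complex_of_vec_inverse [simp]: "complex_of_vec (vec_of_complex z) = z" "vec_of_complex (complex_of_vec v) = v"
  by (auto simp: complex_of_vec_def vec_of_complex_def vec_eq_iff forall_2)

lemma bounded_linear_complex_of_vec: "bounded_linear complex_of_vec"
  by (rule linear_conv_bounded_linear[THEN iffD1]) (auto intro!: linearI simp: complex_of_vec_def complex_eq_iff)

lemma bounded_linear_vec_of_complex: "bounded_linear vec_of_complex"
  by (rule linear_conv_bounded_linear[THEN iffD1]) (auto intro!: linearI simp: vec_of_complex_def vec_eq_iff forall_2)

lemma measurable_complex_of_vec: "complex_of_vec \<in> borel_measurable borel"
  by (intro borel_measurable_continuous_onI linear_continuous_on bounded_linear_complex_of_vec)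

lemma distr_lborel_complex_of_vec: "distr lborel borel complex_of_vec = (lborel :: complex measure)"
proof (rule lborel_eqI[symmetric])
  fix l u :: complex assume le: "\<And>b. b \<in> Basis \<Longrightarrow> l \<bullet> b \<le> u \<bullet> b"
  have "complex_of_vec -` box l u = box (vec_of_complex l) (vec_of_complex u)"
    by (auto simp: mem_box_cart forall_2 in_box_complex_iff complex_of_vec_def vec_of_complex_def)
  moreover have "emeasure lborel (box (vec_of_complex l) (vec_of_complex u)) = (\<Prod>b\<in>Basis. (vec_of_complex u - vec_of_complex l) \<bullet> b)"
  proof (rule emeasure_lborel_box)
    have "vec_nth (vec_of_complex l) i \<le> vec_nth (vec_of_complex u) i" for i
      using exhaust_2[of i] le[of 1] le[of \<i>] by (auto simp: vec_of_complex_def Basis_complex_def)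
    then show "vec_of_complex l \<bullet> b \<le> vec_of_complex u \<bullet> b" if "b \<in> Basis" for b
      using that by (auto simp: Basis_vec_def inner_axis)
  qed
  moreover have "(\<Prod>b\<in>Basis. (vec_of_complex u - vec_of_complex l) \<bullet> b) = (\<Prod>b\<in>Basis. (u - l) \<bullet> b)"
  proof -
    have B: "(Basis :: (real^2) set) = {axis 1 1, axis 2 1}"
      by (auto simp: Basis_vec_def UNIV_2)
    have "axis 1 1 \<noteq> (axis 2 1 :: real^2)" by (simp add: axis_eq_axis)
    then show ?thesis unfolding B by (simp add: Basis_complex_def inner_axis vec_of_complex_def inner_complex_def)
  qed
  ultimately show "emeasure (distr lborel borel complex_of_vec) (box l u) = (\<Prod>b\<in>Basis. (u - l) \<bullet> b)"
    by (simp add: emeasure_distr measurable_complex_of_vec)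
qed simp

lemma integral_complex_eq_lebesgue:
  assumes "(h :: complex \<Rightarrow> real) \<in> borel_measurable borel"
  shows "integral\<^sup>L lborel h = integral\<^sup>L lebesgue (\<lambda>v. h (complex_of_vec v))"
proof -
  have m: "(\<lambda>v. h (complex_of_vec v)) \<in> borel_measurable borel"
    using assms measurable_complex_of_vec by (rule measurable_compose[rotated])
  have "integral\<^sup>L lborel h = integral\<^sup>L (distr lborel borel complex_of_vec) h" by (simp add: distr_lborel_complex_of_vec)
  also have "\<dots> = integral\<^sup>L lborel (\<lambda>v. h (complex_of_vec v))"
    using assms measurable_complex_of_vec by (simp add: integral_distr)
  also have "\<dots> = integral\<^sup>L lebesgue (\<lambda>v. h (complex_of_vec v))"
    using m by (simp add: integral_completion)
  finally show ?thesis .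
qed

text \<open>The general theorem speaks of integrability and value together. Since non-integrable functions have integral
zero, the equation between integrals holds unconditionally.\<close>

lemma integral_change_of_variables_lebesgue:
  fixes f :: "real^2 \<Rightarrow> real"
  assumes "S \<in> sets lebesgue"
    and "\<And>x. x \<in> S \<Longrightarrow> (g has_derivative g' x) (at x within S)" and "inj_on g S"
  shows "(LINT v:S|lebesgue. \<bar>det (matrix (g' v))\<bar> * f (g v)) = (LINT v:g ` S|lebesgue. f v)"
proof -
  let ?F = "\<lambda>v. vec (f v) :: real^1"
  let ?G = "\<lambda>v. \<bar>det (matrix (g' v))\<bar> *\<^sub>R ?F (g v)"
  note cv = has_absolute_integral_change_of_variables[OF assms, of ?F]
  have G1: "(\<lambda>v. vec_nth (?G v) 1) = (\<lambda>v. \<bar>det (matrix (g' v))\<bar> * f (g v))" by simp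
  have F1: "(\<lambda>v. vec_nth (?F v) 1) = f" by simp
  have iff: "?G absolutely_integrable_on S \<longleftrightarrow> ?F absolutely_integrable_on g ` S"
    using cv by blast
  show ?thesis
  proof (cases "?F absolutely_integrable_on g ` S")
    case True
    then have G: "?G absolutely_integrable_on S" using iff by simp
    have eq: "integral S ?G = integral (g ` S) ?F" using cv True by blast
    have "(LINT v:S|lebesgue. \<bar>det (matrix (g' v))\<bar> * f (g v)) = integral S (\<lambda>v. \<bar>det (matrix (g' v))\<bar> * f (g v))"
      using set_lebesgue_integral_eq_integral(2)[OF G[unfolded absolutely_integrable_on_1_iff G1]] .
    also have "\<dots> = vec_nth (integral S ?G) 1"
      using integral_component_eq_cart[OF set_lebesgue_integral_eq_integral(1)[OF G], of 1] G1 by simp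
    also have "\<dots> = integral (g ` S) f"
      using integral_component_eq_cart[OF set_lebesgue_integral_eq_integral(1)[OF True], of 1] F1 eq by simp
    also have "\<dots> = (LINT v:g ` S|lebesgue. f v)"
      using set_lebesgue_integral_eq_integral(2)[OF True[unfolded absolutely_integrable_on_1_iff F1]] by simp
    finally show ?thesis .
  next
    case False
    then have "\<not> ?G absolutely_integrable_on S" using iff by simp
    then show ?thesis using False unfolding absolutely_integrable_on_1_iff G1 F1
      by (simp add: set_lebesgue_integral_def set_integrable_def not_integrable_integral_eq)
  qed
qed

text \<open>The real Jacobian of a complex differentiable map is \<open>|g'|\<^sup>2\<close>.\<close>

lemma conformal_change_of_variables:
  fixes f :: "complex \<Rightarrow> real"
  assumes S: "S \<in> sets borel"
    and der: "\<And>z. z \<in> S \<Longrightarrow> (g has_field_derivative g' z) (at z within S)" and inj: "inj_on g S"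
    and f: "(\<lambda>z. indicator (g ` S) z * f z) \<in> borel_measurable borel"
    and fg: "(\<lambda>z. indicator S z * ((cmod (g' z))\<^sup>2 * f (g z))) \<in> borel_measurable borel"
  shows "(\<integral>z. indicator S z * ((cmod (g' z))\<^sup>2 * f (g z)) \<partial>lborel) = (\<integral>z. indicator (g ` S) z * f z \<partial>lborel)"
proof -
  let ?S = "vec_of_complex ` S" and ?g = "\<lambda>v. vec_of_complex (g (complex_of_vec v))" and ?g' = "\<lambda>v h. vec_of_complex (g' (complex_of_vec v) * complex_of_vec h)"
  have S_eq: "?S = complex_of_vec -` S" by (auto simp: image_iff) (metis complex_of_vec_inverse(2))
  have "complex_of_vec -` S \<inter> space borel \<in> sets borel" using measurable_complex_of_vec S by (rule measurable_sets)
  then have "?S \<in> sets borel" by (simp add: S_eq)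
  then have SL: "?S \<in> sets lebesgue" by simp
  have der': "(?g has_derivative ?g' v) (at v within ?S)" if "v \<in> ?S" for v
  proof -
    have "(g has_derivative (*) (g' (complex_of_vec v))) (at (complex_of_vec v) within complex_of_vec ` ?S)"
      using der[of "complex_of_vec v"] that by (auto simp: has_field_derivative_def image_image)
    from has_derivative_in_compose[OF bounded_linear_imp_has_derivative[OF bounded_linear_complex_of_vec] this]
    have "((\<lambda>v. g (complex_of_vec v)) has_derivative (\<lambda>h. g' (complex_of_vec v) * complex_of_vec h)) (at v within ?S)" .
    from bounded_linear.has_derivative[OF bounded_linear_vec_of_complex this] show ?thesis .
  qed
  have inj': "inj_on ?g ?S"
    using inj by (auto simp: inj_on_def) (metis complex_of_vec_inverse(1))
  have det: "det (matrix (?g' v)) = (cmod (g' (complex_of_vec v)))\<^sup>2" for v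
    unfolding cmod_power2 by (simp add: det_2 matrix_def complex_of_vec_def vec_of_complex_def axis_def power2_eq_square)
  have im: "?g ` ?S = vec_of_complex ` g ` S" by (simp add: image_image)
  have ind: "indicator (vec_of_complex ` A) v = (indicator A (complex_of_vec v) :: real)" for A v
    by (auto simp: indicator_def image_iff) (metis complex_of_vec_inverse(2))
  have "(\<integral>z. indicator S z * ((cmod (g' z))\<^sup>2 * f (g z)) \<partial>lborel)
      = (LINT v:?S|lebesgue. \<bar>det (matrix (?g' v))\<bar> * f (complex_of_vec (?g v)))"
    using integral_complex_eq_lebesgue[OF fg] by (simp add: set_lebesgue_integral_def det ind)
  also have "\<dots> = (LINT v:vec_of_complex ` g ` S|lebesgue. f (complex_of_vec v))"
    using integral_change_of_variables_lebesgue[OF SL der' inj', of "\<lambda>v. f (complex_of_vec v)"] unfolding im .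
  also have "\<dots> = (\<integral>z. indicator (g ` S) z * f z \<partial>lborel)"
    using integral_complex_eq_lebesgue[OF f] by (simp add: set_lebesgue_integral_def ind)
  finally show ?thesis .
qed

text \<open>The measure \<open>dx dy / y\<^sup>2\<close>.\<close>

definition hyp_area :: "complex measure" where
  "hyp_area = density lborel (\<lambda>z. ennreal (indicator uhp z / (Im z)\<^sup>2))"

lemma sets_hyp [simp, measurable_cong]: "sets hyp_area = sets borel" and space_hyp [simp]: "space hyp_area = UNIV"
  by (simp_all add: hyp_area_def)

lemma borel_uhp [measurable]: "uhp \<in> sets borel"
  using open_uhp by simp

lemma borel_measurable_Im [measurable]: "Im \<in> borel_measurable borel"
  and borel_measurable_Re [measurable]: "Re \<in> borel_measurable borel"
  by (intro borel_measurable_continuous_onI continuous_intros)+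

lemma sigma_finite_hyp: "sigma_finite_measure hyp_area"
  unfolding hyp_area_def by (subst sigma_finite_measure.sigma_finite_iff_density_finite[OF sigma_finite_lborel]) auto

lemma integral_hyp:
  fixes f :: "complex \<Rightarrow> real"
  assumes [measurable]: "f \<in> borel_measurable borel"
  shows "integral\<^sup>L hyp_area f = (\<integral>z. indicator uhp z * (f z / (Im z)\<^sup>2) \<partial>lborel)"
  unfolding hyp_area_def by (subst integral_density) (auto intro!: Bochner_Integration.integral_cong)

lemma measurable_moebius_action [measurable]: "moebius_action \<gamma> \<in> borel_measurable borel"
  unfolding moebius_action_eq[abs_def] aut_factor_def by measurable

lemma measurable_aut_factor [measurable]: "aut_factor \<gamma> \<in> borel_measurable borel"
  unfolding aut_factor_def[abs_def] by measurable

text \<open>\<open>|\<gamma>'(z)|\<^sup>2 / (Im \<gamma> z)\<^sup>2 = 1 / (Im z)\<^sup>2\<close>.\<close>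

lemma integral_hyp_moebius:
  fixes f :: "complex \<Rightarrow> real"
  assumes \<gamma>: "det \<gamma> = 1" and [measurable]: "f \<in> borel_measurable borel"
  shows "(\<integral>z. f (moebius_action \<gamma> z) \<partial>hyp_area) = integral\<^sup>L hyp_area f"
proof -
  let ?g' = "\<lambda>z. 1 / (aut_factor \<gamma> z)\<^sup>2"
  have "(\<integral>z. f (moebius_action \<gamma> z) \<partial>hyp_area)
      = (\<integral>z. indicator uhp z * ((cmod (?g' z))\<^sup>2 * (f (moebius_action \<gamma> z) / (Im (moebius_action \<gamma> z))\<^sup>2)) \<partial>lborel)"
    by (subst integral_hyp)
       (auto intro!: Bochner_Integration.integral_cong
         simp: Im_moebius_action[OF \<gamma>] aut_factor_nonzero[OF \<gamma>] norm_divide norm_power power_divide indicator_def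
           split: if_splits simp flip: power_mult)
  also have "\<dots> = (\<integral>z. indicator (moebius_action \<gamma> ` uhp) z * (f z / (Im z)\<^sup>2) \<partial>lborel)"
    using moebius_action_bij[OF \<gamma>]
    by (intro conformal_change_of_variables moebius_action_has_derivative[OF \<gamma>])
       (auto simp: bij_betw_def)
  also have "\<dots> = integral\<^sup>L hyp_area f"
    using moebius_action_bij[OF \<gamma>] by (simp add: bij_betw_def integral_hyp)
  finally show ?thesis .
qed

lemma emeasure_hyp_compact:
  assumes "compact K" "K \<subseteq> uhp"
  shows "emeasure hyp_area K < \<infinity>"
proof (cases "K = {}")
  case False
  have "continuous_on K Im" by (intro continuous_intros)
  then obtain z0 where z0: "z0 \<in> K" "\<And>z. z \<in> K \<Longrightarrow> Im z0 \<le> Im z"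
    using continuous_attains_inf[OF assms(1) False] by blast
  define m where "m = Im z0"
  have m: "m > 0" using z0 assms(2) by (auto simp: m_def uhp_iff)
  have [measurable]: "K \<in> sets borel" using assms by (simp add: compact_imp_closed)
  have "emeasure hyp_area K = (\<integral>\<^sup>+z. ennreal (indicator uhp z / (Im z)\<^sup>2) * indicator K z \<partial>lborel)"
    unfolding hyp_area_def by (subst emeasure_density) auto
  also have "\<dots> \<le> (\<integral>\<^sup>+z. ennreal (1 / m\<^sup>2) * indicator K z \<partial>lborel)"
    using m z0 by (intro nn_integral_mono)
      (auto simp: indicator_def m_def uhp_iff intro!: ennreal_leI divide_left_mono power_mono mult_pos_pos zero_less_power)
  also have "\<dots> = ennreal (1 / m\<^sup>2) * emeasure lborel K"
    by (subst nn_integral_cmult_indicator) auto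
  also have "\<dots> < \<infinity>"
    using emeasure_bounded_finite[OF compact_imp_bounded[OF assms(1)]] by (simp add: ennreal_mult_less_top)
  finally show ?thesis .
qed simp

section \<open>Hyperbolic discs and the mean value property\<close>

text \<open>Mean value property without polar coordinates. In the power series of \<open>G\<close>, the term \<open>a\<^sub>m \<zeta>\<^sup>m\<close> with \<open>m > 0\<close>
changes sign under the rotation by \<open>u = e\<^bsup>i\<pi>/m\<^esup>\<close>, which preserves both the disc and the radial weight; so its
weighted integral vanishes, and the series may be integrated termwise.\<close>

lemma integral_radial_times_harmonic:
  fixes \<kappa> :: "complex \<Rightarrow> real"
  assumes G: "G holomorphic_on ball 0 1" "G 0 = 0"
    and [measurable]: "\<kappa> \<in> borel_measurable borel"
    and rot: "\<And>u \<zeta>. cmod u = 1 \<Longrightarrow> \<kappa> (u * \<zeta>) = \<kappa> \<zeta>"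
    and bdd: "\<And>\<zeta>. \<zeta> \<in> cball 0 (1/2) \<Longrightarrow> \<bar>\<kappa> \<zeta>\<bar> \<le> B"
  shows "(\<integral>\<zeta>. indicator (cball 0 (1/2)) \<zeta> * (\<kappa> \<zeta> * Re (G \<zeta>)) \<partial>lborel) = 0"
proof -
  let ?S = "cball (0::complex) (1/2)"
  define a where "a m = (deriv ^^ m) G 0 / fact m" for m
  define t where "t m \<zeta> = indicator ?S \<zeta> * (\<kappa> \<zeta> * Re (a m * \<zeta> ^ m))" for m \<zeta>
  have B: "B \<ge> 0" using bdd[of 0] by (meson abs_ge_zero order_trans centre_in_cball zero_le_divide_1_iff zero_le_numeral)
  have [measurable]: "t m \<in> borel_measurable borel" for m
    unfolding t_def[abs_def]
    by (intro borel_measurable_times borel_measurable_indicator assms(3) borel_measurable_continuous_onI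
        continuous_intros) simp
  \<comment> \<open>Any radius strictly between \<open>1/2\<close> and \<open>1\<close> gives geometric convergence on the disc of radius \<open>1/2\<close>.\<close>
  have sub: "cball 0 (3/4) \<subseteq> ball (0::complex) 1" by auto
  have cont: "continuous_on (cball 0 (3/4)) G"
    using holomorphic_on_imp_continuous_on[OF G(1)] sub by (rule continuous_on_subset)
  then obtain C where C: "C > 0" "\<And>z. z \<in> cball 0 (3/4) \<Longrightarrow> cmod (G z) \<le> C"
    using compact_imp_bounded[OF compact_continuous_image[OF cont compact_cball]]
    by (auto simp: bounded_pos)
  have "cmod ((deriv ^^ m) G 0) \<le> fact m * C / (3/4) ^ m" for m
    by (rule Cauchy_inequality[OF holomorphic_on_subset[OF G(1)] cont]) (use C in auto)
  then have a: "cmod (a m) \<le> C / (3/4) ^ m" for m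
    unfolding a_def norm_divide by (simp add: field_simps)
  have t_le: "\<bar>t m \<zeta>\<bar> \<le> indicator ?S \<zeta> * (B * (C * (2/3) ^ m))" for m \<zeta>
  proof (cases "\<zeta> \<in> ?S")
    case True
    have "\<bar>Re (a m * \<zeta> ^ m)\<bar> \<le> cmod (a m) * cmod \<zeta> ^ m"
      using abs_Re_le_cmod[of "a m * \<zeta> ^ m"] by (simp add: norm_mult norm_power)
    also have "\<dots> \<le> (C / (3/4) ^ m) * (1/2) ^ m"
      using a[of m] True C by (intro mult_mono power_mono) auto
    also have "\<dots> = C * (2/3) ^ m" by (simp add: power_divide[symmetric] flip: power_mult_distrib)
        (simp add: power_divide power_mult_distrib[symmetric] field_simps)
    finally show ?thesis using True bdd[OF True] B by (auto simp: t_def abs_mult intro!: mult_mono)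
  qed (simp add: t_def)
  have intS: "integrable lborel (\<lambda>\<zeta>. indicator ?S \<zeta> * x)" for x :: real
    by (intro integrable_mult_left) (auto intro!: integrable_real_indicator emeasure_bounded_finite)
  have int: "integrable lborel (t m)" for m
    by (rule Bochner_Integration.integrable_bound[OF intS[of "B * (C * (2/3) ^ m)"]])
       (use t_le[of m] in \<open>auto simp: abs_mult B C(1) less_imp_le\<close>)
  have zero: "integral\<^sup>L lborel (t m) = 0" for m
  proof (cases "m = 0")
    case True
    have "t 0 = (\<lambda>_. 0)" using G(2) by (simp add: t_def a_def fun_eq_iff)
    then show ?thesis using True by simp
  next
    case False
    define u where "u = exp (\<i> * of_real (pi / m))"
    have u1: "cmod u = 1" by (simp add: u_def)
    have "of_nat m * (\<i> * of_real (pi / m)) = \<i> * complex_of_real pi" using False by simp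
    then have um: "u ^ m = - 1"
      unfolding u_def exp_of_nat_mult[symmetric] by (simp only: exp_pi_i')
    have im: "(*) u ` ?S = ?S"
    proof (intro equalityI subsetI)
      fix x assume "x \<in> ?S"
      then show "x \<in> (*) u ` ?S" using u1 by (intro image_eqI[of _ _ "x / u"]) (auto simp: norm_divide)
    qed (auto simp: norm_mult u1)
    have neg: "(\<lambda>\<zeta>. indicator ?S \<zeta> * ((cmod u)\<^sup>2 * (\<kappa> (u * \<zeta>) * Re (a m * (u * \<zeta>) ^ m)))) = (\<lambda>\<zeta>. - t m \<zeta>)"
    proof
      fix \<zeta>
      have "a m * (u * \<zeta>) ^ m = - (a m * \<zeta> ^ m)" by (simp add: power_mult_distrib um)
      then show "indicator ?S \<zeta> * ((cmod u)\<^sup>2 * (\<kappa> (u * \<zeta>) * Re (a m * (u * \<zeta>) ^ m))) = - t m \<zeta>"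
        unfolding t_def rot[OF u1] u1 by (simp only: uminus_complex.sel power_one mult_1_left mult_minus_right)
    qed
    have "integral\<^sup>L lborel (t m) = (\<integral>\<zeta>. indicator ((*) u ` ?S) \<zeta> * (\<kappa> \<zeta> * Re (a m * \<zeta> ^ m)) \<partial>lborel)"
      unfolding im t_def ..
    also have "\<dots> = (\<integral>\<zeta>. indicator ?S \<zeta> * ((cmod u)\<^sup>2 * (\<kappa> (u * \<zeta>) * Re (a m * (u * \<zeta>) ^ m))) \<partial>lborel)"
    proof (rule conformal_change_of_variables[symmetric, where g' = "\<lambda>_. u"])
      show "inj_on ((*) u) ?S" using u1 by (auto simp: inj_on_def)
      show "((*) u has_field_derivative u) (at z within ?S)" for z
        by (auto intro!: derivative_eq_intros)
      show "(\<lambda>z. indicator ((*) u ` ?S) z * (\<kappa> z * Re (a m * z ^ m))) \<in> borel_measurable borel"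
        unfolding im t_def[symmetric] by measurable
      show "(\<lambda>\<zeta>. indicator ?S \<zeta> * ((cmod u)\<^sup>2 * (\<kappa> (u * \<zeta>) * Re (a m * (u * \<zeta>) ^ m)))) \<in> borel_measurable borel"
        unfolding neg by measurable
    qed simp
    also have "\<dots> = (\<integral>\<zeta>. - t m \<zeta> \<partial>lborel)" unfolding neg ..
    also have "\<dots> = - integral\<^sup>L lborel (t m)" by simp
    finally show ?thesis by simp
  qed
  have sums: "(\<lambda>m. t m \<zeta>) sums (indicator ?S \<zeta> * (\<kappa> \<zeta> * Re (G \<zeta>)))" for \<zeta>
  proof (cases "\<zeta> \<in> ?S")
    case True
    then have "(\<lambda>m. a m * \<zeta> ^ m) sums G \<zeta>"
      using holomorphic_power_series[OF G(1), of \<zeta>] by (simp add: a_def)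
    then show ?thesis unfolding t_def by (intro sums_mult sums_Re)
  qed (simp add: t_def)
  have summ: "summable (\<lambda>m. \<bar>t m \<zeta>\<bar>)" for \<zeta>
    by (rule summable_comparison_test'[where N = 0 and g = "\<lambda>m. indicator ?S \<zeta> * (B * (C * (2/3) ^ m))"])
       (use t_le in \<open>auto intro!: summable_mult summable_geometric\<close>)
  have "summable (\<lambda>m. LINT \<zeta>|lborel. norm (t m \<zeta>))"
  proof (rule summable_comparison_test'[where N = 0 and g = "\<lambda>m. measure lborel ?S * (B * (C * (2/3) ^ m))"])
    fix m
    have "(LINT \<zeta>|lborel. norm (t m \<zeta>)) \<le> (LINT \<zeta>|lborel. indicator ?S \<zeta> * (B * (C * (2/3) ^ m)))"
      using int t_le intS by (intro integral_mono) auto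
    then show "norm (LINT \<zeta>|lborel. norm (t m \<zeta>)) \<le> measure lborel ?S * (B * (C * (2/3) ^ m))" by simp
  qed (auto intro!: summable_mult summable_geometric)
  then have "(LINT \<zeta>|lborel. suminf (\<lambda>m. t m \<zeta>)) = suminf (\<lambda>m. integral\<^sup>L lborel (t m))"
    using summ int by (intro integral_suminf) auto
  then show ?thesis using sums_unique[OF sums] zero by simp
qed

text \<open>Hyperbolic distance at most \<open>artanh(1/2) * 2\<close>: with \<open>\<delta> = |z - w| / |z - cnj w|\<close> and
\<open>|z - cnj w|\<^sup>2 = |z - w|\<^sup>2 + 4 Im z Im w\<close>, the condition is \<open>\<delta> \<le> 1/2\<close>. The form below makes
symmetry and invariance evident.\<close>

definition hyp_near :: "complex \<Rightarrow> complex \<Rightarrow> bool" where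
  "hyp_near z w \<longleftrightarrow> z \<in> uhp \<and> w \<in> uhp \<and> (cmod (z - w))\<^sup>2 \<le> 4 / 3 * (Im z * Im w)"

lemma hyp_near_sym: "hyp_near z w \<longleftrightarrow> hyp_near w z"
  by (auto simp: hyp_near_def norm_minus_commute mult.commute)

text \<open>A hyperbolic disc about a point of a compact set stays in a compact set. The first two bounds are the two roots
of the quadratic inequality \<open>(Im z - Im w)\<^sup>2 \<le> 4/3 Im z Im w\<close>.\<close>

lemma hyp_near_bounds:
  assumes "hyp_near z w"
  shows "Im w \<le> 3 * Im z" "Im z \<le> 3 * Im w" "cmod (z - w) \<le> 2 * Im w"
proof -
  have p: "Im z > 0" "Im w > 0" and le: "(cmod (z - w))\<^sup>2 \<le> 4 / 3 * (Im z * Im w)"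
    using assms by (auto simp: hyp_near_def uhp_iff)
  have "(Im z - Im w)\<^sup>2 \<le> (cmod (z - w))\<^sup>2"
    by (simp add: cmod_power2)
  with le have "(Im z - Im w)\<^sup>2 \<le> 4 / 3 * (Im z * Im w)" by simp
  then have "(3 * Im z - Im w) * (Im z - 3 * Im w) \<le> 0"
    by (simp add: power2_eq_square algebra_simps)
  then have "(3 * Im z - Im w \<ge> 0 \<and> Im z - 3 * Im w \<le> 0) \<or> (3 * Im z - Im w \<le> 0 \<and> Im z - 3 * Im w \<ge> 0)"
    by (auto simp: mult_le_0_iff)
  then show 1: "Im w \<le> 3 * Im z" and 2: "Im z \<le> 3 * Im w" using p by auto
  have "4 / 3 * (Im z * Im w) \<le> 4 / 3 * (3 * Im w * Im w)" using 2 p by (intro mult_left_mono mult_right_mono) auto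
  also have "\<dots> = (2 * Im w)\<^sup>2" by (simp add: power2_eq_square)
  finally have "(cmod (z - w))\<^sup>2 \<le> (2 * Im w)\<^sup>2" using le by (rule order_trans[rotated])
  then show "cmod (z - w) \<le> 2 * Im w" by (rule power2_le_imp_le) (use p in simp)
qed

lemma cmod_moebius_diff:
  assumes "det \<gamma> = 1" "z \<in> uhp" "w \<in> uhp"
  shows "cmod (moebius_action \<gamma> z - moebius_action \<gamma> w) = cmod (z - w) / (cmod (aut_factor \<gamma> z) * cmod (aut_factor \<gamma> w))"
proof -
  let ?a = "complex_of_real (entry \<gamma> 1 1)" and ?b = "complex_of_real (entry \<gamma> 1 2)"
  let ?c = "complex_of_real (entry \<gamma> 2 1)" and ?d = "complex_of_real (entry \<gamma> 2 2)"
  have nz: "aut_factor \<gamma> z \<noteq> 0" "aut_factor \<gamma> w \<noteq> 0" using aut_factor_nonzero assms by auto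
  have "?a * ?d - ?b * ?c = of_real (det \<gamma>)" by (simp add: det_2)
  then have det: "?a * ?d - ?b * ?c = 1" using assms(1) by simp
  have "(?a * z + ?b) * aut_factor \<gamma> w - (?a * w + ?b) * aut_factor \<gamma> z = (?a * ?d - ?b * ?c) * (z - w)"
    by (simp add: aut_factor_def algebra_simps)
  then have "moebius_action \<gamma> z - moebius_action \<gamma> w = (z - w) / (aut_factor \<gamma> z * aut_factor \<gamma> w)"
    using nz det by (simp add: moebius_action_eq field_simps)
  then show ?thesis by (simp add: norm_divide norm_mult)
qed

lemma hyp_near_moebius:
  assumes "det \<gamma> = 1" "z \<in> uhp" "w \<in> uhp"
  shows "hyp_near (moebius_action \<gamma> z) (moebius_action \<gamma> w) \<longleftrightarrow> hyp_near z w"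
proof -
  have nz: "cmod (aut_factor \<gamma> z) > 0" "cmod (aut_factor \<gamma> w) > 0" using aut_factor_nonzero assms by auto
  show ?thesis
    using assms nz unfolding hyp_near_def
    by (simp add: moebius_action_in_uhp cmod_moebius_diff Im_moebius_action power_divide power_mult_distrib divide_le_cancel
        flip: times_divide_eq_right)
       (simp add: field_simps)
qed

text \<open>For \<open>w\<close> in the half-plane, a conformal map from the unit disc onto the half-plane which sends \<open>0\<close> to \<open>w\<close>.\<close>

definition cayley :: "complex \<Rightarrow> complex \<Rightarrow> complex" where
  "cayley w \<zeta> = (w - cnj w * \<zeta>) / (1 - \<zeta>)"

lemma Im_cayley: "cmod \<zeta> < 1 \<Longrightarrow> Im (cayley w \<zeta>) = Im w * (1 - (cmod \<zeta>)\<^sup>2) / (cmod (1 - \<zeta>))\<^sup>2"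
  unfolding cayley_def Im_divide cmod_power2
  by (simp add: power2_eq_square algebra_simps)

lemma one_minus_nonzero: "cmod \<zeta> < 1 \<Longrightarrow> 1 - \<zeta> \<noteq> 0"
  by auto

lemma cayley_diff: "cmod \<zeta> < 1 \<Longrightarrow> cayley w \<zeta> - w = (w - cnj w) * \<zeta> / (1 - \<zeta>)"
  using one_minus_nonzero[of \<zeta>] by (simp add: cayley_def field_simps)

lemma cayley_has_derivative:
  assumes "cmod \<zeta> < 1"
  shows "(cayley w has_field_derivative (w - cnj w) / (1 - \<zeta>)\<^sup>2) (at \<zeta> within S)"
  unfolding cayley_def[abs_def] using one_minus_nonzero[OF assms]
  by (auto intro!: derivative_eq_intros simp: power2_eq_square field_simps)

lemma cmod_w_minus_cnj: "cmod (w - cnj w) = 2 * \<bar>Im w\<bar>"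
  by (simp add: complex_diff_cnj norm_mult)

lemma cayley_in_uhp:
  assumes "cmod \<zeta> < 1" "w \<in> uhp" shows "cayley w \<zeta> \<in> uhp"
proof -
  have "(cmod \<zeta>)\<^sup>2 < 1" using assms(1) by (simp add: power_less_one_iff)
  then show ?thesis using assms one_minus_nonzero[OF assms(1)] by (simp add: uhp_iff Im_cayley)
qed

lemma cayley_inj: assumes "w \<in> uhp" shows "inj_on (cayley w) (ball 0 1)"
proof (rule inj_onI)
  fix x y assume "x \<in> ball 0 1" "y \<in> ball 0 1" and eq: "cayley w x = cayley w y"
  then have nz: "1 - x \<noteq> 0" "1 - y \<noteq> 0" by auto
  have "(w - cnj w * x) * (1 - y) = (w - cnj w * y) * (1 - x)"
    using eq nz by (simp add: cayley_def field_simps)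
  then have "(w - cnj w) * (x - y) = 0" by (simp add: algebra_simps)
  moreover have "w - cnj w \<noteq> 0" using assms by (auto simp: uhp_iff complex_eq_iff)
  ultimately show "x = y" by simp
qed

lemma cayley_image:
  assumes w: "w \<in> uhp"
  shows "cayley w ` cball 0 (1/2) = {z. hyp_near z w}"
proof (intro equalityI subsetI)
  fix z assume "z \<in> cayley w ` cball 0 (1/2)"
  then obtain \<zeta> where z: "z = cayley w \<zeta>" and "cmod \<zeta> \<le> 1/2" by auto
  then have l: "cmod \<zeta> < 1" and "(cmod \<zeta>)\<^sup>2 \<le> (1/2)\<^sup>2" by (auto intro: power_mono)
  have nz: "(cmod (1 - \<zeta>))\<^sup>2 > 0" using one_minus_nonzero[OF l] by simp
  have w0: "Im w > 0" using w by (simp add: uhp_iff)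
  have "(cmod (z - w))\<^sup>2 = 4 * (Im w)\<^sup>2 * (cmod \<zeta>)\<^sup>2 / (cmod (1 - \<zeta>))\<^sup>2"
    unfolding z cayley_diff[OF l] norm_divide norm_mult cmod_w_minus_cnj
    by (simp add: power_divide power_mult_distrib)
  also have "\<dots> \<le> (4 / 3 * (Im w)\<^sup>2 * (1 - (cmod \<zeta>)\<^sup>2)) / (cmod (1 - \<zeta>))\<^sup>2"
  proof (rule divide_right_mono)
    have "4 * (cmod \<zeta>)\<^sup>2 \<le> 4 / 3 * (1 - (cmod \<zeta>)\<^sup>2)" using \<open>(cmod \<zeta>)\<^sup>2 \<le> (1/2)\<^sup>2\<close> by (simp add: power2_eq_square)
    then have "(Im w)\<^sup>2 * (4 * (cmod \<zeta>)\<^sup>2) \<le> (Im w)\<^sup>2 * (4 / 3 * (1 - (cmod \<zeta>)\<^sup>2))" by (intro mult_left_mono) auto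
    then show "4 * (Im w)\<^sup>2 * (cmod \<zeta>)\<^sup>2 \<le> 4 / 3 * (Im w)\<^sup>2 * (1 - (cmod \<zeta>)\<^sup>2)" by (simp add: algebra_simps)
  qed simp
  also have "\<dots> = 4 / 3 * (Im z * Im w)"
    unfolding z Im_cayley[OF l] by (simp add: power2_eq_square)
  finally show "z \<in> {z. hyp_near z w}" using w cayley_in_uhp[OF l w] by (simp add: hyp_near_def z)
next
  fix z assume "z \<in> {z. hyp_near z w}"
  then have z: "z \<in> uhp" and le: "(cmod (z - w))\<^sup>2 \<le> 4 / 3 * (Im z * Im w)" by (auto simp: hyp_near_def)
  have p: "Im z > 0" "Im w > 0" using z w by (auto simp: uhp_iff)
  have nz: "z - cnj w \<noteq> 0" using p by (auto simp: complex_eq_iff)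
  define \<zeta> where "\<zeta> = (z - w) / (z - cnj w)"
  have "(cmod (z - cnj w))\<^sup>2 = (cmod (z - w))\<^sup>2 + 4 * (Im z * Im w)"
    unfolding cmod_power2 by (simp add: power2_eq_square algebra_simps)
  then have "(cmod (z - w))\<^sup>2 \<le> (1/2 * cmod (z - cnj w))\<^sup>2" using le by (simp add: power_mult_distrib power2_eq_square)
  then have "cmod (z - w) \<le> 1/2 * cmod (z - cnj w)" by (rule power2_le_imp_le) simp
  then have \<zeta>: "cmod \<zeta> \<le> 1/2" using nz by (simp add: \<zeta>_def norm_divide field_simps)
  have w1: "w - cnj w \<noteq> 0" using p by (auto simp: complex_eq_iff)
  have "1 - \<zeta> = (w - cnj w) / (z - cnj w)" using nz by (simp add: \<zeta>_def field_simps)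
  moreover have "w - cnj w * \<zeta> = z * (w - cnj w) / (z - cnj w)"
    using nz by (simp add: \<zeta>_def field_simps)
  ultimately have "cayley w \<zeta> = z" using nz w1 by (simp add: cayley_def)
  then show "z \<in> cayley w ` cball 0 (1/2)" using \<zeta> by (intro image_eqI[of _ _ \<zeta>]) auto
qed

text \<open>The density \<open>4 / (1 - |\<zeta>|\<^sup>2)\<^sup>2\<close> is that of hyperbolic area in the disc model, where \<open>ln Im\<close> becomes
\<open>ln(1 - |\<zeta>|\<^sup>2)\<close> up to a harmonic function. So this is what the area integral of \<open>ln Im\<close> over a
hyperbolic disc loses against its value at the centre.\<close>

definition disc_defect :: real where
  "disc_defect = - (\<integral>\<zeta>. indicator (cball 0 (1/2)) \<zeta> * (4 / (1 - (cmod \<zeta>)\<^sup>2)\<^sup>2 * ln (1 - (cmod \<zeta>)\<^sup>2)) \<partial>lborel)"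

lemma cmod_sq_half: "\<zeta> \<in> cball 0 (1/2) \<Longrightarrow> (cmod \<zeta>)\<^sup>2 \<le> 1/4"
  using power_mono[of "cmod \<zeta>" "1/2" 2] by (simp add: power2_eq_square)

lemma integrable_disc_log:
  "integrable lborel (\<lambda>\<zeta>. indicator (cball 0 (1/2)) \<zeta> * (4 / (1 - (cmod \<zeta>)\<^sup>2)\<^sup>2 * ln (1 - (cmod \<zeta>)\<^sup>2)))"
proof -
  have "continuous_on (cball 0 (1/2)) (\<lambda>\<zeta>::complex. 4 / (1 - (cmod \<zeta>)\<^sup>2)\<^sup>2 * ln (1 - (cmod \<zeta>)\<^sup>2))"
    by (intro continuous_intros) (auto dest: cmod_sq_half)
  from borel_integrable_compact[OF compact_cball this] show ?thesis by simp
qed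

lemma disc_defect_pos: "disc_defect > 0"
proof -
  let ?f = "\<lambda>\<zeta>::complex. indicator (cball 0 (1/2)) \<zeta> * (4 / (1 - (cmod \<zeta>)\<^sup>2)\<^sup>2 * ln (1 - (cmod \<zeta>)\<^sup>2))"
  \<comment> \<open>A ball inside the disc which stays away from \<open>0\<close>, where the integrand vanishes.\<close>
  let ?B = "ball (3/8 :: complex) (1/8)"
  have "measure lborel ?B * (1/4) = (\<integral>\<zeta>. indicator ?B \<zeta> * (1/4) \<partial>lborel)" by simp
  also have "\<dots> \<le> (\<integral>\<zeta>. - ?f \<zeta> \<partial>lborel)"
  proof (intro integral_mono)
    show "integrable lborel (\<lambda>\<zeta>::complex. indicator ?B \<zeta> * (1/4::real))"
      by (intro integrable_mult_left) (auto intro!: integrable_real_indicator emeasure_bounded_finite)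
    show "integrable lborel (\<lambda>\<zeta>. - ?f \<zeta>)" using integrable_disc_log by simp
    fix \<zeta> :: complex
    show "indicator ?B \<zeta> * (1/4) \<le> - ?f \<zeta>"
    proof (cases "\<zeta> \<in> cball 0 (1/2)")
      case True
      define s where "s = (cmod \<zeta>)\<^sup>2"
      have s: "0 \<le> s" "s \<le> 1/4" using cmod_sq_half[OF True] by (auto simp: s_def)
      have "s \<le> - ln (1 - s)" using ln_le_minus_one[of "1 - s"] s by simp
      moreover have "4 \<le> 4 / (1 - s)\<^sup>2" using s power_le_one[of "1 - s" 2] by (simp add: pos_le_divide_eq)
      ultimately have "4 * s \<le> 4 / (1 - s)\<^sup>2 * (- ln (1 - s))" using s by (intro mult_mono) auto
      moreover have "indicator ?B \<zeta> * (1/4) \<le> 4 * s"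
      proof (cases "\<zeta> \<in> ?B")
        case True
        have "3/8 = cmod (3/8)" by simp
        also have "\<dots> \<le> cmod (3/8 - \<zeta>) + cmod \<zeta>" using norm_triangle_sub[of "3/8" \<zeta>] by (simp add: add.commute)
        finally have "1/4 \<le> cmod \<zeta>" using True by (simp add: dist_norm)
        then have "(1/4)\<^sup>2 \<le> s" unfolding s_def by (intro power_mono) auto
        moreover have "indicator ?B \<zeta> = (1::real)" using True by (simp only: indicator_simps)
        ultimately show ?thesis by (simp add: power2_eq_square)
      qed (use s in simp)
      ultimately show ?thesis using True by (simp add: s_def)
    next
      case False
      moreover have "\<zeta> \<notin> ?B"
      proof
        assume "\<zeta> \<in> ?B"
        then have "cmod (\<zeta> - 3/8) < 1/8" by (simp add: dist_norm norm_minus_commute)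
        then have "cmod \<zeta> < 1/8 + 3/8" using norm_triangle_sub[of \<zeta> "3/8"] by simp
        with False show False by simp
      qed
      ultimately show ?thesis by simp
    qed
  qed
  also have "\<dots> = disc_defect" by (simp add: disc_defect_def)
  finally have "measure lborel ?B * (1/4) \<le> disc_defect" .
  moreover have "measure lborel ?B > 0" by (rule content_ball_pos) simp
  ultimately show ?thesis by linarith
qed

text \<open>In the disc model about \<open>w\<close> the function \<open>ln Im + Re P\<close> minus its value at \<open>w\<close> equals \<open>ln(1 - |\<zeta>|\<^sup>2)\<close> plus the real part of
a holomorphic function that vanishes at \<open>0\<close>. The second summand integrates to zero and the first does not depend on \<open>w\<close> or \<open>P\<close>.\<close>

lemma integral_near_superharmonic:
  assumes P: "P holomorphic_on uhp" and w: "w \<in> uhp"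
  shows "(\<integral>z. indicator {z. hyp_near z w} z * ((ln (Im z) + Re (P z)) - (ln (Im w) + Re (P w))) \<partial>hyp_area) = - disc_defect"
proof -
  let ?S = "cball (0::complex) (1/2)"
  let ?\<phi> = "\<lambda>z. ln (Im z) + Re (P z)"
  let ?\<kappa> = "\<lambda>\<zeta>. 4 / (1 - (cmod \<zeta>)\<^sup>2)\<^sup>2"
  let ?g' = "\<lambda>\<zeta>. (w - cnj w) / (1 - \<zeta>)\<^sup>2"
  \<comment> \<open>The logarithm is the harmonic part of \<open>ln Im\<close> in the disc model.\<close>
  define G where "G \<zeta> = P (cayley w \<zeta>) - P w - 2 * Ln (1 - \<zeta>)" for \<zeta>
  have w0: "Im w > 0" using w by (simp add: uhp_iff)
  have sub: "?S \<subseteq> ball 0 1" by auto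
  have hol_c: "cayley w holomorphic_on ball 0 1"
    unfolding holomorphic_on_def field_differentiable_def by (auto intro!: exI cayley_has_derivative)
  have "1 - \<zeta> \<notin> \<real>\<^sub>\<le>\<^sub>0" if "\<zeta> \<in> ball 0 1" for \<zeta> :: complex
    using that abs_Re_le_cmod[of \<zeta>] by (auto simp: complex_nonpos_Reals_iff)
  then have G: "G holomorphic_on ball 0 1"
    unfolding G_def using w cayley_in_uhp
    by (intro holomorphic_intros holomorphic_on_compose_gen[OF hol_c P, unfolded o_def]) auto
  have G0: "G 0 = 0" by (simp add: G_def cayley_def)
  have near_eq: "{z. hyp_near z w} = cayley w ` ?S" using cayley_image[OF w] by simp
  have cont_c: "continuous_on ?S (cayley w)"
    using holomorphic_on_imp_continuous_on[OF hol_c] sub by (rule continuous_on_subset)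
  have comp: "compact (cayley w ` ?S)" using cont_c by (intro compact_continuous_image) auto
  have im_uhp: "cayley w ` ?S \<subseteq> uhp" using cayley_in_uhp w by auto
  have cont_P: "continuous_on (cayley w ` ?S) P"
    using holomorphic_on_imp_continuous_on[OF P] im_uhp by (rule continuous_on_subset)
  have b: "cayley w ` ?S \<in> sets borel" using comp by (simp add: compact_imp_closed)
  have cont1: "continuous_on (cayley w ` ?S) (\<lambda>z. ?\<phi> z - ?\<phi> w)"
    using im_uhp by (intro continuous_intros cont_P) (auto simp: uhp_iff)
  have cont2: "continuous_on (cayley w ` ?S) (\<lambda>z. (?\<phi> z - ?\<phi> w) / (Im z)\<^sup>2)"
    using im_uhp by (intro continuous_intros cont_P) (auto simp: uhp_iff)
  have m1: "(\<lambda>z. indicator (cayley w ` ?S) z * (?\<phi> z - ?\<phi> w)) \<in> borel_measurable borel"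
    using borel_measurable_continuous_on_indicator[OF b cont1] by simp
  have m2: "(\<lambda>z. indicator (cayley w ` ?S) z * ((?\<phi> z - ?\<phi> w) / (Im z)\<^sup>2)) \<in> borel_measurable borel"
    using borel_measurable_continuous_on_indicator[OF b cont2] by simp
  have pt: "indicator ?S \<zeta> * ((cmod (?g' \<zeta>))\<^sup>2 * ((?\<phi> (cayley w \<zeta>) - ?\<phi> w) / (Im (cayley w \<zeta>))\<^sup>2))
     = indicator ?S \<zeta> * (?\<kappa> \<zeta> * ln (1 - (cmod \<zeta>)\<^sup>2)) + indicator ?S \<zeta> * (?\<kappa> \<zeta> * Re (G \<zeta>))" for \<zeta>
  proof (cases "\<zeta> \<in> ?S")
    case True
    then have l: "cmod \<zeta> < 1" by auto
    define s where "s = 1 - (cmod \<zeta>)\<^sup>2"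
    define q where "q = cmod (1 - \<zeta>)"
    have s: "s > 0" using cmod_sq_half[OF True] by (simp add: s_def)
    have q: "q > 0" using one_minus_nonzero[OF l] by (simp add: q_def)
    have im: "Im (cayley w \<zeta>) = Im w * s / q\<^sup>2" using Im_cayley[OF l] by (simp add: s_def q_def)
    have "ln (Im (cayley w \<zeta>)) = ln (Im w) + ln s - 2 * ln q"
      unfolding im using w0 s q by (simp add: ln_mult ln_div ln_realpow)
    moreover have "Re (Ln (1 - \<zeta>)) = ln q" using one_minus_nonzero[OF l] by (simp add: q_def)
    ultimately have *: "?\<phi> (cayley w \<zeta>) - ?\<phi> w = ln s + Re (G \<zeta>)" by (simp add: G_def)
    have g': "cmod (?g' \<zeta>) = 2 * Im w / q\<^sup>2"
      using w0 by (simp only: norm_divide norm_power cmod_w_minus_cnj q_def abs_of_pos)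
    have "(cmod (?g' \<zeta>))\<^sup>2 / (Im (cayley w \<zeta>))\<^sup>2 = 4 / s\<^sup>2"
      unfolding im g' using w0 s q by (simp add: power_divide power_mult_distrib field_simps)
    then have "(cmod (?g' \<zeta>))\<^sup>2 * ((?\<phi> (cayley w \<zeta>) - ?\<phi> w) / (Im (cayley w \<zeta>))\<^sup>2) = 4 / s\<^sup>2 * (ln s + Re (G \<zeta>))"
      unfolding * by (metis (no_types, lifting) times_divide_eq_left times_divide_eq_right)
    then show ?thesis unfolding s_def[symmetric] by (simp only: distrib_left)
  qed simp
  have bddk: "\<bar>?\<kappa> \<zeta>\<bar> \<le> 8" if "\<zeta> \<in> ?S" for \<zeta>
  proof -
    have "3/4 \<le> 1 - (cmod \<zeta>)\<^sup>2" using cmod_sq_half[OF that] by simp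
    then have "(3/4)\<^sup>2 \<le> (1 - (cmod \<zeta>)\<^sup>2)\<^sup>2" by (intro power_mono) auto
    then have "1/2 \<le> (1 - (cmod \<zeta>)\<^sup>2)\<^sup>2" by (simp add: power2_eq_square)
    then show ?thesis by (simp add: divide_le_eq)
  qed
  have intG: "integrable lborel (\<lambda>\<zeta>. indicator ?S \<zeta> * (?\<kappa> \<zeta> * Re (G \<zeta>)))"
  proof -
    have "continuous_on ?S (\<lambda>\<zeta>. ?\<kappa> \<zeta> * Re (G \<zeta>))"
      by (intro continuous_intros continuous_on_subset[OF holomorphic_on_imp_continuous_on[OF G] sub])
         (auto dest: cmod_sq_half)
    from borel_integrable_compact[OF compact_cball this] show ?thesis by simp
  qed
  have zero: "(\<integral>\<zeta>. indicator ?S \<zeta> * (?\<kappa> \<zeta> * Re (G \<zeta>)) \<partial>lborel) = 0"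
    by (rule integral_radial_times_harmonic[OF G G0 _ _ bddk]) (auto simp: norm_mult)
  have "(\<integral>z. indicator {z. hyp_near z w} z * (?\<phi> z - ?\<phi> w) \<partial>hyp_area)
      = (\<integral>z. indicator uhp z * (indicator (cayley w ` ?S) z * (?\<phi> z - ?\<phi> w) / (Im z)\<^sup>2) \<partial>lborel)"
    unfolding near_eq using m1 by (rule integral_hyp)
  also have "\<dots> = (\<integral>z. indicator (cayley w ` ?S) z * ((?\<phi> z - ?\<phi> w) / (Im z)\<^sup>2) \<partial>lborel)"
    using im_uhp by (intro Bochner_Integration.integral_cong) (auto simp: indicator_def)
  also have "\<dots> = (\<integral>\<zeta>. indicator ?S \<zeta> * ((cmod (?g' \<zeta>))\<^sup>2 * ((?\<phi> (cayley w \<zeta>) - ?\<phi> w) / (Im (cayley w \<zeta>))\<^sup>2)) \<partial>lborel)"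
  proof (rule conformal_change_of_variables[symmetric, OF _ _ _ m2])
    show "inj_on (cayley w) ?S" using cayley_inj[OF w] sub by (rule inj_on_subset)
    show "(cayley w has_field_derivative ?g' \<zeta>) (at \<zeta> within ?S)" if "\<zeta> \<in> ?S" for \<zeta>
      using that by (intro cayley_has_derivative) auto
    show "(\<lambda>\<zeta>. indicator ?S \<zeta> * ((cmod (?g' \<zeta>))\<^sup>2 * ((?\<phi> (cayley w \<zeta>) - ?\<phi> w) / (Im (cayley w \<zeta>))\<^sup>2))) \<in> borel_measurable borel"
      unfolding pt using integrable_disc_log intG by (auto dest!: borel_measurable_integrable)
  qed simp
  also have "\<dots> = - disc_defect"
    unfolding pt using integrable_disc_log intG zero by (simp add: disc_defect_def)
  finally show ?thesis .
qed

section \<open>The affine transformation law of weight two\<close>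

lemma integral_hyp_cong:
  fixes f g :: "complex \<Rightarrow> real"
  assumes "f \<in> borel_measurable borel" "g \<in> borel_measurable borel" "\<And>z. z \<in> uhp \<Longrightarrow> f z = g z"
  shows "integral\<^sup>L hyp_area f = integral\<^sup>L hyp_area g"
  using assms by (simp add: integral_hyp) (auto intro!: Bochner_Integration.integral_cong simp: indicator_def)

context cocompact_fuchsian_group
begin

text \<open>An invariant kernel may be integrated with the first variable in a fundamental domain and the second one in the
whole half-plane, or the other way round. Antisymmetry therefore makes the double integral zero; yet it equals \<open>c\<close> times the area
of the quotient.

Integration over the quotient is written as integration against a function \<open>\<rho>\<close> of compact
support whose translates add up to \<open>1\<close> (on the compact set that matters). Such a \<open>\<rho>\<close> is the indicator of a compact fundamental
set \<open>K\<close> divided by the number of group elements that map the point into \<open>K\<close>.\<close>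

lemma antisymmetric_kernel_integral_zero:
  fixes D :: "complex \<Rightarrow> complex \<Rightarrow> real"
  assumes meas [measurable]: "case_prod D \<in> borel_measurable (borel \<Otimes>\<^sub>M borel)"
    and anti: "\<And>z w. D w z = - D z w"
    and inv: "\<And>\<gamma> z w. \<gamma> \<in> G \<Longrightarrow> z \<in> uhp \<Longrightarrow> w \<in> uhp \<Longrightarrow> D (moebius_action \<gamma> z) (moebius_action \<gamma> w) = D z w"
    and supp: "\<And>z w. \<not> hyp_near z w \<Longrightarrow> D z w = 0"
    and bdd: "\<And>K. compact K \<Longrightarrow> K \<subseteq> uhp \<Longrightarrow> \<exists>B. \<forall>z\<in>K. \<forall>w\<in>K. \<bar>D z w\<bar> \<le> B"
    and int: "\<And>w. w \<in> uhp \<Longrightarrow> (\<integral>z. D z w \<partial>hyp_area) = c"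
  shows "c = 0"
proof -
  interpret hyp_area: sigma_finite_measure hyp_area by (rule sigma_finite_hyp)
  interpret P: pair_sigma_finite hyp_area hyp_area by unfold_locales
  obtain K0 where K0: "compact K0" "K0 \<subseteq> uhp" "\<And>\<tau>. \<tau> \<in> uhp \<Longrightarrow> \<exists>\<gamma>\<in>G. moebius_action \<gamma> \<tau> \<in> K0"
    using compact_fundamental_set by blast
  have cb: "cball \<i> (1/2) \<subseteq> uhp"
  proof
    fix z assume "z \<in> cball \<i> (1/2)"
    then have "\<bar>Im (\<i> - z)\<bar> \<le> 1/2" using abs_Im_le_cmod[of "\<i> - z"] by (simp add: dist_norm)
    then have "Im (\<i> - z) \<le> 1/2" using abs_le_D1 by blast
    then show "z \<in> uhp" by (simp add: uhp_iff)
  qed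
  \<comment> \<open>The additional disc guarantees that the fundamental set has positive area.\<close>
  define K where "K = K0 \<union> cball \<i> (1/2)"
  have K: "compact K" "K \<subseteq> uhp" "\<And>\<tau>. \<tau> \<in> uhp \<Longrightarrow> \<exists>\<gamma>\<in>G. moebius_action \<gamma> \<tau> \<in> K" "K \<noteq> {}"
    unfolding K_def using K0 cb by (auto, blast)
  have [measurable]: "K \<in> sets borel" using K by (simp add: compact_imp_closed)
  have "continuous_on K Im" by (intro continuous_intros)
  then obtain z0 where z0: "z0 \<in> K" "\<And>z. z \<in> K \<Longrightarrow> Im z0 \<le> Im z"
    using continuous_attains_inf[OF K(1,4)] by blast
  define m where "m = Im z0"
  have m: "m > 0" "\<And>z. z \<in> K \<Longrightarrow> m \<le> Im z" using z0 K(2) by (auto simp: m_def uhp_iff)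
  obtain R where R: "R > 0" "\<And>z. z \<in> K \<Longrightarrow> cmod z \<le> R"
    using compact_imp_bounded[OF K(1)] by (auto simp: bounded_pos)
  \<comment> \<open>Large enough to contain every point near a point of \<open>K\<close>.\<close>
  define K' where "K' = {z. m / 3 \<le> Im z} \<inter> cball 0 (3 * R)"
  have K': "compact K'" "K' \<subseteq> uhp"
    using m closed_Int_compact[OF closed_halfspace_Im_ge compact_cball] by (auto simp only: K'_def) (simp add: uhp_iff)
  have [measurable]: "K' \<in> sets borel" using K' by (simp add: compact_imp_closed)
  have KK': "K \<subseteq> K'"
  proof
    fix z assume "z \<in> K"
    with m(1) m(2)[of z] R(1) R(2)[of z] show "z \<in> K'" by (auto simp: K'_def)
  qed
  have nearK: "z \<in> K'" if "hyp_near z w" "w \<in> K" for z w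
  proof -
    have "cmod z \<le> cmod w + cmod (z - w)" by (rule norm_triangle_sub)
    also have "\<dots> \<le> 3 * R" using hyp_near_bounds(3)[OF that(1)] R(2)[OF that(2)] abs_Im_le_cmod[of w] by simp
    finally show ?thesis using hyp_near_bounds(1)[OF that(1)] m(2)[OF that(2)] by (simp add: K'_def)
  qed
  \<comment> \<open>The finitely many group elements that can contribute to the integrals below.\<close>
  define G0 where "G0 = {\<gamma> \<in> G. \<exists>z\<in>K'. moebius_action \<gamma> z \<in> K'}"
  have fin: "finite G0" unfolding G0_def by (rule finite_returns[OF K'])
  have G0: "\<gamma> \<in> G" "det \<gamma> = 1" if "\<gamma> \<in> G0" for \<gamma> using that det_one by (auto simp: G0_def)
  have G0I: "\<gamma> \<in> G0" if "\<gamma> \<in> G" "z \<in> K'" "moebius_action \<gamma> z \<in> K'" for \<gamma> z using that by (auto simp: G0_def)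
  have G0_adj: "adj2 \<gamma> \<in> G0" if "\<gamma> \<in> G0" for \<gamma>
  proof -
    obtain z where z: "z \<in> K'" "moebius_action \<gamma> z \<in> K'" using \<open>\<gamma> \<in> G0\<close> by (auto simp: G0_def)
    then show ?thesis using G0[OF that] K'(2)
      by (intro G0I[of _ "moebius_action \<gamma> z"]) (auto simp: adj2_in moebius_action_adj2)
  qed
  define N where "N z = (\<Sum>\<gamma>\<in>G0. indicator K (moebius_action \<gamma> z) :: real)" for z
  define \<rho> where "\<rho> z = indicator K z / N z" for z
  have [measurable]: "N \<in> borel_measurable borel" unfolding N_def[abs_def] by measurable
  have [measurable]: "\<rho> \<in> borel_measurable borel" unfolding \<rho>_def[abs_def] by measurable
  have N_card: "N z = card {\<gamma> \<in> G. moebius_action \<gamma> z \<in> K}" if "z \<in> K'" for z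
  proof -
    have "{\<gamma> \<in> G. moebius_action \<gamma> z \<in> K} = {\<gamma> \<in> G0. moebius_action \<gamma> z \<in> K}"
      using that KK' by (auto simp: G0_def)
    then show ?thesis using fin by (simp add: N_def indicator_def sum.If_cases Int_def)
  qed
  have N_ge: "N z \<ge> 1" if z: "z \<in> K'" for z
  proof -
    obtain \<gamma> where \<gamma>: "\<gamma> \<in> G" "moebius_action \<gamma> z \<in> K" using K(3) z K'(2) by blast
    then have "\<gamma> \<in> G0" using z KK' G0I by blast
    then have "indicator K (moebius_action \<gamma> z) \<le> N z"
      unfolding N_def using fin by (intro member_le_sum) auto
    then show ?thesis using \<gamma> by simp
  qed
  have N_inv: "N (moebius_action \<gamma> z) = N z" if "z \<in> K'" "\<gamma> \<in> G" "moebius_action \<gamma> z \<in> K'" for z \<gamma>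
  proof -
    have z: "z \<in> uhp" using that K'(2) by blast
    have "bij_betw (\<lambda>\<delta>. \<delta> ** \<gamma>) {\<delta> \<in> G. moebius_action \<delta> (moebius_action \<gamma> z) \<in> K} {\<delta> \<in> G. moebius_action \<delta> z \<in> K}"
    proof (rule bij_betw_byWitness[where f' = "\<lambda>\<delta>. \<delta> ** adj2 \<gamma>"])
      show "\<forall>\<delta>\<in>{\<delta> \<in> G. moebius_action \<delta> (moebius_action \<gamma> z) \<in> K}. \<delta> ** \<gamma> ** adj2 \<gamma> = \<delta>"
        "\<forall>\<delta>\<in>{\<delta> \<in> G. moebius_action \<delta> z \<in> K}. \<delta> ** adj2 \<gamma> ** \<gamma> = \<delta>"
        using that(2) det_one by (auto simp: adj2_mult simp flip: matrix_mul_assoc)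
      show "(\<lambda>\<delta>. \<delta> ** \<gamma>) ` {\<delta> \<in> G. moebius_action \<delta> (moebius_action \<gamma> z) \<in> K} \<subseteq> {\<delta> \<in> G. moebius_action \<delta> z \<in> K}"
        using that(2) z by (auto simp: moebius_action_mult det_one mult_in)
      show "(\<lambda>\<delta>. \<delta> ** adj2 \<gamma>) ` {\<delta> \<in> G. moebius_action \<delta> z \<in> K} \<subseteq> {\<delta> \<in> G. moebius_action \<delta> (moebius_action \<gamma> z) \<in> K}"
        using that(2) z by (auto simp: moebius_action_mult det_one mult_in adj2_in moebius_action_in_uhp moebius_action_adj2)
    qed
    then show ?thesis unfolding N_card[OF that(1)] N_card[OF that(3)] by (simp add: bij_betw_same_card)
  qed
  have \<rho>_sum: "(\<Sum>\<gamma>\<in>G0. \<rho> (moebius_action \<gamma> z)) = 1" if "z \<in> K'" for z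
  proof -
    have "(\<Sum>\<gamma>\<in>G0. \<rho> (moebius_action \<gamma> z)) = (\<Sum>\<gamma>\<in>G0. indicator K (moebius_action \<gamma> z) / N z)"
    proof (rule sum.cong[OF refl])
      fix \<gamma> assume "\<gamma> \<in> G0"
      then show "\<rho> (moebius_action \<gamma> z) = indicator K (moebius_action \<gamma> z) / N z"
        using N_inv[OF that G0(1)] KK' by (cases "moebius_action \<gamma> z \<in> K") (auto simp: \<rho>_def)
    qed
    also have "\<dots> = N z / N z" unfolding sum_divide_distrib[symmetric] by (simp only: N_def)
    finally show ?thesis using N_ge[OF that] by simp
  qed
  have \<rho>_bd: "0 \<le> \<rho> z" "\<rho> z \<le> 1" for z
    using N_ge[of z] KK' by (auto simp: \<rho>_def indicator_def divide_le_eq)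
  have \<rho>_supp: "z \<in> K" if "\<rho> z \<noteq> 0" for z using that by (auto simp: \<rho>_def indicator_def split: if_splits)
  obtain B where B: "\<And>z w. z \<in> K' \<Longrightarrow> w \<in> K' \<Longrightarrow> \<bar>D z w\<bar> \<le> B" using bdd[OF K'] by blast
  have [measurable]: "(\<lambda>p. D (f p) (g p)) \<in> borel_measurable M"
    if "f \<in> borel_measurable M" "g \<in> borel_measurable M" for f g and M :: "'x measure"
    using measurable_compose[OF measurable_Pair[OF that] meas] by simp
  have fin_K': "emeasure (hyp_area \<Otimes>\<^sub>M hyp_area) (K' \<times> K') < \<infinity>"
    using emeasure_hyp_compact[OF K'] by (subst hyp_area.emeasure_pair_measure_Times) (auto simp: ennreal_mult_less_top)
  have integrable: "integrable (hyp_area \<Otimes>\<^sub>M hyp_area) (\<lambda>(w, z). a z * b w * D z w)"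
    if [measurable]: "a \<in> borel_measurable borel" "b \<in> borel_measurable borel"
      and ab: "\<And>z. \<bar>a z\<bar> \<le> 1" "\<And>z. \<bar>b z\<bar> \<le> 1"
      and s: "(\<forall>z. a z \<noteq> 0 \<longrightarrow> z \<in> K) \<or> (\<forall>z. b z \<noteq> 0 \<longrightarrow> z \<in> K)" for a b
  proof (rule integrableI_bounded_set[where A = "K' \<times> K'" and B = B])
    have nz: "z \<in> K' \<and> w \<in> K'" if "a z * b w * D z w \<noteq> 0" for z w
    proof -
      have n: "hyp_near z w" using that supp by fastforce
      then show ?thesis using s that nearK[OF n] nearK[of w z] KK' hyp_near_sym by auto
    qed
    show "AE p in hyp_area \<Otimes>\<^sub>M hyp_area. p \<notin> K' \<times> K' \<longrightarrow> (case p of (w, z) \<Rightarrow> a z * b w * D z w) = 0"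
      using nz by (intro AE_I2) (auto split: prod.splits)
    show "AE p in hyp_area \<Otimes>\<^sub>M hyp_area. p \<in> K' \<times> K' \<longrightarrow> norm (case p of (w, z) \<Rightarrow> a z * b w * D z w) \<le> B"
    proof (intro AE_I2 impI)
      fix p assume "p \<in> K' \<times> K'"
      then obtain w z where p: "p = (w, z)" "w \<in> K'" "z \<in> K'" by auto
      have "\<bar>a z\<bar> * \<bar>b w\<bar> * \<bar>D z w\<bar> \<le> 1 * 1 * B" using ab B[OF p(3,2)] by (intro mult_mono) auto
      then show "norm (case p of (w, z) \<Rightarrow> a z * b w * D z w) \<le> B" by (simp add: p abs_mult)
    qed
  qed (use fin_K' in auto)
  define E where "E = (\<integral>w. (\<integral>z. \<rho> w * D z w \<partial>hyp_area) \<partial>hyp_area)"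
  have \<rho>G: "\<bar>\<rho> z\<bar> \<le> 1" for z using \<rho>_bd[of z] by simp
  have int1: "integrable (hyp_area \<Otimes>\<^sub>M hyp_area) (\<lambda>(w, z). \<rho> (moebius_action \<gamma> z) * \<rho> w * D z w)" for \<gamma>
    using \<rho>G \<rho>_supp by (intro integrable) auto
  have int2: "integrable (hyp_area \<Otimes>\<^sub>M hyp_area) (\<lambda>(w, z). \<rho> z * \<rho> (moebius_action \<gamma> w) * D z w)" for \<gamma>
    using \<rho>G \<rho>_supp by (intro integrable) auto
  have int3: "integrable (hyp_area \<Otimes>\<^sub>M hyp_area) (\<lambda>(w, z). \<rho> z * D z w)"
    using integrable[of \<rho> "\<lambda>_. 1"] \<rho>G \<rho>_supp by simp
  have int4: "integrable (hyp_area \<Otimes>\<^sub>M hyp_area) (\<lambda>(w, z). \<rho> w * D z w)"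
    using integrable[of "\<lambda>_. 1" \<rho>] \<rho>G \<rho>_supp by simp
  \<comment> \<open>Replace both variables by their translates under \<open>\<gamma>\<close>; the kernel does not change.\<close>
  have unfold_term: "integral\<^sup>L (hyp_area \<Otimes>\<^sub>M hyp_area) (\<lambda>(w, z). \<rho> (moebius_action \<gamma> z) * \<rho> w * D z w)
      = integral\<^sup>L (hyp_area \<Otimes>\<^sub>M hyp_area) (\<lambda>(w, z). \<rho> z * \<rho> (moebius_action (adj2 \<gamma>) w) * D z w)" if "\<gamma> \<in> G0" for \<gamma>
  proof -
    note \<gamma> = G0[OF that]
    define H where "H w z = \<rho> z * \<rho> (moebius_action (adj2 \<gamma>) w) * D z w" for w z
    have [measurable]: "(\<lambda>p. H (f p) (g p)) \<in> borel_measurable M"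
      if "f \<in> borel_measurable M" "g \<in> borel_measurable M" for f g and M :: "'y measure"
      unfolding H_def using that by measurable
    have "integral\<^sup>L (hyp_area \<Otimes>\<^sub>M hyp_area) (\<lambda>(w, z). \<rho> (moebius_action \<gamma> z) * \<rho> w * D z w)
       = (\<integral>w. (\<integral>z. \<rho> (moebius_action \<gamma> z) * \<rho> w * D z w \<partial>hyp_area) \<partial>hyp_area)"
      using P.integral_fst'[OF int1[of \<gamma>]] by simp
    also have "\<dots> = (\<integral>w. (\<integral>z. H (moebius_action \<gamma> w) (moebius_action \<gamma> z) \<partial>hyp_area) \<partial>hyp_area)"
      by (intro integral_hyp_cong)
         (auto simp: H_def inv \<gamma> moebius_action_adj2)
    also have "\<dots> = (\<integral>w. (\<integral>z. H (moebius_action \<gamma> w) z \<partial>hyp_area) \<partial>hyp_area)"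
      by (intro Bochner_Integration.integral_cong refl integral_hyp_moebius \<gamma>) measurable
    also have "\<dots> = (\<integral>w. (\<integral>z. H w z \<partial>hyp_area) \<partial>hyp_area)"
      by (rule integral_hyp_moebius[OF \<gamma>(2), of "\<lambda>w. \<integral>z. H w z \<partial>hyp_area"]) measurable
    also have "\<dots> = integral\<^sup>L (hyp_area \<Otimes>\<^sub>M hyp_area) (\<lambda>(w, z). \<rho> z * \<rho> (moebius_action (adj2 \<gamma>) w) * D z w)"
      unfolding H_def using P.integral_fst'[OF int2[of "adj2 \<gamma>"]] by simp
    finally show ?thesis .
  qed
  have "E = integral\<^sup>L (hyp_area \<Otimes>\<^sub>M hyp_area) (\<lambda>(w, z). \<rho> w * D z w)"
    unfolding E_def using P.integral_fst'[OF int4] by simp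
  also have "\<dots> = integral\<^sup>L (hyp_area \<Otimes>\<^sub>M hyp_area) (\<lambda>p. \<Sum>\<gamma>\<in>G0. (\<lambda>(w, z). \<rho> (moebius_action \<gamma> z) * \<rho> w * D z w) p)"
  proof (intro Bochner_Integration.integral_cong refl, clarify)
    fix w z
    show "\<rho> w * D z w = (\<Sum>\<gamma>\<in>G0. \<rho> (moebius_action \<gamma> z) * \<rho> w * D z w)"
    proof (cases "\<rho> w * D z w = 0")
      case False
      then have "hyp_near z w" "w \<in> K" using supp \<rho>_supp by auto
      then show ?thesis using \<rho>_sum[OF nearK] by (simp add: mult.assoc flip: sum_distrib_right)
    qed auto
  qed
  also have "\<dots> = (\<Sum>\<gamma>\<in>G0. integral\<^sup>L (hyp_area \<Otimes>\<^sub>M hyp_area) (\<lambda>(w, z). \<rho> (moebius_action \<gamma> z) * \<rho> w * D z w))"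
    using int1 by (intro Bochner_Integration.integral_sum)
  also have "\<dots> = (\<Sum>\<gamma>\<in>G0. integral\<^sup>L (hyp_area \<Otimes>\<^sub>M hyp_area) (\<lambda>(w, z). \<rho> z * \<rho> (moebius_action (adj2 \<gamma>) w) * D z w))"
    using unfold_term by simp
  also have "\<dots> = (\<Sum>\<gamma>\<in>G0. integral\<^sup>L (hyp_area \<Otimes>\<^sub>M hyp_area) (\<lambda>(w, z). \<rho> z * \<rho> (moebius_action \<gamma> w) * D z w))"
    by (rule sum.reindex_bij_witness[of _ adj2 adj2]) (auto simp: G0_adj)
  also have "\<dots> = integral\<^sup>L (hyp_area \<Otimes>\<^sub>M hyp_area) (\<lambda>p. \<Sum>\<gamma>\<in>G0. (\<lambda>(w, z). \<rho> z * \<rho> (moebius_action \<gamma> w) * D z w) p)"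
    using int2 by (intro Bochner_Integration.integral_sum[symmetric])
  also have "\<dots> = integral\<^sup>L (hyp_area \<Otimes>\<^sub>M hyp_area) (\<lambda>(w, z). \<rho> z * D z w)"
  proof (intro Bochner_Integration.integral_cong refl, clarify)
    fix w z
    show "(\<Sum>\<gamma>\<in>G0. \<rho> z * \<rho> (moebius_action \<gamma> w) * D z w) = \<rho> z * D z w"
    proof (cases "\<rho> z * D z w = 0")
      case False
      then have "hyp_near z w" "z \<in> K" using supp \<rho>_supp by auto
      then have "hyp_near w z" "z \<in> K" using hyp_near_sym by blast+
      then have "(\<Sum>\<gamma>\<in>G0. \<rho> (moebius_action \<gamma> w)) = 1" by (intro \<rho>_sum nearK)
      moreover have "(\<Sum>\<gamma>\<in>G0. \<rho> z * \<rho> (moebius_action \<gamma> w) * D z w) = (\<Sum>\<gamma>\<in>G0. \<rho> (moebius_action \<gamma> w)) * (\<rho> z * D z w)"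
        by (simp add: sum_distrib_left sum_distrib_right mult_ac)
      ultimately show ?thesis by simp
    qed auto
  qed
  also have "\<dots> = (\<integral>z. (\<integral>w. \<rho> z * D z w \<partial>hyp_area) \<partial>hyp_area)"
    using P.integral_snd[OF int3] by simp
  also have "\<dots> = (\<integral>z. (\<integral>w. - (\<rho> z * D w z) \<partial>hyp_area) \<partial>hyp_area)"
    by (subst anti) simp
  also have "\<dots> = - E" by (simp add: E_def)
  finally have "E = 0" by simp
  have "E = (\<integral>w. \<rho> w * c \<partial>hyp_area)"
    unfolding E_def by (intro integral_hyp_cong) (auto simp: int)
  also have "\<dots> = integral\<^sup>L hyp_area \<rho> * c" by simp
  finally have "integral\<^sup>L hyp_area \<rho> * c = 0" using \<open>E = 0\<close> by simp
  moreover have "integral\<^sup>L hyp_area \<rho> > 0"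
  proof -
    let ?C = "cball \<i> (1/2)"
    have iK: "integrable hyp_area (indicator A :: complex \<Rightarrow> real)" if "compact A" "A \<subseteq> uhp" for A
      using emeasure_hyp_compact[OF that] that by (intro integrable_real_indicator) (auto simp: compact_imp_closed)
    have i\<rho>: "integrable hyp_area \<rho>"
      by (rule Bochner_Integration.integrable_bound[OF iK[OF K(1,2)]])
         (use \<rho>G \<rho>_supp in \<open>auto simp: indicator_def\<close>)
    have card: "real (card G0) > 0"
    proof -
      have "\<i> \<in> K'" using KK' by (auto simp: K_def)
      from N_ge[OF this] have "G0 \<noteq> {}" by (auto simp: N_def)
      then show ?thesis using fin by (simp add: card_gt_0_iff)
    qed
    have "integral\<^sup>L hyp_area (\<lambda>z. indicator ?C z * (1 / card G0)) \<le> integral\<^sup>L hyp_area \<rho>"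
    proof (rule integral_mono)
      show "integrable hyp_area (\<lambda>z. indicator ?C z * (1 / card G0) :: real)"
        by (intro integrable_mult_left iK cb compact_cball)
      fix z
      show "indicator ?C z * (1 / card G0) \<le> \<rho> z"
      proof (cases "z \<in> ?C")
        case True
        then have "z \<in> K" by (simp add: K_def)
        have "N z \<le> card G0" unfolding N_def using sum_bounded_above[of G0 "\<lambda>\<gamma>. indicator K (moebius_action \<gamma> z)" "1::real"]
          by (simp add: indicator_def)
        moreover have "N z \<ge> 1" using N_ge \<open>z \<in> K\<close> KK' by blast
        ultimately show ?thesis using True \<open>z \<in> K\<close> by (simp add: \<rho>_def frac_le)
      qed (use \<rho>_bd in simp)
    qed (rule i\<rho>)
    moreover have "integral\<^sup>L hyp_area (\<lambda>z. indicator ?C z * (1 / card G0)) = measure hyp_area ?C / card G0" by simp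
    moreover have "measure hyp_area ?C > 0"
    proof -
      have "measure lborel ?C * (1/4) = (\<integral>z. indicator ?C z * (1/4) \<partial>lborel)" by simp
      also have "\<dots> \<le> (\<integral>z. indicator uhp z * (indicator ?C z / (Im z)\<^sup>2) \<partial>lborel)"
      proof (rule integral_mono)
        show "integrable lborel (\<lambda>z. indicator ?C z * (1/4) :: real)"
          by (intro integrable_mult_left) (auto intro!: integrable_real_indicator emeasure_bounded_finite)
        have "continuous_on ?C (\<lambda>z. 1 / (Im z)\<^sup>2)" using cb by (intro continuous_intros) (auto simp: uhp_iff)
        from borel_integrable_compact[OF compact_cball this]
        show "integrable lborel (\<lambda>z. indicator uhp z * (indicator ?C z / (Im z)\<^sup>2) :: real)"
          by (rule Bochner_Integration.integrable_cong[THEN iffD1, rotated -1]) (use cb in \<open>auto simp: indicator_def\<close>)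
        fix z
        show "indicator ?C z * (1/4) \<le> indicator uhp z * (indicator ?C z / (Im z)\<^sup>2)"
        proof (cases "z \<in> ?C")
          case True
          then have z: "z \<in> uhp" using cb by blast
          have "\<bar>Im (z - \<i>)\<bar> \<le> 1/2" using True abs_Im_le_cmod[of "z - \<i>"] by (simp add: dist_norm norm_minus_commute)
          then have "Im (z - \<i>) \<le> 1/2" using abs_le_D1 by blast
          then have "(Im z)\<^sup>2 \<le> 2\<^sup>2" using z by (intro power_mono) (auto simp: uhp_iff)
          then show ?thesis using True z by (simp add: uhp_iff frac_le)
        qed simp
      qed
      also have "\<dots> = integral\<^sup>L hyp_area (indicator ?C)" by (subst integral_hyp) (auto intro!: borel_measurable_indicator)
      also have "\<dots> = measure hyp_area ?C" by simp
      finally have "measure lborel ?C * (1/4) \<le> measure hyp_area ?C" .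
      moreover have "measure lborel ?C > 0" by (rule content_cball_pos) simp
      ultimately show ?thesis by linarith
    qed
    ultimately show ?thesis using card by (smt (verit) divide_pos_pos)
  qed
  ultimately show ?thesis by simp
qed

text \<open>The derivative of \<open>q = e\<^bsup>P \<circ> \<gamma> - P\<^esup> / j\<^sup>2\<close> vanishes precisely because of the inhomogeneous term \<open>-cj\<close>; its constant absolute value
gives the additive period of \<open>\<phi> = ln Im + Re P\<close>.\<close>

lemma no_affine_weight_two_form:
  assumes h: "h holomorphic_on uhp"
    and trans: "\<And>\<gamma> \<tau>. \<gamma> \<in> G \<Longrightarrow> \<tau> \<in> uhp \<Longrightarrow>
      h (moebius_action \<gamma> \<tau>) = (aut_factor \<gamma> \<tau>)\<^sup>2 * h \<tau> - of_real (entry \<gamma> 2 1) * aut_factor \<gamma> \<tau>"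
  shows False
proof -
  have "(\<lambda>z. - 2 * h z) holomorphic_on uhp" using h by (intro holomorphic_intros)
  then obtain P where P: "\<And>z. z \<in> uhp \<Longrightarrow> (P has_field_derivative - 2 * h z) (at z within uhp)"
    using holomorphic_convex_primitive'[OF convex_uhp open_uhp] by blast
  then have P': "(P has_field_derivative - 2 * h z) (at z)" if "z \<in> uhp" for z
    using that at_within_open[OF that open_uhp] by metis
  have holP: "P holomorphic_on uhp" using P unfolding holomorphic_on_def field_differentiable_def by blast
  define \<phi> where "\<phi> z = ln (Im z) + Re (P z)" for z
  have equi: "\<exists>l. \<forall>z\<in>uhp. \<phi> (moebius_action \<gamma> z) = \<phi> z + l" if \<gamma>: "\<gamma> \<in> G" for \<gamma>
  proof -
    note det = det_one[OF \<gamma>]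
    define q where "q z = exp (P (moebius_action \<gamma> z) - P z) / (aut_factor \<gamma> z)\<^sup>2" for z
    have "(q has_field_derivative 0) (at z within uhp)" if z: "z \<in> uhp" for z
    proof -
      let ?j = "aut_factor \<gamma> z" and ?c = "complex_of_real (entry \<gamma> 2 1)"
      have j: "?j \<noteq> 0" using aut_factor_nonzero[OF det z] .
      have dP: "((\<lambda>z. P (moebius_action \<gamma> z)) has_field_derivative (- 2 * h (moebius_action \<gamma> z)) * (1 / ?j\<^sup>2)) (at z within uhp)"
        by (rule DERIV_chain2[OF P'[OF moebius_action_in_uhp[OF det z]] moebius_action_has_derivative[OF det z]])
      let ?e = "exp (P (moebius_action \<gamma> z) - P z)"
      have d1: "(q has_field_derivative
          ((?e * ((- 2 * h (moebius_action \<gamma> z)) * (1 / ?j\<^sup>2) - (- 2 * h z))) * ?j\<^sup>2 - ?e * (2 * ?j * ?c)) / (?j\<^sup>2 * ?j\<^sup>2)) (at z within uhp)"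
        unfolding q_def[abs_def] using j
        by (auto intro!: derivative_eq_intros dP P[OF z] aut_factor_has_derivative simp: power2_eq_square)
      have eq: "(- 2 * h (moebius_action \<gamma> z)) * (1 / ?j\<^sup>2) - (- 2 * h z) = 2 * ?c / ?j"
        unfolding trans[OF \<gamma> z] using j by (simp add: field_simps power2_eq_square)
      have "(?e * ((- 2 * h (moebius_action \<gamma> z)) * (1 / ?j\<^sup>2) - (- 2 * h z))) * ?j\<^sup>2 - ?e * (2 * ?j * ?c) = 0"
        unfolding eq using j by (simp add: field_simps power2_eq_square)
      from d1[unfolded this] show ?thesis by simp
    qed
    then obtain C where C: "\<And>z. z \<in> uhp \<Longrightarrow> q z = C"
      using has_field_derivative_zero_constant[OF convex_uhp, of q] by blast
    have "\<phi> (moebius_action \<gamma> z) = \<phi> z + ln (cmod C)" if z: "z \<in> uhp" for z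
    proof -
      have j: "cmod (aut_factor \<gamma> z) > 0" using aut_factor_nonzero[OF det z] by simp
      have "ln (cmod C) = ln (exp (Re (P (moebius_action \<gamma> z)) - Re (P z)) / (cmod (aut_factor \<gamma> z))\<^sup>2)"
        unfolding C[OF z, symmetric] q_def by (simp add: norm_divide norm_power)
      also have "\<dots> = Re (P (moebius_action \<gamma> z)) - Re (P z) - 2 * ln (cmod (aut_factor \<gamma> z))"
        using j by (simp add: ln_div ln_realpow)
      finally have 1: "ln (cmod C) = Re (P (moebius_action \<gamma> z)) - Re (P z) - 2 * ln (cmod (aut_factor \<gamma> z))" .
      have "ln (Im (moebius_action \<gamma> z)) = ln (Im z) - 2 * ln (cmod (aut_factor \<gamma> z))"
        using j z by (simp add: Im_moebius_action[OF det z] ln_div ln_realpow uhp_iff)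
      with 1 show ?thesis by (simp add: \<phi>_def)
    qed
    then show ?thesis by blast
  qed
  have cont: "continuous_on uhp \<phi>"
    unfolding \<phi>_def using holomorphic_on_imp_continuous_on[OF holP]
    by (intro continuous_intros) (auto simp: uhp_iff)
  \<comment> \<open>\<open>\<phi>\<close> made globally measurable; only its values on the half-plane matter.\<close>
  define \<psi> where "\<psi> z = indicator uhp z * \<phi> z" for z
  have [measurable]: "\<psi> \<in> borel_measurable borel"
    using borel_measurable_continuous_on_indicator[OF borel_uhp cont] by (simp add: \<psi>_def[abs_def])
  \<comment> \<open>Truncation to nearby pairs makes the integral over one variable finite.\<close>
  define D where "D z w = (if hyp_near z w then \<psi> z - \<psi> w else 0)" for z w
  have nearD: "hyp_near z w \<Longrightarrow> z \<in> uhp \<and> w \<in> uhp" for z w by (simp add: hyp_near_def)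
  have "- disc_defect = 0"
  proof (rule antisymmetric_kernel_integral_zero[of D])
    show "case_prod D \<in> borel_measurable (borel \<Otimes>\<^sub>M borel)"
      unfolding D_def hyp_near_def case_prod_unfold by measurable
    show "D w z = - D z w" for z w by (simp add: D_def hyp_near_sym)
    show "D (moebius_action \<gamma> z) (moebius_action \<gamma> w) = D z w" if "\<gamma> \<in> G" "z \<in> uhp" "w \<in> uhp" for \<gamma> z w
      using equi[OF that(1)] that
      by (auto simp: D_def hyp_near_moebius det_one \<psi>_def moebius_action_in_uhp)
    show "D z w = 0" if "\<not> hyp_near z w" for z w using that by (simp add: D_def)
    show "\<exists>B. \<forall>z\<in>K. \<forall>w\<in>K. \<bar>D z w\<bar> \<le> B" if K: "compact K" "K \<subseteq> uhp" for K
    proof -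
      have "bounded (\<phi> ` K)"
        by (rule compact_imp_bounded[OF compact_continuous_image[OF continuous_on_subset[OF cont K(2)] K(1)]])
      then obtain B where B: "\<And>z. z \<in> K \<Longrightarrow> \<bar>\<phi> z\<bar> \<le> B" by (auto simp: bounded_iff)
      have "\<bar>D z w\<bar> \<le> 2 * B" if "z \<in> K" "w \<in> K" for z w
      proof -
        have "\<psi> z = \<phi> z" "\<psi> w = \<phi> w" using that K(2) by (auto simp: \<psi>_def)
        then show ?thesis using B[OF that(1)] B[OF that(2)] by (auto simp: D_def)
      qed
      then show ?thesis by blast
    qed
    show "(\<integral>z. D z w \<partial>hyp_area) = - disc_defect" if w: "w \<in> uhp" for w
    proof -
      have "D z w = indicator {z. hyp_near z w} z * ((ln (Im z) + Re (P z)) - (ln (Im w) + Re (P w)))" for z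
        using w by (auto simp: D_def \<psi>_def \<phi>_def hyp_near_def)
      then show ?thesis using integral_near_superharmonic[OF holP w] by simp
    qed
  qed
  then show False using disc_defect_pos by simp
qed

end

section \<open>Derivatives of automorphic forms\<close>

text \<open>With this normalisation the transformation law below has the coefficients \<open>1/(m-l)!\<close>, which are those of an exponential
and match \<open>e\<^bsup>-cjL(1)\<^esup>\<close>.\<close>

definition normalized_derivative :: "nat \<Rightarrow> (complex \<Rightarrow> complex) \<Rightarrow> nat \<Rightarrow> complex \<Rightarrow> complex" where
  "normalized_derivative w F m \<tau> = (deriv ^^ m) F \<tau> / (fact m * pochhammer (of_nat w) m)"

lemma normalized_derivative_0 [simp]: "normalized_derivative w F 0 = F"
  by (simp add: normalized_derivative_def fun_eq_iff)

lemma pochhammer_of_nat_nonzero: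
  assumes "w > 0" shows "pochhammer (of_nat w) m \<noteq> (0::complex)"
proof
  assume "pochhammer (of_nat w) m = (0::complex)"
  then obtain k where "of_nat w = - (of_nat k :: complex)" by (auto simp: pochhammer_eq_0_iff)
  then have "of_nat (w + k) = (0::complex)" by simp
  with assms show False by (simp only: of_nat_eq_0_iff)
qed

lemma normalized_derivative_holomorphic:
  assumes "F holomorphic_on uhp" "w > 0" shows "normalized_derivative w F m holomorphic_on uhp"
proof -
  have nz: "fact m * pochhammer (of_nat w) m \<noteq> (0::complex)"
    using pochhammer_of_nat_nonzero[OF assms(2)] by simp
  show ?thesis
    unfolding normalized_derivative_def[abs_def]
    by (intro holomorphic_intros holomorphic_higher_deriv assms open_uhp nz)
qed

lemma normalized_derivative_has_derivative:
  assumes "F holomorphic_on uhp" "w > 0" "\<tau> \<in> uhp"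
  shows "(normalized_derivative w F m has_field_derivative
    of_nat (Suc m) * (of_nat w + of_nat m) * normalized_derivative w F (Suc m) \<tau>) (at \<tau>)"
proof -
  have nz: "pochhammer (of_nat w) m \<noteq> (0::complex)" "of_nat w + of_nat m \<noteq> (0::complex)"
    using pochhammer_of_nat_nonzero[OF assms(2)] assms(2) by (auto simp flip: of_nat_add)
  have "((deriv ^^ m) F has_field_derivative (deriv ^^ Suc m) F \<tau>) (at \<tau>)"
    using holomorphic_derivI[OF holomorphic_higher_deriv[OF assms(1) open_uhp] open_uhp assms(3)] by simp
  from DERIV_cdivide[OF this, of "fact m * pochhammer (of_nat w) m"]
  have "(normalized_derivative w F m has_field_derivative (deriv ^^ Suc m) F \<tau> / (fact m * pochhammer (of_nat w) m)) (at \<tau>)"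
    by (simp add: normalized_derivative_def[abs_def])
  moreover have "(deriv ^^ Suc m) F \<tau> / (fact m * pochhammer (of_nat w) m)
      = of_nat (Suc m) * (of_nat w + of_nat m) * normalized_derivative w F (Suc m) \<tau>"
    using nz unfolding normalized_derivative_def pochhammer_Suc fact_Suc
    by (simp add: divide_simps del: of_nat_Suc)
  ultimately show ?thesis by simp
qed

context SL2R_group
begin

text \<open>Differentiating the law for \<open>m\<close> and multiplying by \<open>j\<^sup>2\<close> gives the law for \<open>m + 1\<close>. The coefficient of the \<open>l\<close>-th term
works out since \<open>(w + m + l)(m + 1 - l) + l (w + l - 1) = (m + 1)(w + m)\<close>.\<close>

lemma normalized_derivative_moebius:
  assumes F: "automorphic (int w) F" and w: "w > 0" and \<gamma>: "\<gamma> \<in> G"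
  shows "\<tau> \<in> uhp \<Longrightarrow> normalized_derivative w F m (moebius_action \<gamma> \<tau>)
    = (\<Sum>l\<le>m. of_real (entry \<gamma> 2 1) ^ (m - l) / fact (m - l) * aut_factor \<gamma> \<tau> ^ (w + m + l) * normalized_derivative w F l \<tau>)"
proof (induction m arbitrary: \<tau>)
  case 0
  then show ?case using automorphicD(2)[OF F \<gamma> 0] by simp
next
  case (Suc m)
  note \<tau> = Suc.prems
  let ?c = "complex_of_real (entry \<gamma> 2 1)" and ?j = "aut_factor \<gamma> \<tau>" and ?N = "normalized_derivative w F"
  note det = det_one[OF \<gamma>] and hol = automorphicD(1)[OF F]
  have j: "?j \<noteq> 0" by (rule aut_factor_nonzero[OF det \<tau>])
  \<comment> \<open>The terms of the law to be proved, in which both parts of the derivative are expressed.\<close>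
  define X where "X l = ?c ^ (Suc m - l) * ?j ^ (w + Suc m + l) * ?N l \<tau> / fact (Suc m - l)" for l
  have wm: "of_nat (Suc m) * (of_nat w + of_nat m) \<noteq> (0::complex)"
    using w by (auto simp del: of_nat_Suc simp flip: of_nat_add of_nat_mult)
  have "((\<lambda>\<tau>. ?N m (moebius_action \<gamma> \<tau>)) has_field_derivative
      of_nat (Suc m) * (of_nat w + of_nat m) * ?N (Suc m) (moebius_action \<gamma> \<tau>) * (1 / ?j\<^sup>2)) (at \<tau>)"
    by (rule DERIV_chain2[OF normalized_derivative_has_derivative[OF hol w moebius_action_in_uhp[OF det \<tau>]]
          moebius_action_has_derivative[OF det \<tau>]])
  then have "((\<lambda>\<tau>. \<Sum>l\<le>m. ?c ^ (m - l) / fact (m - l) * aut_factor \<gamma> \<tau> ^ (w + m + l) * ?N l \<tau>) has_field_derivative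
      of_nat (Suc m) * (of_nat w + of_nat m) * ?N (Suc m) (moebius_action \<gamma> \<tau>) * (1 / ?j\<^sup>2)) (at \<tau>)"
    by (rule has_field_derivative_transform_within_open[OF _ open_uhp \<tau>]) (rule Suc.IH)
  moreover have "((\<lambda>\<tau>. \<Sum>l\<le>m. ?c ^ (m - l) / fact (m - l) * aut_factor \<gamma> \<tau> ^ (w + m + l) * ?N l \<tau>) has_field_derivative
      (\<Sum>l\<le>m. ?c ^ (m - l) / fact (m - l) * (of_nat (w + m + l) * ?j ^ (w + m + l - 1) * ?c) * ?N l \<tau>
        + ?c ^ (m - l) / fact (m - l) * ?j ^ (w + m + l) * (of_nat (Suc l) * (of_nat w + of_nat l) * ?N (Suc l) \<tau>))) (at \<tau>)"
  proof (intro DERIV_sum)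
    fix l
    have "((\<lambda>\<tau>. ?c ^ (m - l) / fact (m - l) * aut_factor \<gamma> \<tau> ^ (w + m + l) * ?N l \<tau>) has_field_derivative
        ?c ^ (m - l) / fact (m - l) * (of_nat (w + m + l) * (?c * ?j ^ (w + m + l - Suc 0))) * ?N l \<tau>
        + of_nat (Suc l) * (of_nat w + of_nat l) * ?N (Suc l) \<tau> * (?c ^ (m - l) / fact (m - l) * ?j ^ (w + m + l))) (at \<tau>)"
      by (rule DERIV_mult[OF DERIV_cmult[OF DERIV_power[OF aut_factor_has_derivative]]
            normalized_derivative_has_derivative[OF hol w \<tau>]])
    then show "((\<lambda>\<tau>. ?c ^ (m - l) / fact (m - l) * aut_factor \<gamma> \<tau> ^ (w + m + l) * ?N l \<tau>) has_field_derivative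
        ?c ^ (m - l) / fact (m - l) * (of_nat (w + m + l) * ?j ^ (w + m + l - 1) * ?c) * ?N l \<tau>
        + ?c ^ (m - l) / fact (m - l) * ?j ^ (w + m + l) * (of_nat (Suc l) * (of_nat w + of_nat l) * ?N (Suc l) \<tau>)) (at \<tau>)"
      by (simp only: mult_ac One_nat_def)
  qed
  ultimately have "of_nat (Suc m) * (of_nat w + of_nat m) * ?N (Suc m) (moebius_action \<gamma> \<tau>) * (1 / ?j\<^sup>2)
     = (\<Sum>l\<le>m. ?c ^ (m - l) / fact (m - l) * (of_nat (w + m + l) * ?j ^ (w + m + l - 1) * ?c) * ?N l \<tau>
        + ?c ^ (m - l) / fact (m - l) * ?j ^ (w + m + l) * (of_nat (Suc l) * (of_nat w + of_nat l) * ?N (Suc l) \<tau>))"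
    by (rule DERIV_unique)
  then have "of_nat (Suc m) * (of_nat w + of_nat m) * ?N (Suc m) (moebius_action \<gamma> \<tau>)
     = ?j\<^sup>2 * (\<Sum>l\<le>m. ?c ^ (m - l) / fact (m - l) * (of_nat (w + m + l) * ?j ^ (w + m + l - 1) * ?c) * ?N l \<tau>
        + ?c ^ (m - l) / fact (m - l) * ?j ^ (w + m + l) * (of_nat (Suc l) * (of_nat w + of_nat l) * ?N (Suc l) \<tau>))"
    using j by (simp add: field_simps)
  also have "\<dots> = (\<Sum>l\<le>m. of_nat (w + m + l) * of_nat (Suc m - l) * X l)
       + (\<Sum>l\<le>m. of_nat (Suc l) * (of_nat w + of_nat (Suc l) - 1) * X (Suc l))"
    unfolding sum_distrib_left sum.distrib[symmetric]
  proof (rule sum.cong[OF refl])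
    fix l assume "l \<in> {..m}"
    then have l: "Suc m - l = Suc (m - l)" by auto
    have p: "?j\<^sup>2 * ?j ^ (w + m + l - 1) = ?j ^ (w + Suc m + l)"
    proof -
      have "w + Suc m + l = 2 + (w + m + l - 1)" using w by simp
      then show ?thesis by (simp only: power_add)
    qed
    have p2: "?j\<^sup>2 * ?j ^ (w + m + l) = ?j ^ (w + Suc m + Suc l)"
      by (simp add: power2_eq_square)
    have f: "of_nat (Suc (m - l)) / fact (Suc (m - l)) = (1 / fact (m - l) :: complex)"
      by (simp add: fact_Suc del: of_nat_Suc)
    have 1: "of_nat (w + m + l) * of_nat (Suc m - l) * X l
      = ?c ^ (m - l) / fact (m - l) * (of_nat (w + m + l) * (?j\<^sup>2 * ?j ^ (w + m + l - 1)) * ?c) * ?N l \<tau>"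
    proof -
      have "of_nat (w + m + l) * of_nat (Suc m - l) * X l
        = (of_nat (Suc (m - l)) / fact (Suc (m - l))) * (of_nat (w + m + l) * (?c ^ Suc (m - l) * ?j ^ (w + Suc m + l) * ?N l \<tau>))"
        unfolding X_def l by (simp del: of_nat_Suc fact_Suc power_Suc)
      then show ?thesis unfolding f p by (simp add: mult_ac)
    qed
    have 2: "of_nat (Suc l) * (of_nat w + of_nat (Suc l) - 1) * X (Suc l)
      = ?c ^ (m - l) / fact (m - l) * (?j\<^sup>2 * ?j ^ (w + m + l)) * (of_nat (Suc l) * (of_nat w + of_nat l) * ?N (Suc l) \<tau>)"
      unfolding X_def p2 by (simp add: mult_ac)
    show "?j\<^sup>2 * (?c ^ (m - l) / fact (m - l) * (of_nat (w + m + l) * ?j ^ (w + m + l - 1) * ?c) * ?N l \<tau>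
        + ?c ^ (m - l) / fact (m - l) * ?j ^ (w + m + l) * (of_nat (Suc l) * (of_nat w + of_nat l) * ?N (Suc l) \<tau>))
      = of_nat (w + m + l) * of_nat (Suc m - l) * X l + of_nat (Suc l) * (of_nat w + of_nat (Suc l) - 1) * X (Suc l)"
      unfolding 1 2 by (simp only: distrib_left mult_ac)
  qed
  also have "(\<Sum>l\<le>m. of_nat (w + m + l) * of_nat (Suc m - l) * X l) = (\<Sum>l\<le>Suc m. of_nat (w + m + l) * of_nat (Suc m - l) * X l)"
    by simp
  also have "(\<Sum>l\<le>m. of_nat (Suc l) * (of_nat w + of_nat (Suc l) - 1) * X (Suc l))
      = (\<Sum>l\<le>Suc m. of_nat l * (of_nat w + of_nat l - 1) * X l)"
    by (subst sum.atMost_Suc_shift) simp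
  also have "(\<Sum>l\<le>Suc m. of_nat (w + m + l) * of_nat (Suc m - l) * X l) + (\<Sum>l\<le>Suc m. of_nat l * (of_nat w + of_nat l - 1) * X l)
      = (\<Sum>l\<le>Suc m. of_nat (Suc m) * (of_nat w + of_nat m) * X l)"
    unfolding sum.distrib[symmetric]
  proof (rule sum.cong[OF refl])
    fix l assume "l \<in> {..Suc m}"
    then have "of_nat (Suc m - l) = (of_nat (Suc m) - of_nat l :: complex)" by (simp add: of_nat_diff)
    then show "of_nat (w + m + l) * of_nat (Suc m - l) * X l + of_nat l * (of_nat w + of_nat l - 1) * X l
        = of_nat (Suc m) * (of_nat w + of_nat m) * X l"
      by (simp only:) (simp add: algebra_simps)
  qed
  also have "\<dots> = of_nat (Suc m) * (of_nat w + of_nat m) * (\<Sum>l\<le>Suc m. X l)" by (simp only: sum_distrib_left)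
  finally have "?N (Suc m) (moebius_action \<gamma> \<tau>) = (\<Sum>l\<le>Suc m. X l)" using wm by (metis mult_left_cancel)
  also have "\<dots> = (\<Sum>l\<le>Suc m. ?c ^ (Suc m - l) / fact (Suc m - l) * ?j ^ (w + Suc m + l) * ?N l \<tau>)"
    unfolding X_def by (intro sum.cong) auto
  finally show ?case .
qed

end

section \<open>The grading of a vertex operator algebra and the factor K\<close>

lemma (in vector_space) Sum_any_scale:
  assumes "finite {n. f n \<noteq> 0}"
  shows "Sum_any (\<lambda>n. scale c (f n)) = scale c (Sum_any f)"
proof -
  have "Sum_any (\<lambda>n. scale c (f n)) = (\<Sum>n | f n \<noteq> 0. scale c (f n))"
    by (rule Sum_any.expand_superset) (use assms in auto)
  then show ?thesis by (simp add: Sum_any.expand_set scale_sum_right)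
qed

lemma (in Vector_Spaces.linear) Sum_any_linear:
  assumes "finite {n. g n \<noteq> 0}"
  shows "f (Sum_any g) = Sum_any (\<lambda>n. f (g n))"
proof -
  have "Sum_any (\<lambda>n. f (g n)) = (\<Sum>n | g n \<noteq> 0. f (g n))"
    by (rule Sum_any.expand_superset) (use assms zero in auto)
  then show ?thesis by (simp add: Sum_any.expand_set sum)
qed

context cft_type_voa
begin

abbreviation sc :: "complex \<Rightarrow> 'v \<Rightarrow> 'v" where "sc \<equiv> voa_scale A"
abbreviation gc :: "'v \<Rightarrow> int \<Rightarrow> 'v" where "gc \<equiv> grade_component A"
abbreviation L1 :: "'v \<Rightarrow> 'v" where "L1 \<equiv> Vir A 1"

sublocale V: vector_space sc by (rule vector_space_scale)

lemma subspace_grade: "V.subspace (voa_grade A n)"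
  using grade_finite_dim[of n] by (simp add: finite_dim_subspace_def)

lemma graded_decomp_gc: "graded_decomp A v (gc v)"
  unfolding grade_component_def by (rule theI'[OF grade_direct_sum])

lemma gc_eqI: "graded_decomp A v u \<Longrightarrow> gc v = u"
  using graded_decomp_gc grade_direct_sum by blast

lemma gc_in_grade: "gc v n \<in> voa_grade A n"
  and finite_gc: "finite {n. gc v n \<noteq> 0}"
  and Sum_any_gc: "v = Sum_any (gc v)"
  using graded_decomp_gc[of v] by (auto simp: graded_decomp_def)

lemma gc_inject: "gc v = gc w \<Longrightarrow> v = w"
  using Sum_any_gc by metis

lemma gc_add: "gc (v + w) n = gc v n + gc w n"
proof -
  have "graded_decomp A (v + w) (\<lambda>n. gc v n + gc w n)"
    unfolding graded_decomp_def
  proof (intro conjI allI)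
    show "gc v n + gc w n \<in> voa_grade A n" for n
      by (intro V.subspace_add subspace_grade gc_in_grade)
    show "finite {n. gc v n + gc w n \<noteq> 0}"
      by (rule finite_subset[OF _ finite_UnI[OF finite_gc[of v] finite_gc[of w]]]) auto
    show "v + w = (Sum_any (\<lambda>n. gc v n + gc w n))"
      using Sum_any.distrib[OF finite_gc finite_gc] Sum_any_gc by metis
  qed
  from gc_eqI[OF this] show ?thesis by simp
qed

lemma gc_scale: "gc (sc c v) n = sc c (gc v n)"
proof -
  have "graded_decomp A (sc c v) (\<lambda>n. sc c (gc v n))"
    unfolding graded_decomp_def
  proof (intro conjI allI)
    show "sc c (gc v n) \<in> voa_grade A n" for n
      by (intro V.subspace_scale subspace_grade gc_in_grade)
    show "finite {n. sc c (gc v n) \<noteq> 0}"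
      by (rule finite_subset[OF _ finite_gc[of v]]) auto
    show "sc c v = (Sum_any (\<lambda>n. sc c (gc v n)))"
      using V.Sum_any_scale[OF finite_gc] Sum_any_gc by metis
  qed
  from gc_eqI[OF this] show ?thesis by simp
qed

lemma linear_gc: "Vector_Spaces.linear sc sc (\<lambda>v. gc v n)"
  by unfold_locales (auto simp: gc_add gc_scale)

lemma gc_zero [simp]: "gc 0 n = 0"
  using gc_scale[of 0 0 n] by simp

lemma gc_sum: "gc (sum f S) n = (\<Sum>x\<in>S. gc (f x) n)"
  using module_hom.sum[OF linear_gc[unfolded Vector_Spaces.linear_iff_module_hom]] by blast

lemma gc_homogeneous:
  assumes "v \<in> voa_grade A n" shows "gc v m = (if m = n then v else 0)"
proof -
  have "graded_decomp A v (\<lambda>m. if m = n then v else 0)"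
    unfolding graded_decomp_def
  proof (intro conjI allI)
    show "(if m = n then v else 0) \<in> voa_grade A m" for m
      using assms V.subspace_0[OF subspace_grade] by auto
    show fin: "finite {m. (if m = n then v else 0) \<noteq> 0}" by (rule finite_subset[of _ "{n}"]) auto
    show "v = (Sum_any (\<lambda>m. if m = n then v else 0))" by simp
  qed
  from gc_eqI[OF this] show ?thesis by simp
qed

lemma gc_neg: "n < 0 \<Longrightarrow> gc v n = 0"
  using gc_in_grade[of v n] grade_negative by auto

lemma filtration_iff: "v \<in> voa_filtration A N \<longleftrightarrow> (\<forall>n>N. gc v n = 0)"
proof
  assume "v \<in> voa_filtration A N"
  then show "\<forall>n>N. gc v n = 0"
    unfolding voa_filtration_def
  proof (induction rule: V.span_induct)
    case base
    show ?case by (auto simp: V.subspace_def gc_add gc_scale)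
  next
    case (step x)
    then obtain n where "n \<le> N" "x \<in> voa_grade A n" by auto
    then show ?case by (auto simp: gc_homogeneous)
  qed
next
  assume *: "\<forall>n>N. gc v n = 0"
  have "v = (\<Sum>n | gc v n \<noteq> 0. gc v n)" using Sum_any_gc[of v] by (simp add: Sum_any.expand_set)
  also have "\<dots> \<in> voa_filtration A N"
    unfolding voa_filtration_def
  proof (intro V.span_sum V.span_base)
    fix n assume "n \<in> {n. gc v n \<noteq> 0}"
    with * have "n \<le> N" by force
    then show "gc v n \<in> \<Union>(voa_grade A ` {..N})" using gc_in_grade by blast
  qed
  finally show "v \<in> voa_filtration A N" .
qed

lemma linear_Vir: "Vector_Spaces.linear sc sc (Vir A n)"
  unfolding Vir_def[abs_def] by (rule mode_linear_right)

lemma gc_L0: "gc (Vir A 0 v) n = sc (of_int n) (gc v n)"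
proof -
  have "graded_decomp A (Vir A 0 v) (\<lambda>n. sc (of_int n) (gc v n))"
    unfolding graded_decomp_def
  proof (intro conjI allI)
    show "sc (of_int n) (gc v n) \<in> voa_grade A n" for n
      by (intro V.subspace_scale subspace_grade gc_in_grade)
    show "finite {n. sc (of_int n) (gc v n) \<noteq> 0}"
      by (rule finite_subset[OF _ finite_gc[of v]]) auto
    have "Vir A 0 v = Vir A 0 (Sum_any (gc v))" using Sum_any_gc[of v] by simp
    also have "\<dots> = Sum_any (\<lambda>n. Vir A 0 (gc v n))"
      by (rule linear.Sum_any_linear[OF linear_Vir finite_gc])
    also have "\<dots> = Sum_any (\<lambda>n. sc (of_int n) (gc v n))"
      using L_zero_grade[OF gc_in_grade] by simp
    finally show "Vir A 0 v = (Sum_any (\<lambda>n. sc (of_int n) (gc v n)))" .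
  qed
  from gc_eqI[OF this] show ?thesis by simp
qed

text \<open>By \<open>[L(0), L(1)] = -L(1)\<close>, the vector \<open>L(1) v\<close> is an eigenvector of \<open>L(0)\<close> for the eigenvalue \<open>n - 1\<close>, and
components of any other degree are eigenvectors for other eigenvalues.\<close>

lemma L1_lowers_grade:
  assumes v: "v \<in> voa_grade A n" shows "L1 v \<in> voa_grade A (n - 1)"
proof -
  interpret L: Vector_Spaces.linear sc sc L1 by (rule linear_Vir)
  have "Vir A 0 (L1 v) - L1 (Vir A 0 v) = sc (- 1) (L1 v)"
    using virasoro[of 0 1 v] by simp
  moreover have "L1 (Vir A 0 v) = sc (of_int n) (L1 v)" by (simp add: L_zero_grade[OF v] L.scale)
  ultimately have "Vir A 0 (L1 v) = sc (of_int n) (L1 v) + sc (- 1) (L1 v)" by (simp add: algebra_simps)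
  then have L0: "Vir A 0 (L1 v) = sc (of_int (n - 1)) (L1 v)" by (simp add: V.scale_left_diff_distrib)
  have zero: "gc (L1 v) m = 0" if "m \<noteq> n - 1" for m
  proof -
    have "sc (of_int m) (gc (L1 v) m) = sc (of_int (n - 1)) (gc (L1 v) m)"
      using L0 gc_L0[of "L1 v" m] gc_scale[of "of_int (n - 1)" "L1 v" m] by simp
    then have "sc (of_int m - of_int (n - 1)) (gc (L1 v) m) = 0" by (simp only: V.scale_left_diff_distrib) simp
    moreover have "of_int m - of_int (n - 1) \<noteq> (0::complex)" using that by (simp flip: of_int_diff)
    ultimately show ?thesis by simp
  qed
  have "L1 v = Sum_any (gc (L1 v))" by (rule Sum_any_gc)
  also have "\<dots> = (\<Sum>m\<in>{n - 1}. gc (L1 v) m)"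
    by (rule Sum_any.expand_superset) (use zero in auto)
  finally show ?thesis using gc_in_grade[of "L1 v" "n - 1"] by simp
qed

lemma gc_L1: "gc (L1 v) n = L1 (gc v (n + 1))"
proof -
  interpret L: Vector_Spaces.linear sc sc L1 by (rule linear_Vir)
  have "graded_decomp A (L1 v) (\<lambda>n. L1 (gc v (n + 1)))"
    unfolding graded_decomp_def
  proof (intro conjI allI)
    show "L1 (gc v (n + 1)) \<in> voa_grade A n" for n
      using L1_lowers_grade[OF gc_in_grade[of v "n + 1"]] by simp
    have "{n. L1 (gc v (n + 1)) \<noteq> 0} \<subseteq> (\<lambda>n. n - 1) ` {n. gc v n \<noteq> 0}"
    proof
      fix n assume "n \<in> {n. L1 (gc v (n + 1)) \<noteq> 0}"
      then have "gc v (n + 1) \<noteq> 0" by (auto simp: L.zero)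
      then show "n \<in> (\<lambda>n. n - 1) ` {n. gc v n \<noteq> 0}" by (intro image_eqI[of _ _ "n + 1"]) auto
    qed
    then show "finite {n. L1 (gc v (n + 1)) \<noteq> 0}" using finite_gc finite_subset by blast
    have "L1 v = L1 (Sum_any (gc v))" using Sum_any_gc[of v] by simp
    also have "\<dots> = Sum_any (\<lambda>n. L1 (gc v n))"
      by (rule L.Sum_any_linear[OF finite_gc])
    also have "\<dots> = Sum_any (\<lambda>n. L1 (gc v (n + 1)))"
      by (rule Sum_any.reindex_cong[of "\<lambda>n. n + 1"]) (auto simp: bij_betw_def fun_eq_iff intro!: bijI' exI[of _ "_ - 1"])
    finally show "L1 v = (Sum_any (\<lambda>n. L1 (gc v (n + 1))))" .
  qed
  from gc_eqI[OF this] show ?thesis by simp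
qed

lemma linear_L1_pow: "Vector_Spaces.linear sc sc (L1 ^^ i)"
proof (induction i)
  case 0
  show ?case by unfold_locales auto
next
  case (Suc i)
  then show ?case using Vector_Spaces.linear_compose[OF _ linear_Vir, of sc "L1 ^^ i" 1] by (simp only: funpow.simps)
qed

lemma L1_pow_add: "(L1 ^^ i) (v + w) = (L1 ^^ i) v + (L1 ^^ i) w"
  and L1_pow_scale: "(L1 ^^ i) (sc c v) = sc c ((L1 ^^ i) v)"
  and L1_pow_sum: "(L1 ^^ i) (sum f S) = (\<Sum>x\<in>S. (L1 ^^ i) (f x))"
  and L1_pow_zero [simp]: "(L1 ^^ i) 0 = 0"
proof -
  interpret Vector_Spaces.linear sc sc "L1 ^^ i" by (rule linear_L1_pow)
  show "(L1 ^^ i) (v + w) = (L1 ^^ i) v + (L1 ^^ i) w" "(L1 ^^ i) (sc c v) = sc c ((L1 ^^ i) v)"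
    "(L1 ^^ i) (sum f S) = (\<Sum>x\<in>S. (L1 ^^ i) (f x))" "(L1 ^^ i) 0 = 0"
    by (simp_all add: add scale sum zero)
qed

lemma gc_L1_pow: "gc ((L1 ^^ i) v) n = (L1 ^^ i) (gc v (n + int i))"
  by (induction i arbitrary: n) (auto simp: gc_L1 add.assoc)

lemma L1_pow_grade: "v \<in> voa_grade A n \<Longrightarrow> (L1 ^^ i) v \<in> voa_grade A (n - int i)"
proof (induction i)
  case (Suc i)
  then show ?case using L1_lowers_grade[of "(L1 ^^ i) v" "n - int i"] by (simp add: algebra_simps)
qed simp

lemma L1_pow_vanish:
  assumes "v \<in> voa_filtration A N" "int i > N" shows "(L1 ^^ i) v = 0"
proof -
  have "gc ((L1 ^^ i) v) n = 0" for n
  proof (cases "n < 0")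
    case True
    then show ?thesis by (rule gc_neg)
  next
    case False
    then have "n + int i > N" using assms(2) by simp
    then show ?thesis using assms(1) by (simp add: gc_L1_pow filtration_iff)
  qed
  then show ?thesis by (intro gc_inject) auto
qed

lemma ex_filtration: "\<exists>N::nat. v \<in> voa_filtration A (int N)"
proof -
  obtain N where N: "\<forall>n\<in>{n. gc v n \<noteq> 0}. n \<le> N" using finite_gc[of v] by (meson finite_has_maximal2 bdd_above.E bdd_above_finite)
  have "gc v n = 0" if "n > int (nat N)" for n
  proof (rule ccontr)
    assume "gc v n \<noteq> 0"
    then have "n \<le> N" using N by blast
    with that show False by linarith
  qed
  then show ?thesis unfolding filtration_iff by blast
qed

lemma filtration_mono: "v \<in> voa_filtration A N \<Longrightarrow> N \<le> M \<Longrightarrow> v \<in> voa_filtration A M"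
  by (auto simp: filtration_iff)

lemma exp_L1_eq:
  assumes "v \<in> voa_filtration A (int N)"
  shows "exp_L1 A x v = (\<Sum>i\<le>N. sc (x ^ i / fact i) ((L1 ^^ i) v))"
  unfolding exp_L1_def
proof (rule Sum_any.expand_superset)
  show "{i. sc (x ^ i / fact i) ((L1 ^^ i) v) \<noteq> 0} \<subseteq> {..N}"
    using L1_pow_vanish[OF assms] by (auto intro: ccontr)
qed simp

lemma exp_L1_filtration:
  assumes "v \<in> voa_filtration A (int N)" shows "exp_L1 A x v \<in> voa_filtration A (int N)"
  using assms unfolding exp_L1_eq[OF assms] filtration_iff
  by (auto simp: gc_sum gc_scale gc_L1_pow)

text \<open>The double sum may be restricted to \<open>i + l \<le> N\<close> because \<open>L(1)\<close> is nilpotent on vectors of bounded degree; then the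
binomial theorem applies degree by degree.\<close>

lemma exp_L1_add:
  "exp_L1 A x (exp_L1 A y v) = exp_L1 A (x + y) v"
proof -
  obtain N where N: "v \<in> voa_filtration A (int N)" using ex_filtration by blast
  define g where "g i l = sc (x ^ i / fact i * (y ^ l / fact l)) ((L1 ^^ (i + l)) v)" for i l
  have van: "g i l = 0" if "i + l > N" for i l using L1_pow_vanish[OF N, of "i + l"] that by (simp add: g_def)
  have "exp_L1 A x (exp_L1 A y v) = (\<Sum>i\<le>N. \<Sum>l\<le>N. g i l)"
    by (subst exp_L1_eq[OF exp_L1_filtration[OF N]], subst exp_L1_eq[OF N])
       (simp add: L1_pow_sum V.scale_sum_right L1_pow_scale g_def funpow_add)
  also have "\<dots> = (\<Sum>i\<le>N. \<Sum>l\<le>N - i. g i l)"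
    by (intro sum.cong refl sum.mono_neutral_right) (auto intro!: van)
  also have "\<dots> = (\<Sum>(i, l)\<in>{(i, l). i + l \<le> N}. g i l)"
    by (simp add: sum.Sigma, rule sum.cong) auto
  also have "\<dots> = (\<Sum>s\<le>N. \<Sum>i\<le>s. g i (s - i))" by (rule sum.triangle_reindex_eq)
  also have "\<dots> = (\<Sum>s\<le>N. sc ((x + y) ^ s / fact s) ((L1 ^^ s) v))"
  proof (rule sum.cong[OF refl])
    fix s
    have "(\<Sum>i\<le>s. x ^ i / fact i * (y ^ (s - i) / fact (s - i))) = (x + y) ^ s / fact s"
      unfolding binomial_ring sum_divide_distrib
      by (intro sum.cong refl) (simp add: binomial_fact)
    then show "(\<Sum>i\<le>s. g i (s - i)) = sc ((x + y) ^ s / fact s) ((L1 ^^ s) v)"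
      unfolding g_def by (simp add: V.scale_sum_left[symmetric])
  qed
  also have "\<dots> = exp_L1 A (x + y) v" by (rule exp_L1_eq[OF N, symmetric])
  finally show ?thesis .
qed

lemma exp_L1_0 [simp]: "exp_L1 A 0 v = v"
proof -
  obtain N where N: "v \<in> voa_filtration A (int N)" using ex_filtration by blast
  have "exp_L1 A 0 v = (\<Sum>i\<le>N. if i = 0 then v else 0)"
    unfolding exp_L1_eq[OF N] by (intro sum.cong refl) (auto simp: power_0_left)
  then show ?thesis by simp
qed

lemma gc_pow_neg_2L0: "gc (pow_neg_2L0 A x v) n = sc (x powi (- 2 * n)) (gc v n)"
proof -
  have "graded_decomp A (pow_neg_2L0 A x v) (\<lambda>n. sc (x powi (- 2 * n)) (gc v n))"
    unfolding graded_decomp_def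
  proof (intro conjI allI)
    show "sc (x powi (- 2 * n)) (gc v n) \<in> voa_grade A n" for n
      by (intro V.subspace_scale subspace_grade gc_in_grade)
    show "finite {n. sc (x powi (- 2 * n)) (gc v n) \<noteq> 0}"
      by (rule finite_subset[OF _ finite_gc[of v]]) auto
  qed (simp add: pow_neg_2L0_def)
  from gc_eqI[OF this] show ?thesis by simp
qed

lemma pow_neg_2L0_inverse:
  assumes "x \<noteq> 0" shows "pow_neg_2L0 A x (pow_neg_2L0 A (inverse x) v) = v"
proof (rule gc_inject, rule ext)
  fix n
  have "x powi (- 2 * n) * inverse x powi (- 2 * n) = 1"
    using assms by (simp add: power_int_inverse)
  then show "gc (pow_neg_2L0 A x (pow_neg_2L0 A (inverse x) v)) n = gc v n"
    by (simp add: gc_pow_neg_2L0 del: mult_minus_left)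
qed

text \<open>The two factors \<open>e\<^bsup>xL(1)\<^esup>\<close> and \<open>j\<^bsup>-2L(0)\<^esup>\<close> are inverted by changing the signs of the exponents.\<close>

lemma bij_K_factor:
  assumes "aut_factor \<gamma> \<tau> \<noteq> 0" shows "bij (K_factor A \<gamma> \<tau>)"
proof -
  let ?j = "aut_factor \<gamma> \<tau>" and ?x = "- of_real (vec_nth (vec_nth \<gamma> 2) 1) * aut_factor \<gamma> \<tau>"
  have 1: "bij (exp_L1 A ?x)"
    by (rule o_bij[where g = "exp_L1 A (- ?x)"]) (auto simp: fun_eq_iff exp_L1_add)
  have 2: "bij (pow_neg_2L0 A ?j)"
    using pow_neg_2L0_inverse[OF assms] pow_neg_2L0_inverse[of "inverse ?j"] assms
    by (intro o_bij[where g = "pow_neg_2L0 A (inverse ?j)"]) (auto simp: fun_eq_iff)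
  have "K_factor A \<gamma> \<tau> = exp_L1 A ?x \<circ> pow_neg_2L0 A ?j" by (auto simp: K_factor_def fun_eq_iff)
  then show ?thesis using bij_comp[OF 2 1] by simp
qed

lemma gc_K_factor:
  assumes "v \<in> voa_filtration A (int N)"
  shows "gc (K_factor A \<gamma> \<tau> v) n = (\<Sum>i\<le>N. sc ((- of_real (vec_nth (vec_nth \<gamma> 2) 1) * aut_factor \<gamma> \<tau>) ^ i / fact i
     * aut_factor \<gamma> \<tau> powi (- 2 * (n + int i))) ((L1 ^^ i) (gc v (n + int i))))"
proof -
  have "pow_neg_2L0 A (aut_factor \<gamma> \<tau>) v \<in> voa_filtration A (int N)"
    using assms by (auto simp: filtration_iff gc_pow_neg_2L0)
  then show ?thesis
    unfolding K_factor_def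
    by (simp add: exp_L1_eq gc_sum gc_scale gc_L1_pow gc_pow_neg_2L0 L1_pow_scale del: mult_minus_left)
qed

lemma K_factor_scale: "K_factor A \<gamma> \<tau> (sc c v) = sc c (K_factor A \<gamma> \<tau> v)"
proof -
  obtain N where N: "v \<in> voa_filtration A (int N)" using ex_filtration by blast
  then have N': "sc c v \<in> voa_filtration A (int N)" by (auto simp: filtration_iff gc_scale)
  show ?thesis
    by (rule gc_inject, rule ext)
       (simp add: gc_K_factor[OF N] gc_K_factor[OF N'] gc_scale L1_pow_scale V.scale_sum_right mult.commute)
qed

text \<open>Invariance under the slash action, solved for \<open>f(\<gamma>\<tau>)\<close> so that the inverse of \<open>K\<close> disappears.\<close>

lemma voa_slash_fixed_iff:
  assumes "aut_factor \<gamma> \<tau> \<noteq> 0"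
  shows "voa_slash A k \<gamma> f \<tau> = f \<tau> \<longleftrightarrow>
    f (moebius_action \<gamma> \<tau>) = sc (aut_factor \<gamma> \<tau> powi k) (K_factor A \<gamma> \<tau> (f \<tau>))"
proof -
  let ?j = "aut_factor \<gamma> \<tau>" and ?K = "K_factor A \<gamma> \<tau>"
  have bij: "bij ?K" by (rule bij_K_factor[OF assms])
  have j: "?j powi k \<noteq> 0" using assms by simp
  have inv1: "sc (?j powi k) (sc (?j powi (- k)) x) = x" and inv2: "sc (?j powi (- k)) (sc (?j powi k) x) = x" for x
    using j by (simp_all add: power_int_minus)
  have "voa_slash A k \<gamma> f \<tau> = f \<tau> \<longleftrightarrow> inv_into UNIV ?K (f (moebius_action \<gamma> \<tau>)) = sc (?j powi k) (f \<tau>)"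
    unfolding voa_slash_def by (metis inv1 inv2)
  also have "\<dots> \<longleftrightarrow> f (moebius_action \<gamma> \<tau>) = ?K (sc (?j powi k) (f \<tau>))"
    by (subst eq_commute, subst bij_inv_eq_iff[OF bij], rule eq_commute)
  finally show ?thesis by (simp add: K_factor_scale)
qed

lemma K_factor_add: "K_factor A \<gamma> \<tau> (v + w) = K_factor A \<gamma> \<tau> v + K_factor A \<gamma> \<tau> w"
proof -
  obtain N M where NM: "v \<in> voa_filtration A (int N)" "w \<in> voa_filtration A (int M)" using ex_filtration by blast
  let ?N = "max N M"
  have N: "v \<in> voa_filtration A (int ?N)" "w \<in> voa_filtration A (int ?N)"
    using NM filtration_mono by auto
  then have N': "v + w \<in> voa_filtration A (int ?N)" by (auto simp: filtration_iff gc_add)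
  show ?thesis
    by (rule gc_inject, rule ext)
       (simp only: gc_K_factor[OF N(1)] gc_K_factor[OF N(2)] gc_K_factor[OF N'] gc_add L1_pow_add V.scale_right_distrib sum.distrib)
qed

end

section \<open>Vector-valued forms and their top components\<close>

locale cocompact_group_voa = cocompact_fuchsian_group G + cft_type_voa A
  for G :: "(real^2^2) set" and A :: "('v::ab_group_add) voa"
begin

sublocale FV: vector_space "fun_scale sc :: complex \<Rightarrow> (complex \<Rightarrow> 'v) \<Rightarrow> _"
  by (rule vector_space_fun_scale[OF vector_space_scale])

sublocale FC: vector_space "fun_scale (*) :: complex \<Rightarrow> (complex \<Rightarrow> complex) \<Rightarrow> _"
  by (rule vector_space_fun_scale[OF vector_space_complex])

text \<open>The transformation law is written with \<open>K\<close> instead of its inverse, which keeps it linear in \<open>f\<close> on both sides.\<close>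

definition vector_forms :: "int \<Rightarrow> (complex \<Rightarrow> 'v) set" where
  "vector_forms k = {f. (\<exists>N. \<forall>\<tau>\<in>uhp. f \<tau> \<in> voa_filtration A N) \<and> vholomorphic_on sc f uhp \<and>
     (\<forall>\<tau>. \<tau> \<notin> uhp \<longrightarrow> f \<tau> = 0) \<and>
     (\<forall>\<gamma>\<in>G. \<forall>\<tau>\<in>uhp. f (moebius_action \<gamma> \<tau>) = sc (aut_factor \<gamma> \<tau> powi k) (K_factor A \<gamma> \<tau> (f \<tau>)))}"

text \<open>The filtration of the space of forms by the degree of the top component. The value \<open>p = -1\<close> gives the zero space and
starts the induction on \<open>p\<close>.\<close>

definition filtered_forms :: "int \<Rightarrow> int \<Rightarrow> (complex \<Rightarrow> 'v) set" where
  "filtered_forms k p = {f \<in> vector_forms k. \<forall>\<tau>. f \<tau> \<in> voa_filtration A p}"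

definition top_component :: "int \<Rightarrow> (complex \<Rightarrow> 'v) \<Rightarrow> complex \<Rightarrow> 'v" where
  "top_component p f \<tau> = gc (f \<tau>) p"

lemma linear_top_component: "Vector_Spaces.linear (fun_scale sc) (fun_scale sc) (top_component p)"
  by unfold_locales (auto simp: top_component_def fun_scale_def gc_add gc_scale fun_eq_iff)

lemma vector_formsD:
  assumes "f \<in> vector_forms k"
  shows "vholomorphic_on sc f uhp" "\<tau> \<notin> uhp \<Longrightarrow> f \<tau> = 0"
    "\<gamma> \<in> G \<Longrightarrow> \<tau> \<in> uhp \<Longrightarrow> f (moebius_action \<gamma> \<tau>) = sc (aut_factor \<gamma> \<tau> powi k) (K_factor A \<gamma> \<tau> (f \<tau>))"
  using assms by (auto simp: vector_forms_def)

lemma subspace_vector_forms: "FV.subspace (vector_forms k)"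
proof -
  have add: "f + g \<in> vector_forms k" if f: "f \<in> vector_forms k" and g: "g \<in> vector_forms k" for f g
  proof -
    obtain N M where "\<forall>\<tau>\<in>uhp. f \<tau> \<in> voa_filtration A N" "\<forall>\<tau>\<in>uhp. g \<tau> \<in> voa_filtration A M"
      using f g by (auto simp: vector_forms_def)
    then have 1: "\<forall>\<tau>\<in>uhp. (f + g) \<tau> \<in> voa_filtration A (max N M)"
      by (auto simp: filtration_iff gc_add)
    have 2: "vholomorphic_on sc (f + g) uhp"
      unfolding vholomorphic_on_def
    proof (intro allI impI)
      fix \<phi> :: "'v \<Rightarrow> complex" assume \<phi>: "Vector_Spaces.linear sc (*) \<phi>"
      interpret L: Vector_Spaces.linear sc "(*)" \<phi> by (rule \<phi>)
      have "(\<lambda>z. \<phi> (f z)) holomorphic_on uhp" "(\<lambda>z. \<phi> (g z)) holomorphic_on uhp"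
        using vector_formsD(1)[OF f] vector_formsD(1)[OF g] \<phi> by (auto simp: vholomorphic_on_def)
      then show "(\<lambda>z. \<phi> ((f + g) z)) holomorphic_on uhp" by (simp add: L.add holomorphic_on_add)
    qed
    show ?thesis
      using 1 2 vector_formsD(2,3)[OF f] vector_formsD(2,3)[OF g]
      unfolding vector_forms_def by (auto simp: K_factor_add V.scale_right_distrib)
  qed
  have scale: "fun_scale sc c f \<in> vector_forms k" if f: "f \<in> vector_forms k" for f c
  proof -
    obtain N where "\<forall>\<tau>\<in>uhp. f \<tau> \<in> voa_filtration A N"
      using f by (auto simp: vector_forms_def)
    then have 1: "\<forall>\<tau>\<in>uhp. fun_scale sc c f \<tau> \<in> voa_filtration A N"
      by (auto simp: filtration_iff gc_scale fun_scale_def)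
    have 2: "vholomorphic_on sc (fun_scale sc c f) uhp"
      unfolding vholomorphic_on_def
    proof (intro allI impI)
      fix \<phi> :: "'v \<Rightarrow> complex" assume \<phi>: "Vector_Spaces.linear sc (*) \<phi>"
      interpret L: Vector_Spaces.linear sc "(*)" \<phi> by (rule \<phi>)
      have "(\<lambda>z. \<phi> (f z)) holomorphic_on uhp"
        using vector_formsD(1)[OF f] \<phi> by (auto simp: vholomorphic_on_def)
      then show "(\<lambda>z. \<phi> (fun_scale sc c f z)) holomorphic_on uhp"
        by (simp add: L.scale fun_scale_def holomorphic_on_mult)
    qed
    show ?thesis
      using 1 2 vector_formsD(2,3)[OF f]
      unfolding vector_forms_def by (auto simp: K_factor_scale fun_scale_def mult.commute)
  qed
  have zero: "0 \<in> vector_forms k"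
  proof -
    have K0: "K_factor A \<gamma> \<tau> 0 = 0" for \<gamma> \<tau> using K_factor_scale[of \<gamma> \<tau> 0 0] by simp
    have "vholomorphic_on sc 0 uhp"
      unfolding vholomorphic_on_def
    proof (intro allI impI)
      fix \<phi> :: "'v \<Rightarrow> complex" assume \<phi>: "Vector_Spaces.linear sc (*) \<phi>"
      interpret L: Vector_Spaces.linear sc "(*)" \<phi> by (rule \<phi>)
      show "(\<lambda>z. \<phi> (0 z)) holomorphic_on uhp" by (simp add: L.zero)
    qed
    then show ?thesis by (auto simp: vector_forms_def filtration_iff K0)
  qed
  show ?thesis using add scale zero by (auto simp: FV.subspace_def)
qed

lemma subspace_filtered_forms: "FV.subspace (filtered_forms k p)"
  using subspace_vector_forms[of k]
  by (auto simp: FV.subspace_def filtered_forms_def filtration_iff gc_add gc_scale fun_scale_def)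

lemma holomorphic_component:
  assumes "vholomorphic_on sc f uhp" "Vector_Spaces.linear sc (*) \<phi>"
  shows "(\<lambda>\<tau>. \<phi> (gc (f \<tau>) n)) holomorphic_on uhp"
proof -
  have "Vector_Spaces.linear sc (*) (\<lambda>v. \<phi> (gc v n))"
    using Vector_Spaces.linear_compose[OF linear_gc assms(2), of n] by (simp add: o_def)
  then show ?thesis using assms(1) by (auto simp: vholomorphic_on_def)
qed

text \<open>Only the term without \<open>L(1)\<close> reaches the top degree, and only the first power of \<open>L(1)\<close> connects the top degree with
the next one.\<close>

lemma top_component_moebius:
  assumes f: "f \<in> filtered_forms k (int p)" and \<gamma>: "\<gamma> \<in> G" and \<tau>: "\<tau> \<in> uhp"
  shows "gc (f (moebius_action \<gamma> \<tau>)) (int p) = sc (aut_factor \<gamma> \<tau> powi (k - 2 * int p)) (gc (f \<tau>) (int p))"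
    "gc (f (moebius_action \<gamma> \<tau>)) (int p - 1) = sc (aut_factor \<gamma> \<tau> powi (k - 2 * int p + 2)) (gc (f \<tau>) (int p - 1))
       - sc (of_real (entry \<gamma> 2 1) * aut_factor \<gamma> \<tau> powi (k - 2 * int p + 1)) (L1 (gc (f \<tau>) (int p)))"
proof -
  let ?j = "aut_factor \<gamma> \<tau>" and ?c = "complex_of_real (entry \<gamma> 2 1)"
  have j: "?j \<noteq> 0" using aut_factor_nonzero det_one \<gamma> \<tau> by blast
  have fv: "f \<in> vector_forms k" and fp: "f \<tau> \<in> voa_filtration A (int p)"
    using f by (auto simp: filtered_forms_def)
  \<comment> \<open>With one degree to spare the terms \<open>i = 0\<close> and \<open>i = 1\<close> are both present in the sum, even for \<open>p = 0\<close>.\<close>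
  have N: "f \<tau> \<in> voa_filtration A (int (Suc p))" using fp by (rule filtration_mono) simp
  have van: "gc (f \<tau>) (m + int i) = 0" if "m + int i > int p" for m i
    using fp that by (simp add: filtration_iff)
  note tr = vector_formsD(3)[OF fv \<gamma> \<tau>]
  have "gc (K_factor A \<gamma> \<tau> (f \<tau>)) (int p) = (\<Sum>i\<in>{0}. sc ((- ?c * ?j) ^ i / fact i * ?j powi (- 2 * (int p + int i))) ((L1 ^^ i) (gc (f \<tau>) (int p + int i))))"
    unfolding gc_K_factor[OF N] by (rule sum.mono_neutral_right) (auto simp: van)
  then show "gc (f (moebius_action \<gamma> \<tau>)) (int p) = sc (?j powi (k - 2 * int p)) (gc (f \<tau>) (int p))"
    unfolding tr gc_scale using j by (simp add: power_int_diff power_int_minus divide_inverse)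
  have "gc (K_factor A \<gamma> \<tau> (f \<tau>)) (int p - 1) = (\<Sum>i\<in>{0, 1}. sc ((- ?c * ?j) ^ i / fact i * ?j powi (- 2 * (int p - 1 + int i))) ((L1 ^^ i) (gc (f \<tau>) (int p - 1 + int i))))"
    unfolding gc_K_factor[OF N] by (rule sum.mono_neutral_right) (auto simp: van)
  also have "\<dots> = sc (?j powi (- 2 * (int p - 1))) (gc (f \<tau>) (int p - 1)) - sc (?c * ?j * ?j powi (- 2 * int p)) (L1 (gc (f \<tau>) (int p)))"
    by simp
  finally have K: "gc (K_factor A \<gamma> \<tau> (f \<tau>)) (int p - 1) = \<dots>" .
  have 1: "?j powi k * ?j powi (- 2 * (int p - 1)) = ?j powi (k - 2 * int p + 2)"
    using j by (simp add: power_int_add[symmetric] algebra_simps)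
  have 2: "?j powi k * (?c * ?j * ?j powi (- 2 * int p)) = ?c * ?j powi (k - 2 * int p + 1)"
  proof -
    have "?j powi (k - 2 * int p + 1) = ?j powi k * ?j powi (- 2 * int p) * ?j"
      using j by (simp add: power_int_add power_int_diff power_int_minus divide_inverse)
    then show ?thesis by (simp add: mult_ac)
  qed
  show "gc (f (moebius_action \<gamma> \<tau>)) (int p - 1) = sc (?j powi (k - 2 * int p + 2)) (gc (f \<tau>) (int p - 1))
       - sc (?c * ?j powi (k - 2 * int p + 1)) (L1 (gc (f \<tau>) (int p)))"
    unfolding tr gc_scale K V.scale_right_diff_distrib V.scale_scale 1 2 ..
qed

lemma top_component_automorphic:
  assumes f: "f \<in> filtered_forms k (int p)" and \<phi>: "Vector_Spaces.linear sc (*) \<phi>"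
  shows "(\<lambda>\<tau>. \<phi> (gc (f \<tau>) (int p))) \<in> scalar_forms (k - 2 * int p)"
proof -
  interpret L: Vector_Spaces.linear sc "(*)" \<phi> by (rule \<phi>)
  have fv: "f \<in> vector_forms k" using f by (auto simp: filtered_forms_def)
  show ?thesis
    unfolding scalar_forms_def automorphic_def
    using holomorphic_component[OF vector_formsD(1)[OF fv] \<phi>] top_component_moebius(1)[OF f] vector_formsD(2)[OF fv]
    by (auto simp: L.scale L.zero)
qed

lemma kernel_top_component:
  "{f \<in> filtered_forms k p. top_component p f = 0} = filtered_forms k (p - 1)"
proof (intro equalityI subsetI)
  fix f assume f: "f \<in> {f \<in> filtered_forms k p. top_component p f = 0}"
  then have "gc (f \<tau>) m = 0" if "m > p - 1" for \<tau> m
  proof (cases "m = p")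
    case True
    have "top_component p f \<tau> = 0" using f by simp
    then show ?thesis by (simp add: top_component_def True)
  qed (use f that in \<open>auto simp: filtered_forms_def filtration_iff\<close>)
  with f show "f \<in> filtered_forms k (p - 1)" by (auto simp: filtered_forms_def filtration_iff)
next
  fix f assume "f \<in> filtered_forms k (p - 1)"
  then show "f \<in> {f \<in> filtered_forms k p. top_component p f = 0}"
    by (auto simp: filtered_forms_def filtration_iff top_component_def fun_eq_iff)
qed

text \<open>The component of degree \<open>p\<close> has the negative weight \<open>2(n - p)\<close>.\<close>

lemma filtered_forms_lower:
  assumes f: "f \<in> filtered_forms (2 * int n) (int p)" and "p > n"
  shows "f \<in> filtered_forms (2 * int n) (int p - 1)"
proof -
  have "gc (f \<tau>) (int p) = 0" for \<tau>
  proof (cases "\<tau> \<in> uhp")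
    case True
    show ?thesis
    proof (rule ccontr)
      assume "gc (f \<tau>) (int p) \<noteq> 0"
      then obtain \<phi> where \<phi>: "Vector_Spaces.linear sc (*) \<phi>" "\<phi> (gc (f \<tau>) (int p)) = 1"
        using V.separating_functional by blast
      have "2 * int n - 2 * int p = - 2 * int (p - n)" using assms(2) by linarith
      with top_component_automorphic[OF f \<phi>(1)]
      have "(\<lambda>\<tau>. \<phi> (gc (f \<tau>) (int p))) \<in> scalar_forms (- 2 * int (p - n))" by (simp only:)
      then have aut: "automorphic (- 2 * int (p - n)) (\<lambda>\<tau>. \<phi> (gc (f \<tau>) (int p)))"
        by (simp only: scalar_forms_def mem_Collect_eq)
      have "p - n > 0" using assms(2) by simp
      from automorphic_negative_weight_zero[OF aut this True] \<phi>(2) show False by simp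
    qed
  next
    case False
    have "f \<in> vector_forms (2 * int n)" using f by (simp add: filtered_forms_def)
    from vector_formsD(2)[OF this False] show ?thesis by simp
  qed
  then have "top_component (int p) f = 0" by (simp add: top_component_def fun_eq_iff)
  then show ?thesis using f kernel_top_component[of "2 * int n" "int p"] by blast
qed

lemma vector_forms_eq_filtered: "vector_forms (2 * int n) = filtered_forms (2 * int n) (int n)"
proof
  show "filtered_forms (2 * int n) (int n) \<subseteq> vector_forms (2 * int n)" by (auto simp: filtered_forms_def)
  show "vector_forms (2 * int n) \<subseteq> filtered_forms (2 * int n) (int n)"
  proof
    fix f assume f: "f \<in> vector_forms (2 * int n)"
    have down: "f \<in> filtered_forms (2 * int n) (int (n + d)) \<Longrightarrow> f \<in> filtered_forms (2 * int n) (int n)" for d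
    proof (induction d)
      case (Suc d)
      then have "f \<in> filtered_forms (2 * int n) (int (n + Suc d) - 1)" by (intro filtered_forms_lower) auto
      then show ?case using Suc.IH by simp
    qed simp
    obtain N where N: "\<forall>\<tau>\<in>uhp. f \<tau> \<in> voa_filtration A N" using f by (auto simp: vector_forms_def)
    have "f \<tau> \<in> voa_filtration A (int (n + nat N))" for \<tau>
    proof (cases "\<tau> \<in> uhp")
      case True
      then show ?thesis using N filtration_mono[of "f \<tau>" N] by simp
    next
      case False
      then show ?thesis using vector_formsD(2)[OF f] by (simp add: filtration_iff)
    qed
    then have "f \<in> filtered_forms (2 * int n) (int (n + nat N))" using f by (simp add: filtered_forms_def)
    then show "f \<in> filtered_forms (2 * int n) (int n)" by (rule down)
  qed
qed

section \<open>Lifting scalar forms of positive weight\<close>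

text \<open>The lift of \<open>F \<otimes> v\<close> of weight \<open>w + 2p\<close>: the \<open>m\<close>-th summand has degree \<open>p - m\<close>, and its
weight \<open>w + 2m\<close> is the one required in that degree.\<close>

definition kuznetsov_lift :: "nat \<Rightarrow> nat \<Rightarrow> (complex \<Rightarrow> complex) \<Rightarrow> 'v \<Rightarrow> complex \<Rightarrow> 'v" where
  "kuznetsov_lift w p F v \<tau> = (if \<tau> \<in> uhp then
     \<Sum>m\<le>p. sc ((- 1) ^ m * normalized_derivative w F m \<tau>) ((L1 ^^ m) v) else 0)"

lemma gc_kuznetsov_lift:
  assumes v: "v \<in> voa_grade A (int p)" and \<tau>: "\<tau> \<in> uhp"
  shows "s \<le> p \<Longrightarrow> gc (kuznetsov_lift w p F v \<tau>) (int p - int s) = sc ((- 1) ^ s * normalized_derivative w F s \<tau>) ((L1 ^^ s) v)"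
    and "m > int p \<Longrightarrow> gc (kuznetsov_lift w p F v \<tau>) m = 0"
proof -
  have g: "gc ((L1 ^^ i) v) m = (if m = int p - int i then (L1 ^^ i) v else 0)" for i m
    by (rule gc_homogeneous[OF L1_pow_grade[OF v]])
  show "gc (kuznetsov_lift w p F v \<tau>) (int p - int s) = sc ((- 1) ^ s * normalized_derivative w F s \<tau>) ((L1 ^^ s) v)" if "s \<le> p"
  proof -
    have "gc (kuznetsov_lift w p F v \<tau>) (int p - int s)
       = (\<Sum>m\<le>p. if m = s then sc ((- 1) ^ m * normalized_derivative w F m \<tau>) ((L1 ^^ m) v) else 0)"
      unfolding kuznetsov_lift_def by (simp only: \<tau> if_True gc_sum gc_scale g) (intro sum.cong, auto)
    then show ?thesis using that by simp
  qed
  show "gc (kuznetsov_lift w p F v \<tau>) m = 0" if "m > int p"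
    unfolding kuznetsov_lift_def using \<tau> that by (auto simp: gc_sum gc_scale g intro!: sum.neutral)
qed

text \<open>In degree \<open>p - s\<close> both sides are multiples of \<open>L(1)\<^sup>s v\<close>. The multiples agree by the transformation law of the normalised
derivatives, where the sign \<open>(-1)\<^sup>m\<close> in the lift turns \<open>e\<^bsup>-cjL(1)\<^esup>\<close> into the positive coefficients of that law.\<close>

lemma kuznetsov_lift_in_filtered_forms:
  assumes F: "automorphic (int w) F" and w: "w > 0" and v: "v \<in> voa_grade A (int p)" and k: "k = int w + 2 * int p"
  shows "kuznetsov_lift w p F v \<in> filtered_forms k (int p)"
proof -
  let ?f = "kuznetsov_lift w p F v" and ?N = "normalized_derivative w F"
  have fil: "?f \<tau> \<in> voa_filtration A (int p)" for \<tau>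
    using gc_kuznetsov_lift(2)[OF v, of \<tau>] by (cases "\<tau> \<in> uhp") (auto simp: filtration_iff kuznetsov_lift_def)
  have hol: "vholomorphic_on sc ?f uhp"
    unfolding vholomorphic_on_def
  proof (intro allI impI)
    fix \<phi> :: "'v \<Rightarrow> complex" assume \<phi>: "Vector_Spaces.linear sc (*) \<phi>"
    interpret L: Vector_Spaces.linear sc "(*)" \<phi> by (rule \<phi>)
    have "(\<lambda>\<tau>. \<Sum>m\<le>p. (- 1) ^ m * ?N m \<tau> * \<phi> ((L1 ^^ m) v)) holomorphic_on uhp"
      by (intro holomorphic_intros normalized_derivative_holomorphic[OF automorphicD(1)[OF F] w])
    then show "(\<lambda>\<tau>. \<phi> (?f \<tau>)) holomorphic_on uhp"
      by (rule holomorphic_transform) (simp add: kuznetsov_lift_def L.sum L.scale)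
  qed
  have tr: "?f (moebius_action \<gamma> \<tau>) = sc (aut_factor \<gamma> \<tau> powi k) (K_factor A \<gamma> \<tau> (?f \<tau>))"
    if \<gamma>: "\<gamma> \<in> G" and \<tau>: "\<tau> \<in> uhp" for \<gamma> \<tau>
  proof (rule gc_inject, rule ext)
    fix m
    let ?j = "aut_factor \<gamma> \<tau>" and ?c = "complex_of_real (entry \<gamma> 2 1)"
    have j: "?j \<noteq> 0" using aut_factor_nonzero det_one \<gamma> \<tau> by blast
    have g\<tau>: "moebius_action \<gamma> \<tau> \<in> uhp" using moebius_action_in_uhp det_one \<gamma> \<tau> by blast
    consider "m > int p" | "m < 0" | "0 \<le> m" "m \<le> int p" by linarith
    then show "gc (?f (moebius_action \<gamma> \<tau>)) m = gc (sc (?j powi k) (K_factor A \<gamma> \<tau> (?f \<tau>))) m"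
    proof cases
      case 1
      then have "gc (?f \<tau>) (m + int i) = 0" for i by (intro gc_kuznetsov_lift(2)[OF v \<tau>]) simp
      then show ?thesis
        using 1 by (simp add: gc_kuznetsov_lift(2)[OF v g\<tau>] gc_scale gc_K_factor[OF fil])
    next
      case 2
      then show ?thesis by (simp add: gc_neg)
    next
      case 3
      define s where "s = p - nat m"
      have s: "s \<le> p" "m = int p - int s" using 3 by (auto simp: s_def)
      let ?T = "\<lambda>i. sc ((- ?c * ?j) ^ i / fact i * ?j powi (- 2 * (m + int i))) ((L1 ^^ i) (gc (?f \<tau>) (m + int i)))"
      have coef: "?j powi k * ((- ?c * ?j) ^ i / fact i * ?j powi (- 2 * (m + int i)) * ((- 1) ^ (s - i) * ?N (s - i) \<tau>))
          = (- 1) ^ s * (?c ^ (s - (s - i)) / fact (s - (s - i)) * ?j ^ (w + s + (s - i)) * ?N (s - i) \<tau>)" if i: "i \<le> s" for i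
      proof -
        have e: "k + int i + - 2 * (m + int i) = int (w + s + (s - i))" using i by (simp add: k s(2) of_nat_diff algebra_simps)
        have "?j powi k * ?j powi int i * ?j powi (- 2 * (m + int i)) = ?j powi int (w + s + (s - i))"
          unfolding e[symmetric] by (simp only: power_int_add[OF disjI1[OF j]])
        then have J: "?j powi k * ?j ^ i * ?j powi (- 2 * (m + int i)) = ?j ^ (w + s + (s - i))"
          by (simp only: power_int_of_nat)
        have S: "(- 1) ^ i * (- 1) ^ (s - i) = ((- 1) ^ s :: complex)" using i by (simp flip: power_add)
        have M: "(- ?c * ?j) ^ i = (- 1) ^ i * ?c ^ i * ?j ^ i" by (simp add: power_mult_distrib power_minus')
        have "?j powi k * ((- ?c * ?j) ^ i / fact i * ?j powi (- 2 * (m + int i)) * ((- 1) ^ (s - i) * ?N (s - i) \<tau>))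
            = ((- 1) ^ i * (- 1) ^ (s - i)) * (?c ^ i / fact i * (?j powi k * ?j ^ i * ?j powi (- 2 * (m + int i))) * ?N (s - i) \<tau>)"
          unfolding M by (simp only: divide_inverse mult_ac)
        moreover have "s - (s - i) = i" using i by simp
        ultimately show ?thesis unfolding J S by simp
      qed
      have "gc (sc (?j powi k) (K_factor A \<gamma> \<tau> (?f \<tau>))) m = sc (?j powi k) (\<Sum>i\<le>p. ?T i)"
        unfolding gc_scale gc_K_factor[OF fil] ..
      also have "(\<Sum>i\<le>p. ?T i) = (\<Sum>i\<le>s. ?T i)"
      proof (rule sum.mono_neutral_right)
        show "\<forall>i\<in>{..p} - {..s}. ?T i = 0"
        proof
          fix i assume "i \<in> {..p} - {..s}"
          then have "m + int i > int p" using s by auto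
          then show "?T i = 0" using gc_kuznetsov_lift(2)[OF v \<tau>] by simp
        qed
      qed (use s in auto)
      also have "\<dots> = (\<Sum>i\<le>s. sc ((- ?c * ?j) ^ i / fact i * ?j powi (- 2 * (m + int i)) * ((- 1) ^ (s - i) * ?N (s - i) \<tau>)) ((L1 ^^ s) v))"
      proof (rule sum.cong[OF refl])
        fix i assume "i \<in> {..s}"
        then have i: "i \<le> s" by simp
        then have mi: "m + int i = int p - int (s - i)" and "s - i \<le> p" using s by simp_all
        then have "gc (?f \<tau>) (m + int i) = sc ((- 1) ^ (s - i) * ?N (s - i) \<tau>) ((L1 ^^ (s - i)) v)"
          unfolding mi by (intro gc_kuznetsov_lift(1)[OF v \<tau>])
        moreover have "(L1 ^^ i) ((L1 ^^ (s - i)) v) = (L1 ^^ s) v"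
          using i funpow_add[of i "s - i" L1] by simp
        ultimately show "?T i = sc ((- ?c * ?j) ^ i / fact i * ?j powi (- 2 * (m + int i)) * ((- 1) ^ (s - i) * ?N (s - i) \<tau>)) ((L1 ^^ s) v)"
          by (simp only: L1_pow_scale V.scale_scale)
      qed
      also have "sc (?j powi k) \<dots> = sc (\<Sum>i\<le>s. (- 1) ^ s * (?c ^ (s - (s - i)) / fact (s - (s - i)) * ?j ^ (w + s + (s - i)) * ?N (s - i) \<tau>)) ((L1 ^^ s) v)"
        unfolding V.scale_sum_left[symmetric] V.scale_scale sum_distrib_left
        by (intro arg_cong2[where f = sc] sum.cong refl coef) simp
      also have "(\<Sum>i\<le>s. (- 1) ^ s * (?c ^ (s - (s - i)) / fact (s - (s - i)) * ?j ^ (w + s + (s - i)) * ?N (s - i) \<tau>))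
          = (\<Sum>l\<le>s. (- 1) ^ s * (?c ^ (s - l) / fact (s - l) * ?j ^ (w + s + l) * ?N l \<tau>))"
        by (rule sum.reindex_bij_witness[of _ "\<lambda>l. s - l" "\<lambda>i. s - i"]) auto
      also have "\<dots> = (- 1) ^ s * ?N s (moebius_action \<gamma> \<tau>)"
        unfolding normalized_derivative_moebius[OF F w \<gamma> \<tau>] sum_distrib_left ..
      finally show ?thesis
        using gc_kuznetsov_lift(1)[OF v g\<tau> s(1)] s(2) by simp
    qed
  qed
  have "\<forall>\<tau>. \<tau> \<notin> uhp \<longrightarrow> ?f \<tau> = 0" by (simp add: kuznetsov_lift_def)
  with fil hol tr show ?thesis
    unfolding filtered_forms_def vector_forms_def by blast
qed

text \<open>Top components always have coordinates in the scalar forms of weight \<open>2n - 2p\<close>; conversely the lifts realise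
all products, and the set of top components is a subspace.\<close>

lemma image_top_component:
  assumes "p < n"
  shows "top_component (int p) ` filtered_forms (2 * int n) (int p)
    = tensor_forms sc (scalar_forms (2 * int n - 2 * int p)) (voa_grade A (int p))"
proof
  show "top_component (int p) ` filtered_forms (2 * int n) (int p)
    \<subseteq> tensor_forms sc (scalar_forms (2 * int n - 2 * int p)) (voa_grade A (int p))"
  proof (rule image_subsetI)
    fix f assume f: "f \<in> filtered_forms (2 * int n) (int p)"
    show "top_component (int p) f \<in> tensor_forms sc (scalar_forms (2 * int n - 2 * int p)) (voa_grade A (int p))"
      by (rule in_tensor_forms[OF vector_space_scale grade_finite_dim])
         (use top_component_automorphic[OF f] in \<open>auto simp: top_component_def gc_in_grade\<close>)
  qed
  interpret T: Vector_Spaces.linear "fun_scale sc" "fun_scale sc" "top_component (int p)"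
    by (rule linear_top_component)
  show "tensor_forms sc (scalar_forms (2 * int n - 2 * int p)) (voa_grade A (int p))
    \<subseteq> top_component (int p) ` filtered_forms (2 * int n) (int p)"
    unfolding tensor_forms_def
  proof (rule FV.span_minimal)
    show "FV.subspace (top_component (int p) ` filtered_forms (2 * int n) (int p))"
      by (rule T.subspace_image[OF subspace_filtered_forms])
    show "{\<lambda>\<tau>. sc (F \<tau>) v |F v. F \<in> scalar_forms (2 * int n - 2 * int p) \<and> v \<in> voa_grade A (int p)}
      \<subseteq> top_component (int p) ` filtered_forms (2 * int n) (int p)"
    proof safe
      fix F v assume F: "F \<in> scalar_forms (2 * int n - 2 * int p)" and v: "v \<in> voa_grade A (int p)"
      define w where "w = 2 * (n - p)"
      have w: "w > 0" "int w = 2 * int n - 2 * int p" using assms by (auto simp: w_def)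
      have "kuznetsov_lift w p F v \<in> filtered_forms (2 * int n) (int p)"
        by (rule kuznetsov_lift_in_filtered_forms[OF _ w(1) v]) (use F w in \<open>auto simp: scalar_forms_def\<close>)
      moreover have "top_component (int p) (kuznetsov_lift w p F v) = (\<lambda>\<tau>. sc (F \<tau>) v)"
      proof
        fix \<tau>
        show "top_component (int p) (kuznetsov_lift w p F v) \<tau> = sc (F \<tau>) v"
        proof (cases "\<tau> \<in> uhp")
          case True
          then show ?thesis using gc_kuznetsov_lift(1)[OF v True, of 0] by (simp add: top_component_def)
        next
          case False
          then show ?thesis using F by (simp add: top_component_def kuznetsov_lift_def scalar_forms_def)
        qed
      qed
      ultimately show "(\<lambda>\<tau>. sc (F \<tau>) v) \<in> top_component (int p) ` filtered_forms (2 * int n) (int p)"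
        by (metis imageI)
    qed
  qed
qed

section \<open>The top component of weight zero\<close>

text \<open>In weight zero the top component is a constant \<open>v\<close>. A functional that does not vanish at \<open>L(1) v\<close> would turn the next
component into a function with the affine transformation law of weight two.\<close>

lemma top_component_quasi_primary:
  assumes f: "f \<in> filtered_forms (2 * int n) (int n)"
  shows "gc (f \<tau>) (int n) \<in> quasi_primary A (int n)"
proof (cases "\<tau> \<in> uhp")
  case False
  have "f \<in> vector_forms (2 * int n)" using f by (simp add: filtered_forms_def)
  from vector_formsD(2)[OF this False] have "f \<tau> = 0" .
  moreover have "L1 0 = 0" using L1_pow_zero[of 1] by simp
  ultimately show ?thesis using V.subspace_0[OF subspace_grade] by (simp add: quasi_primary_def)
next
  case True
  define v where "v = gc (f \<tau>) (int n)"
  have const: "gc (f \<sigma>) (int n) = v" if \<sigma>: "\<sigma> \<in> uhp" for \<sigma>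
  proof (rule ccontr)
    assume "gc (f \<sigma>) (int n) \<noteq> v"
    then have "gc (f \<sigma>) (int n) - v \<noteq> 0" by simp
    then obtain \<phi> where \<phi>: "Vector_Spaces.linear sc (*) \<phi>" "\<phi> (gc (f \<sigma>) (int n) - v) = 1"
      using V.separating_functional by blast
    interpret L: Vector_Spaces.linear sc "(*)" \<phi> by (rule \<phi>(1))
    have "automorphic 0 (\<lambda>\<tau>. \<phi> (gc (f \<tau>) (int n)))"
      using top_component_automorphic[OF f \<phi>(1)] by (simp add: scalar_forms_def)
    then have "(\<lambda>\<tau>. \<phi> (gc (f \<tau>) (int n))) constant_on uhp" by (rule automorphic_weight_zero_constant)
    then have "\<phi> (gc (f \<sigma>) (int n)) = \<phi> v" using \<sigma> True unfolding v_def constant_on_def by metis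
    then show False using \<phi>(2) by (simp add: L.diff)
  qed
  have "L1 v = 0"
  proof (rule ccontr)
    assume "L1 v \<noteq> 0"
    then obtain \<phi> where \<phi>: "Vector_Spaces.linear sc (*) \<phi>" "\<phi> (L1 v) = 1"
      using V.separating_functional by blast
    interpret L: Vector_Spaces.linear sc "(*)" \<phi> by (rule \<phi>(1))
    show False
    proof (rule no_affine_weight_two_form[of "\<lambda>\<tau>. \<phi> (gc (f \<tau>) (int n - 1))"])
      show "(\<lambda>\<tau>. \<phi> (gc (f \<tau>) (int n - 1))) holomorphic_on uhp"
        using f by (intro holomorphic_component \<phi>(1) vector_formsD(1)) (auto simp: filtered_forms_def)
      fix \<gamma> \<sigma> assume "\<gamma> \<in> G" "\<sigma> \<in> uhp"
      then show "\<phi> (gc (f (moebius_action \<gamma> \<sigma>)) (int n - 1))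
        = (aut_factor \<gamma> \<sigma>)\<^sup>2 * \<phi> (gc (f \<sigma>) (int n - 1)) - of_real (entry \<gamma> 2 1) * aut_factor \<gamma> \<sigma>"
        using top_component_moebius(2)[OF f] by (simp add: const L.diff L.scale \<phi>(2))
    qed
  qed
  then show ?thesis using gc_in_grade[of "f \<tau>" "int n"] by (simp add: quasi_primary_def v_def)
qed

lemma subspace_quasi_primary: "V.subspace (quasi_primary A n)"
proof -
  have "L1 (u + v) = L1 u + L1 v" "L1 (sc c u) = sc c (L1 u)" "L1 0 = 0" for u v c
    using L1_pow_add[of 1] L1_pow_scale[of 1] L1_pow_zero[of 1] by simp_all
  then show ?thesis
    using subspace_grade[of n] by (auto simp: V.subspace_def quasi_primary_def)
qed

lemma finite_dim_quasi_primary: "finite_dim_subspace sc (quasi_primary A n)"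
  by (rule finite_dim_subspace_mono[OF vector_space_scale grade_finite_dim[of n] subspace_quasi_primary])
     (auto simp: quasi_primary_def)

text \<open>For a quasi-primary \<open>v \<in> V\<^sub>n\<close> the constant function \<open>v\<close> is a form of weight \<open>2n\<close>, as \<open>K v = j\<^bsup>-2n\<^esup> v\<close>.\<close>

lemma image_top_component_weight_zero:
  "top_component (int n) ` filtered_forms (2 * int n) (int n) = tensor_forms sc (scalar_forms 0) (quasi_primary A (int n))"
proof
  show "top_component (int n) ` filtered_forms (2 * int n) (int n) \<subseteq> tensor_forms sc (scalar_forms 0) (quasi_primary A (int n))"
  proof (rule image_subsetI)
    fix f assume f: "f \<in> filtered_forms (2 * int n) (int n)"
    show "top_component (int n) f \<in> tensor_forms sc (scalar_forms 0) (quasi_primary A (int n))"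
      by (rule in_tensor_forms[OF vector_space_scale finite_dim_quasi_primary])
         (use top_component_automorphic[OF f] top_component_quasi_primary[OF f] in \<open>auto simp: top_component_def\<close>)
  qed
  interpret T: Vector_Spaces.linear "fun_scale sc" "fun_scale sc" "top_component (int n)"
    by (rule linear_top_component)
  show "tensor_forms sc (scalar_forms 0) (quasi_primary A (int n)) \<subseteq> top_component (int n) ` filtered_forms (2 * int n) (int n)"
    unfolding tensor_forms_def
  proof (rule FV.span_minimal)
    show "FV.subspace (top_component (int n) ` filtered_forms (2 * int n) (int n))"
      by (rule T.subspace_image[OF subspace_filtered_forms])
    show "{\<lambda>\<tau>. sc (F \<tau>) v |F v. F \<in> scalar_forms 0 \<and> v \<in> quasi_primary A (int n)}
      \<subseteq> top_component (int n) ` filtered_forms (2 * int n) (int n)"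
    proof safe
      fix F v assume F: "F \<in> scalar_forms 0" and v: "v \<in> quasi_primary A (int n)"
      let ?f = "\<lambda>\<tau>. sc (F \<tau>) v"
      have vn: "v \<in> voa_grade A (int n)" and Lv: "L1 v = 0" using v by (auto simp: quasi_primary_def)
      have fil: "?f \<tau> \<in> voa_filtration A (int n)" for \<tau>
        using gc_homogeneous[OF vn] by (auto simp: filtration_iff gc_scale)
      have "(L1 ^^ i) v = (if i = 0 then v else 0)" for i
        by (cases i) (auto simp: funpow_Suc_right Lv simp del: funpow.simps)
      then have Lpow: "(L1 ^^ i) (sc c v) = (if i = 0 then sc c v else 0)" for i c
        by (simp add: L1_pow_scale)
      have "vholomorphic_on sc ?f uhp"
        unfolding vholomorphic_on_def
      proof (intro allI impI)
        fix \<phi> :: "'v \<Rightarrow> complex" assume \<phi>: "Vector_Spaces.linear sc (*) \<phi>"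
        interpret L: Vector_Spaces.linear sc "(*)" \<phi> by (rule \<phi>)
        have "F holomorphic_on uhp" using F automorphicD(1) by (auto simp: scalar_forms_def)
        then show "(\<lambda>\<tau>. \<phi> (?f \<tau>)) holomorphic_on uhp" by (simp add: L.scale holomorphic_on_mult)
      qed
      moreover have "?f (moebius_action \<gamma> \<tau>) = sc (aut_factor \<gamma> \<tau> powi (2 * int n)) (K_factor A \<gamma> \<tau> (?f \<tau>))"
        if \<gamma>: "\<gamma> \<in> G" and \<tau>: "\<tau> \<in> uhp" for \<gamma> \<tau>
      proof (rule gc_inject, rule ext)
        fix m
        let ?j = "aut_factor \<gamma> \<tau>"
        have j: "?j \<noteq> 0" using aut_factor_nonzero det_one \<gamma> \<tau> by blast
        have "F (moebius_action \<gamma> \<tau>) = F \<tau>"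
          using F \<gamma> \<tau> automorphicD(2)[of 0 F] by (auto simp: scalar_forms_def)
        moreover have "gc (K_factor A \<gamma> \<tau> (?f \<tau>)) m = sc (?j powi (- 2 * m)) (gc (?f \<tau>) m)"
        proof -
          have "gc (K_factor A \<gamma> \<tau> (?f \<tau>)) m = (\<Sum>i\<le>n. if i = 0 then sc (?j powi (- 2 * m)) (gc (?f \<tau>) m) else 0)"
            unfolding gc_K_factor[OF fil] gc_scale gc_homogeneous[OF vn]
            by (intro sum.cong) (auto simp: Lpow)
          then show ?thesis by simp
        qed
        ultimately show "gc (?f (moebius_action \<gamma> \<tau>)) m = gc (sc (?j powi (2 * int n)) (K_factor A \<gamma> \<tau> (?f \<tau>))) m"
          using j by (auto simp: gc_scale gc_homogeneous[OF vn] power_int_minus)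
      qed
      moreover have "\<forall>\<tau>. \<tau> \<notin> uhp \<longrightarrow> ?f \<tau> = 0" using F by (auto simp: scalar_forms_def)
      ultimately have "?f \<in> filtered_forms (2 * int n) (int n)"
        using fil unfolding filtered_forms_def vector_forms_def by blast
      moreover have "top_component (int n) ?f = ?f"
        by (simp add: top_component_def fun_eq_iff gc_scale gc_homogeneous[OF vn])
      ultimately show "?f \<in> top_component (int n) ` filtered_forms (2 * int n) (int n)"
        by (metis imageI)
    qed
  qed
qed

section \<open>The dimension formula\<close>

text \<open>One degree at a time by rank-nullity for the top component. Forms of filtration degree \<open>p - 1\<close> involve exactly the degrees \<open>j < p\<close>.\<close>

lemma dim_filtered_forms:
  assumes "p \<le> n"
  shows "finite_dim_subspace (fun_scale sc) (filtered_forms (2 * int n) (int p - 1)) \<and>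
    FV.dim (filtered_forms (2 * int n) (int p - 1)) =
      (\<Sum>j<p. FC.dim (scalar_forms (2 * int n - 2 * int j)) * V.dim (voa_grade A (int j)))"
  using assms
proof (induction p)
  case 0
  have "filtered_forms (2 * int n) (int 0 - 1) = {0}"
  proof
    show "filtered_forms (2 * int n) (int 0 - 1) \<subseteq> {0}"
    proof
      fix f assume f: "f \<in> filtered_forms (2 * int n) (int 0 - 1)"
      have "gc (f \<tau>) m = 0" for \<tau> m
        using f gc_neg[of m] by (cases "m < 0") (auto simp: filtered_forms_def filtration_iff)
      then have "f \<tau> = 0" for \<tau> by (intro gc_inject) auto
      then show "f \<in> {0}" by (auto simp: fun_eq_iff)
    qed
    show "{0} \<subseteq> filtered_forms (2 * int n) (int 0 - 1)"
      using FV.subspace_0[OF subspace_filtered_forms] by simp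
  qed
  then have eq: "FV.span {} = filtered_forms (2 * int n) (int 0 - 1)" by simp
  show ?case
    using finite_dim_subspaceI[OF FV.vector_space_axioms _ _ eq] FV.independent_empty by simp
next
  case (Suc p)
  have ker: "{f \<in> filtered_forms (2 * int n) (int p). top_component (int p) f = 0} = filtered_forms (2 * int n) (int p - 1)"
    by (rule kernel_top_component)
  have wt: "2 * int n - 2 * int p = 2 * int (n - p)" using Suc.prems by linarith
  have fin: "finite_dim_subspace (fun_scale (*)) (scalar_forms (2 * int n - 2 * int p))"
    unfolding wt by (rule finite_dim_scalar_forms)
  have img: "top_component (int p) ` filtered_forms (2 * int n) (int p)
    = tensor_forms sc (scalar_forms (2 * int n - 2 * int p)) (voa_grade A (int p))"
    using Suc.prems by (intro image_top_component) simp
  note tb = tensor_forms_basis[OF vector_space_scale fin grade_finite_dim[of "int p"]]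
  note IH = Suc.IH[OF Suc_leD[OF Suc.prems]]
  note rn = rank_nullity_subspace[OF linear_top_component[of "int p"] subspace_filtered_forms[of "2 * int n" "int p"], unfolded ker img, OF conjunct1[OF IH] tb(1)]
  have "int (Suc p) - 1 = int p" by simp
  then show ?case
    unfolding sum.lessThan_Suc conjunct2[OF IH, symmetric] tb(2)[symmetric] using rn by (simp only: simp_thms)
qed

theorem dim_vector_forms:
  "finite_dim_subspace (fun_scale sc) (vector_forms (2 * int n))"
  "FV.dim (vector_forms (2 * int n)) =
      (\<Sum>j<n. FC.dim (scalar_forms (2 * int n - 2 * int j)) * V.dim (voa_grade A (int j)))
      + V.dim (quasi_primary A (int n))"
proof -
  note ker = kernel_top_component[of "2 * int n" "int n"] and img = image_top_component_weight_zero[of n]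
  have fin: "finite_dim_subspace (fun_scale (*)) (scalar_forms 0)" using finite_dim_scalar_forms[of 0] by simp
  note tb = tensor_forms_basis[OF vector_space_scale fin finite_dim_quasi_primary[of "int n"]]
  note IH = dim_filtered_forms[OF order_refl, of n]
  note rn = rank_nullity_subspace[OF linear_top_component[of "int n"] subspace_filtered_forms[of "2 * int n" "int n"], unfolded ker img, OF conjunct1[OF IH] tb(1)]
  show "finite_dim_subspace (fun_scale sc) (vector_forms (2 * int n))"
    unfolding vector_forms_eq_filtered by (rule rn(1))
  show "FV.dim (vector_forms (2 * int n)) =
      (\<Sum>j<n. FC.dim (scalar_forms (2 * int n - 2 * int j)) * V.dim (voa_grade A (int j)))
      + V.dim (quasi_primary A (int n))"
    unfolding vector_forms_eq_filtered rn(2) conjunct2[OF IH] tb(2) scalar_forms_weight_zero(2) mult_1 ..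
qed

end

lemma modular_forms_eq_scalar_forms:
  assumes "SL2R_group (SL2R_lift \<Gamma>)"
  shows "modular_forms k \<Gamma> = SL2R_group.scalar_forms (SL2R_lift \<Gamma>) k"
proof -
  interpret SL2R_group "SL2R_lift \<Gamma>" by fact
  have "slash k \<gamma> f \<tau> = f \<tau> \<longleftrightarrow> f (moebius_action \<gamma> \<tau>) = aut_factor \<gamma> \<tau> powi k * f \<tau>"
    if "\<gamma> \<in> SL2R_lift \<Gamma>" "\<tau> \<in> uhp" for \<gamma> f \<tau>
    using aut_factor_nonzero[OF det_one[OF that(1)] that(2)]
    by (auto simp: slash_def power_int_minus field_simps)
  then show ?thesis
    by (auto simp: modular_forms_def scalar_forms_def automorphic_def)
qed

theorem theorem8p4:
  fixes \<Gamma> :: "(real^2^2) set set" and g n :: nat and A :: "('v::ab_group_add) voa"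
  assumes "fuchsian \<Gamma>" and "torsion_free \<Gamma>" and "cocompact \<Gamma>"
    and "has_genus (orbit_surface \<Gamma>) g" and "g \<ge> 2"
    and "cft_type_voa A"
  shows "finite_dim_subspace (fun_scale (voa_scale A)) (voa_modular_forms A (2 * int n) \<Gamma>)
    \<and> (\<forall>j<n. finite_dim_subspace (fun_scale (*)) (modular_forms (2 * int n - 2 * int j) \<Gamma>))
    \<and> vector_space.dim (fun_scale (voa_scale A)) (voa_modular_forms A (2 * int n) \<Gamma>) =
        (\<Sum>j<n. vector_space.dim (fun_scale (*)) (modular_forms (2 * int n - 2 * int j) \<Gamma>)
               * vector_space.dim (voa_scale A) (voa_grade A (int j)))
        + vector_space.dim (voa_scale A) (quasi_primary A (int n))"
proof -
  interpret cft_type_voa A by fact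
  interpret cocompact_fuchsian_group "SL2R_lift \<Gamma>" using assms(1,3) by (rule cocompact_fuchsian_group_lift)
  interpret cocompact_group_voa "SL2R_lift \<Gamma>" A ..
  have M: "modular_forms k \<Gamma> = scalar_forms k" for k
    by (rule modular_forms_eq_scalar_forms[OF SL2R_group_axioms])
  have "voa_slash A k \<gamma> f \<tau> = f \<tau> \<longleftrightarrow>
      f (moebius_action \<gamma> \<tau>) = voa_scale A (aut_factor \<gamma> \<tau> powi k) (K_factor A \<gamma> \<tau> (f \<tau>))"
    if "\<gamma> \<in> SL2R_lift \<Gamma>" "\<tau> \<in> uhp" for k \<gamma> f \<tau>
    using voa_slash_fixed_iff[OF aut_factor_nonzero[OF det_one[OF that(1)] that(2)]] .
  then have VM: "voa_modular_forms A k \<Gamma> = vector_forms k" for k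
    unfolding voa_modular_forms_def vector_forms_def by auto
  have "finite_dim_subspace (fun_scale (*)) (scalar_forms (2 * int n - 2 * int j))" if "j < n" for j
  proof -
    have wt: "2 * int n - 2 * int j = 2 * int (n - j)" using that by linarith
    show ?thesis unfolding wt by (rule finite_dim_scalar_forms)
  qed
  then show ?thesis unfolding M VM using dim_vector_forms[of n] by blast
qed

end
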